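(* Let $k$ be an algebraically closed field, $Q_1$ the quiver with vertices $b,mid,e$ and arrows $b\to e$, $b\to mid$, $mid\to e$, and $\mathcal A=Rep_k(Q_1)\subset D^b(\mathcal A)$ the standard heart. Let $E_1^0,M,E_3^0$ be the simple representations with $k$ at the vertex $b$, $mid$, $e$, respectively. Let $Z:K(\mathcal A)\to\mathbb C$ be the stability function determined by values $Z(E_1^0),Z(M),Z(E_3^0)$ in the open upper half plane chosen so that, with $$\delta_Z=Z(M)+Z(E_1^0)+Z(E_3^0),$$ one has $$0<\arg Z(E_3^0)<\arg\big(Z(E_3^0)+Z(M)\big)<\arg Z(M)<\arg \delta_Z<\arg \big(Z(E_1^0)+Z(M)\big)<\arg Z(E_1^0)<\pi .$$ Let $\sigma=(\mathcal P,Z)\in\mathrm{Stab}(D^b(\mathcal A))$ be the unique stability condition with heart $\mathcal P((0,1])=\mathcal A$ and central charge $Z$. Then the set of stable phases $$P_\sigma=\{\exp(\mathrm i\pi\phi_\sigma(X)) : X \text{ a nonzero } \sigma\text{-semistable object of } D^b(\mathcal A)\}$$ has two (that is, exactly two) limit points in $\mathbb S^1$.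
   Context: $Rep_k(Q_1)$ is the category of finite-dimensional $k$-representations. $\mathrm{Stab}$ denotes the set of locally finite Bridgeland stability conditions; $\phi_\sigma(X)$ is the phase of a semistable object, normalized by $Z(X)\in\mathbb R_{>0}\exp(\mathrm i\pi\phi_\sigma(X))$. A stability function on $\mathcal A$ is a homomorphism $Z:K(\mathcal A)\to\mathbb C$ with $Z(X)\in\{r\exp(\mathrm i\pi t):r>0,\ 0<t\le1\}$ for all nonzero $X\in\mathcal A$. Since $\mathcal A$ has finite length with finitely many simple objects, each stability function on $\mathcal A$ determines a unique locally finite stability condition with heart $\mathcal A$ (Bridgeland). *)

theory Defs
  imports
    "HOL-Analysis.Complex_Transcendental"
    "HOL-Computational_Algebra.Polynomial"
    "HOL-Algebra.Free_Abelian_Groups"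
    "Jordan_Normal_Form.Matrix"
begin

section \<open>Representations of the quiver $Q_1$\<close>

datatype vertex = Vb | Vmid | Ve

datatype arrow = Abe | Abm | Ame

fun src :: "arrow \<Rightarrow> vertex" where
  "src Abe = Vb" | "src Abm = Vb" | "src Ame = Vmid"

fun tgt :: "arrow \<Rightarrow> vertex" where
  "tgt Abe = Ve" | "tgt Abm = Vmid" | "tgt Ame = Ve"

text \<open>Finite-dimensional representations are taken in coordinates: the space at a vertex \<open>i\<close> is
  $k^{d_i}$ and an arrow acts by a matrix on column vectors.\<close>

record 'k rep =
  rdim :: "vertex \<Rightarrow> nat"
  rmap :: "arrow \<Rightarrow> 'k mat"

definition is_rep :: "'k rep \<Rightarrow> bool" where
  "is_rep V \<longleftrightarrow> (\<forall>a. rmap V a \<in> carrier_mat (rdim V (tgt a)) (rdim V (src a)))"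

type_synonym 'k rmor = "vertex \<Rightarrow> 'k mat"

definition rep_hom :: "'k::field rep \<Rightarrow> 'k rep \<Rightarrow> 'k rmor set" where
  "rep_hom V W = {f. (\<forall>i. f i \<in> carrier_mat (rdim W i) (rdim V i)) \<and>
                     (\<forall>a. f (tgt a) * rmap V a = rmap W a * f (src a))}"

definition nonzero_rep :: "'k rep \<Rightarrow> bool" where
  "nonzero_rep V \<longleftrightarrow> (\<exists>i. rdim V i \<noteq> 0)"

definition zero_rep :: "'k::field rep" where
  "zero_rep = \<lparr>rdim = (\<lambda>_. 0), rmap = (\<lambda>_. 0\<^sub>m 0 0)\<rparr>"

definition simple_rep :: "vertex \<Rightarrow> 'k::field rep" where
  "simple_rep v = (let d = (\<lambda>i. if i = v then 1 else 0) in
     \<lparr>rdim = d, rmap = (\<lambda>a. 0\<^sub>m (d (tgt a)) (d (src a)))\<rparr>)"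

definition block_diag :: "'k::zero mat \<Rightarrow> 'k mat \<Rightarrow> 'k mat" where
  "block_diag A B = four_block_mat A (0\<^sub>m (dim_row A) (dim_col B)) (0\<^sub>m (dim_row B) (dim_col A)) B"

definition rep_sum :: "'k::field rep \<Rightarrow> 'k rep \<Rightarrow> 'k rep" where
  "rep_sum V W = \<lparr>rdim = (\<lambda>i. rdim V i + rdim W i), rmap = (\<lambda>a. block_diag (rmap V a) (rmap W a))\<rparr>"

definition short_exact :: "'k::field rep \<Rightarrow> 'k rep \<Rightarrow> 'k rep \<Rightarrow> bool" where
  "short_exact U V W \<longleftrightarrow> (\<exists>f\<in>rep_hom U V. \<exists>g\<in>rep_hom V W. \<forall>i.
     inj_on (\<lambda>x. f i *\<^sub>v x) (carrier_vec (rdim U i)) \<and>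
     (\<lambda>x. f i *\<^sub>v x) ` carrier_vec (rdim U i) =
       {y \<in> carrier_vec (rdim V i). g i *\<^sub>v y = 0\<^sub>v (rdim W i)} \<and>
     (\<lambda>y. g i *\<^sub>v y) ` carrier_vec (rdim V i) = carrier_vec (rdim W i))"


section \<open>Bounded complexes of representations\<close>

record 'k cpx =
  ob :: "int \<Rightarrow> 'k rep"
  dif :: "int \<Rightarrow> 'k rmor"

definition is_cpx :: "'k::field cpx \<Rightarrow> bool" where
  "is_cpx X \<longleftrightarrow>
     (\<forall>n. is_rep (ob X n)) \<and>
     (\<forall>n. dif X n \<in> rep_hom (ob X n) (ob X (n + 1))) \<and>
     (\<forall>n i. dif X (n + 1) i * dif X n i = 0\<^sub>m (rdim (ob X (n + 2)) i) (rdim (ob X n) i)) \<and>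
     (\<exists>N. \<forall>n. \<bar>n\<bar> > N \<longrightarrow> \<not> nonzero_rep (ob X n))"

type_synonym 'k cmap = "int \<Rightarrow> 'k rmor"

definition chain_map :: "'k::field cpx \<Rightarrow> 'k cpx \<Rightarrow> 'k cmap \<Rightarrow> bool" where
  "chain_map X Y f \<longleftrightarrow>
     (\<forall>n. f n \<in> rep_hom (ob X n) (ob Y n)) \<and>
     (\<forall>n i. dif Y n i * f n i = f (n + 1) i * dif X n i)"

definition cm_comp :: "'k::field cmap \<Rightarrow> 'k cmap \<Rightarrow> 'k cmap" (infixl "\<circ>\<^sub>c" 70) where
  "g \<circ>\<^sub>c f = (\<lambda>n i. g n i * f n i)"

definition cm_id :: "'k::field cpx \<Rightarrow> 'k cmap" where
  "cm_id X = (\<lambda>n i. 1\<^sub>m (rdim (ob X n) i))"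

definition cm_zero :: "'k::field cpx \<Rightarrow> 'k cpx \<Rightarrow> 'k cmap" where
  "cm_zero X Y = (\<lambda>n i. 0\<^sub>m (rdim (ob Y n) i) (rdim (ob X n) i))"

definition homotopic :: "'k::field cpx \<Rightarrow> 'k cpx \<Rightarrow> 'k cmap \<Rightarrow> 'k cmap \<Rightarrow> bool" where
  "homotopic X Y f g \<longleftrightarrow>
     (\<exists>h. (\<forall>n. h n \<in> rep_hom (ob X n) (ob Y (n - 1))) \<and>
          (\<forall>n i. f n i - g n i = dif Y (n - 1) i * h n i + h (n + 1) i * dif X n i))"

text \<open>Kernels and images of representations are computed vertexwise, so a chain map is a
  quasi-isomorphism iff at every vertex it is bijective on $\ker d^n / \mathrm{im}\, d^{n-1}$.\<close>

definition cycles :: "'k::field cpx \<Rightarrow> int \<Rightarrow> vertex \<Rightarrow> 'k vec set" where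
  "cycles X n i = {x \<in> carrier_vec (rdim (ob X n) i). dif X n i *\<^sub>v x = 0\<^sub>v (rdim (ob X (n + 1)) i)}"

definition boundaries :: "'k::field cpx \<Rightarrow> int \<Rightarrow> vertex \<Rightarrow> 'k vec set" where
  "boundaries X n i = (\<lambda>x. dif X (n - 1) i *\<^sub>v x) ` carrier_vec (rdim (ob X (n - 1)) i)"

definition quasi_iso :: "'k::field cpx \<Rightarrow> 'k cpx \<Rightarrow> 'k cmap \<Rightarrow> bool" where
  "quasi_iso X Y f \<longleftrightarrow> chain_map X Y f \<and>
     (\<forall>n i. (\<forall>x\<in>cycles X n i. f n i *\<^sub>v x \<in> boundaries Y n i \<longrightarrow> x \<in> boundaries X n i) \<and>
            (\<forall>y\<in>cycles Y n i. \<exists>x\<in>cycles X n i. y - f n i *\<^sub>v x \<in> boundaries Y n i))"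

definition zero_cpx :: "'k::field cpx" where
  "zero_cpx = \<lparr>ob = (\<lambda>_. zero_rep), dif = (\<lambda>_ _. 0\<^sub>m 0 0)\<rparr>"

text \<open>The embedding of representations as complexes concentrated in degree 0.\<close>

definition stalk :: "'k::field rep \<Rightarrow> 'k cpx" where
  "stalk V = (let A = (\<lambda>n. if n = 0 then V else zero_rep) in
     \<lparr>ob = A, dif = (\<lambda>n i. 0\<^sub>m (rdim (A (n + 1)) i) (rdim (A n) i))\<rparr>)"

definition shift :: "'k::field cpx \<Rightarrow> 'k cpx" where
  "shift X = \<lparr>ob = (\<lambda>n. ob X (n + 1)), dif = (\<lambda>n i. - dif X (n + 1) i)\<rparr>"

definition cm_shift :: "'k cmap \<Rightarrow> 'k cmap" where
  "cm_shift f = (\<lambda>n. f (n + 1))"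

definition cpx_sum :: "'k::field cpx \<Rightarrow> 'k cpx \<Rightarrow> 'k cpx" where
  "cpx_sum X Y = \<lparr>ob = (\<lambda>n. rep_sum (ob X n) (ob Y n)),
                  dif = (\<lambda>n i. block_diag (dif X n i) (dif Y n i))\<rparr>"

text \<open>The mapping cone $X[1] \oplus Y$ of \<open>f\<close>, with $d(x, y) = (-dx, fx + dy)$.\<close>

definition cone :: "'k::field cpx \<Rightarrow> 'k cpx \<Rightarrow> 'k cmap \<Rightarrow> 'k cpx" where
  "cone X Y f = \<lparr>ob = (\<lambda>n. rep_sum (ob X (n + 1)) (ob Y n)),
     dif = (\<lambda>n i. four_block_mat
              (- dif X (n + 1) i) (0\<^sub>m (rdim (ob X (n + 2)) i) (rdim (ob Y n) i))
              (f (n + 1) i)       (dif Y n i))\<rparr>"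

definition cone_incl :: "'k::field cpx \<Rightarrow> 'k cpx \<Rightarrow> 'k cmap" where
  "cone_incl X Y = (\<lambda>n i. let a = rdim (ob X (n + 1)) i; b = rdim (ob Y n) i in
     four_block_mat (0\<^sub>m a b) (0\<^sub>m a 0) (1\<^sub>m b) (0\<^sub>m b 0))"

definition cone_proj :: "'k::field cpx \<Rightarrow> 'k cpx \<Rightarrow> 'k cmap" where
  "cone_proj X Y = (\<lambda>n i. let a = rdim (ob X (n + 1)) i; b = rdim (ob Y n) i in
     four_block_mat (1\<^sub>m a) (0\<^sub>m a b) (0\<^sub>m 0 a) (0\<^sub>m 0 b))"


section \<open>The bounded derived category\<close>

text \<open>Objects are the bounded complexes. Morphisms are equivalence classes of roofs
  $X \leftarrow W \rightarrow Y$ in the homotopy category, the left leg being a quasi-isomorphism.\<close>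

definition Db_obj :: "'k::field cpx set" where
  "Db_obj = {X. is_cpx X}"

type_synonym 'k roof = "'k cpx \<times> 'k cmap \<times> 'k cmap"

definition roofs :: "'k::field cpx \<Rightarrow> 'k cpx \<Rightarrow> 'k roof set" where
  "roofs X Y = {(W, s, f). is_cpx W \<and> quasi_iso W X s \<and> chain_map W Y f}"

definition roof_eq :: "'k::field cpx \<Rightarrow> 'k cpx \<Rightarrow> ('k roof \<times> 'k roof) set" where
  "roof_eq X Y = {((W, s, f), (W', s', f')). (W, s, f) \<in> roofs X Y \<and> (W', s', f') \<in> roofs X Y \<and>
     (\<exists>V u v. is_cpx V \<and> quasi_iso V W u \<and> quasi_iso V W' v \<and>
        homotopic V X (s \<circ>\<^sub>c u) (s' \<circ>\<^sub>c v) \<and> homotopic V Y (f \<circ>\<^sub>c u) (f' \<circ>\<^sub>c v))}"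

definition Db_hom :: "'k::field cpx \<Rightarrow> 'k cpx \<Rightarrow> 'k roof set set" where
  "Db_hom X Y = roofs X Y // roof_eq X Y"

definition Db_of :: "'k::field cpx \<Rightarrow> 'k cpx \<Rightarrow> 'k cmap \<Rightarrow> 'k roof set" where
  "Db_of X Y f = roof_eq X Y `` {(X, cm_id X, f)}"

definition Db_id :: "'k::field cpx \<Rightarrow> 'k roof set" where
  "Db_id X = Db_of X X (cm_id X)"

definition Db_zero :: "'k::field cpx \<Rightarrow> 'k cpx \<Rightarrow> 'k roof set" where
  "Db_zero X Y = Db_of X Y (cm_zero X Y)"

text \<open>A composite of the roofs $X \leftarrow W \rightarrow Y$ and $Y \leftarrow W' \rightarrow Z$ is any
  roof $X \leftarrow W \leftarrow V \rightarrow W' \rightarrow Z$ whose middle square commutes up to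
  homotopy and whose leg $V \to W$ is a quasi-isomorphism.\<close>

definition Db_comp ::
    "'k::field cpx \<Rightarrow> 'k cpx \<Rightarrow> 'k cpx \<Rightarrow> 'k roof set \<Rightarrow> 'k roof set \<Rightarrow> 'k roof set" where
  "Db_comp X Y Z \<psi> \<phi> = {r. \<exists>W s f W' t g V h k. (W, s, f) \<in> \<phi> \<and> (W', t, g) \<in> \<psi> \<and>
      is_cpx V \<and> quasi_iso V W h \<and> chain_map V W' k \<and> homotopic V Y (f \<circ>\<^sub>c h) (t \<circ>\<^sub>c k) \<and>
      ((V, s \<circ>\<^sub>c h, g \<circ>\<^sub>c k), r) \<in> roof_eq X Z}"

definition Db_shift :: "'k::field roof set \<Rightarrow> 'k roof set" where
  "Db_shift \<phi> = (\<lambda>(W, s, f). (shift W, cm_shift s, cm_shift f)) ` \<phi>"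

definition Db_iso :: "'k::field cpx \<Rightarrow> 'k cpx \<Rightarrow> 'k roof set \<Rightarrow> bool" where
  "Db_iso X Y \<phi> \<longleftrightarrow> \<phi> \<in> Db_hom X Y \<and>
     (\<exists>\<psi>\<in>Db_hom Y X. Db_comp X Y X \<psi> \<phi> = Db_id X \<and> Db_comp Y X Y \<phi> \<psi> = Db_id Y)"

definition Db_isomorphic :: "'k::field cpx \<Rightarrow> 'k cpx \<Rightarrow> bool" where
  "Db_isomorphic X Y \<longleftrightarrow> (\<exists>\<phi>. Db_iso X Y \<phi>)"

definition Db_nonzero :: "'k::field cpx \<Rightarrow> bool" where
  "Db_nonzero X \<longleftrightarrow> \<not> Db_isomorphic X zero_cpx"

text \<open>Distinguished triangles $X \to Y \to Z \to X[1]$: those isomorphic to a cone triangle.\<close>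

definition dist_triangle :: "'k::field cpx \<Rightarrow> 'k cpx \<Rightarrow> 'k cpx \<Rightarrow>
    'k roof set \<Rightarrow> 'k roof set \<Rightarrow> 'k roof set \<Rightarrow> bool" where
  "dist_triangle X Y Z u v w \<longleftrightarrow>
     X \<in> Db_obj \<and> Y \<in> Db_obj \<and> Z \<in> Db_obj \<and>
     u \<in> Db_hom X Y \<and> v \<in> Db_hom Y Z \<and> w \<in> Db_hom Z (shift X) \<and>
     (\<exists>X' Y' f a b c. X' \<in> Db_obj \<and> Y' \<in> Db_obj \<and> chain_map X' Y' f \<and>
        (let C = cone X' Y' f in
          Db_iso X X' a \<and> Db_iso Y Y' b \<and> Db_iso Z C c \<and>
          Db_comp X Y Y' b u = Db_comp X X' Y' (Db_of X' Y' f) a \<and>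
          Db_comp Y Z C c v = Db_comp Y Y' C (Db_of Y' C (cone_incl X' Y')) b \<and>
          Db_comp Z (shift X) (shift X') (Db_shift a) w =
            Db_comp Z C (shift X') (Db_of C (shift X') (cone_proj X' Y')) c))"

definition triangle :: "'k::field cpx \<Rightarrow> 'k cpx \<Rightarrow> 'k cpx \<Rightarrow> bool" where
  "triangle X Y Z \<longleftrightarrow> (\<exists>u v w. dist_triangle X Y Z u v w)"

definition std_heart :: "'k::field cpx set" where
  "std_heart = {X \<in> Db_obj. \<exists>V. is_rep V \<and> Db_isomorphic X (stalk V)}"


section \<open>Grothendieck groups\<close>

text \<open>The free abelian group on the objects modulo $[B] - [A] - [C]$ for all \<open>T A B C\<close>, where \<open>T\<close> says
  that there is a short exact sequence (or distinguished triangle) with terms \<open>A\<close>, \<open>B\<close>, \<open>C\<close>.\<close>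

definition K_rel :: "'o set \<Rightarrow> ('o \<Rightarrow> 'o \<Rightarrow> 'o \<Rightarrow> bool) \<Rightarrow> ('o \<Rightarrow>\<^sub>0 int) set" where
  "K_rel Ob T = generate (free_Abelian_group Ob)
     {frag_of B - frag_of A - frag_of C | A B C. A \<in> Ob \<and> B \<in> Ob \<and> C \<in> Ob \<and> T A B C}"

definition K_group :: "'o set \<Rightarrow> ('o \<Rightarrow> 'o \<Rightarrow> 'o \<Rightarrow> bool) \<Rightarrow> ('o \<Rightarrow>\<^sub>0 int) set monoid" where
  "K_group Ob T = free_Abelian_group Ob Mod K_rel Ob T"

definition K_class :: "'o set \<Rightarrow> ('o \<Rightarrow> 'o \<Rightarrow> 'o \<Rightarrow> bool) \<Rightarrow> 'o \<Rightarrow> ('o \<Rightarrow>\<^sub>0 int) set" where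
  "K_class Ob T X = K_rel Ob T #>\<^bsub>free_Abelian_group Ob\<^esub> frag_of X"

definition complex_add_group :: "complex monoid" where
  "complex_add_group = \<lparr>carrier = UNIV, monoid.mult = (+), one = 0\<rparr>"

abbreviation K_rep :: "('k::field rep \<Rightarrow>\<^sub>0 int) set monoid" where
  "K_rep \<equiv> K_group {V. is_rep V} short_exact"

abbreviation rep_class :: "'k::field rep \<Rightarrow> ('k rep \<Rightarrow>\<^sub>0 int) set" where
  "rep_class \<equiv> K_class {V. is_rep V} short_exact"

abbreviation K_Db :: "('k::field cpx \<Rightarrow>\<^sub>0 int) set monoid" where
  "K_Db \<equiv> K_group Db_obj triangle"

abbreviation Db_class :: "'k::field cpx \<Rightarrow> ('k cpx \<Rightarrow>\<^sub>0 int) set" where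
  "Db_class \<equiv> K_class Db_obj triangle"


section \<open>Stability functions and stability conditions\<close>

definition stability_function :: "(('k::field rep \<Rightarrow>\<^sub>0 int) set \<Rightarrow> complex) \<Rightarrow> bool" where
  "stability_function Z \<longleftrightarrow> Z \<in> hom K_rep complex_add_group \<and>
     (\<forall>V. is_rep V \<and> nonzero_rep V \<longrightarrow>
        (\<exists>r t. r > 0 \<and> 0 < t \<and> t \<le> 1 \<and>
           Z (rep_class V) = of_real r * exp (\<i> * of_real pi * of_real t)))"

text \<open>Full additive subcategories, always taken to be closed under isomorphism.\<close>

definition additive_subcat :: "'k::field cpx set \<Rightarrow> bool" where
  "additive_subcat C \<longleftrightarrow> C \<subseteq> Db_obj \<and> zero_cpx \<in> C \<and>
     (\<forall>X\<in>C. \<forall>Y\<in>Db_obj. Db_isomorphic X Y \<longrightarrow> Y \<in> C) \<and>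
     (\<forall>X\<in>C. \<forall>Y\<in>C. cpx_sum X Y \<in> C)"

definition slicing :: "(real \<Rightarrow> 'k::field cpx set) \<Rightarrow> bool" where
  "slicing P \<longleftrightarrow>
     (\<forall>\<phi>. additive_subcat (P \<phi>)) \<and>
     (\<forall>\<phi>. P (\<phi> + 1) = shift ` P \<phi>) \<and>
     (\<forall>\<phi> \<psi>. \<phi> > \<psi> \<longrightarrow> (\<forall>X\<in>P \<phi>. \<forall>Y\<in>P \<psi>. Db_hom X Y = {Db_zero X Y})) \<and>
     (\<forall>X\<in>Db_obj. Db_nonzero X \<longrightarrow>
        (\<exists>(n::nat) \<phi> E A. E 0 = zero_cpx \<and> E n = X \<and>
           (\<forall>i j. i < j \<and> j < n \<longrightarrow> \<phi> i > \<phi> j) \<and>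
           (\<forall>i<n. A i \<in> P (\<phi> i) \<and> triangle (E i) (E (Suc i)) (A i))))"

text \<open>\<open>slice_interval P I\<close> is the extension-closed subcategory $\mathcal P(I)$ generated by the
  $\mathcal P(\phi)$ with $\phi \in I$.\<close>

inductive_set slice_interval :: "(real \<Rightarrow> 'k::field cpx set) \<Rightarrow> real set \<Rightarrow> 'k cpx set"
  for P I where
  slice: "\<phi> \<in> I \<Longrightarrow> X \<in> P \<phi> \<Longrightarrow> X \<in> slice_interval P I"
| extension: "X \<in> slice_interval P I \<Longrightarrow> Z \<in> slice_interval P I \<Longrightarrow> triangle X Y Z \<Longrightarrow>
    Y \<in> slice_interval P I"

text \<open>In a quasi-abelian category the strict monomorphisms are the kernels.\<close>

definition strict_subobject ::
    "'k::field cpx set \<Rightarrow> 'k cpx \<Rightarrow> 'k cpx \<Rightarrow> 'k roof set \<Rightarrow> bool" where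
  "strict_subobject C A X m \<longleftrightarrow> A \<in> C \<and> X \<in> C \<and> m \<in> Db_hom A X \<and>
     (\<exists>B\<in>C. \<exists>g\<in>Db_hom X B. Db_comp A X B g m = Db_zero A B \<and>
        (\<forall>T\<in>C. \<forall>t\<in>Db_hom T X. Db_comp T X B g t = Db_zero T B \<longrightarrow>
           (\<exists>!t'. t' \<in> Db_hom T A \<and> Db_comp T A X m t' = t)))"

definition noetherian_cat :: "'k::field cpx set \<Rightarrow> bool" where
  "noetherian_cat C \<longleftrightarrow> (\<forall>X A m.
     (\<forall>i::nat. strict_subobject C (A i) X (m i) \<and>
        (\<exists>j\<in>Db_hom (A i) (A (Suc i)). Db_comp (A i) (A (Suc i)) X (m (Suc i)) j = m i)) \<longrightarrow>
     (\<exists>N. \<forall>i\<ge>N. \<exists>j. Db_iso (A i) (A (Suc i)) j \<and>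
        Db_comp (A i) (A (Suc i)) X (m (Suc i)) j = m i))"

definition artinian_cat :: "'k::field cpx set \<Rightarrow> bool" where
  "artinian_cat C \<longleftrightarrow> (\<forall>X A m.
     (\<forall>i::nat. strict_subobject C (A i) X (m i) \<and>
        (\<exists>j\<in>Db_hom (A (Suc i)) (A i). Db_comp (A (Suc i)) (A i) X (m i) j = m (Suc i))) \<longrightarrow>
     (\<exists>N. \<forall>i\<ge>N. \<exists>j. Db_iso (A (Suc i)) (A i) j \<and>
        Db_comp (A (Suc i)) (A i) X (m i) j = m (Suc i)))"

text \<open>The intervals have length below 1, which is what makes $\mathcal P((t-\eta,t+\eta))$
  quasi-abelian; if the condition holds for some $\eta$ it holds for all smaller ones.\<close>

definition locally_finite :: "(real \<Rightarrow> 'k::field cpx set) \<Rightarrow> bool" where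
  "locally_finite P \<longleftrightarrow> (\<exists>\<eta>. 0 < \<eta> \<and> \<eta> < 1 / 2 \<and>
     (\<forall>t. noetherian_cat (slice_interval P {t - \<eta> <..< t + \<eta>}) \<and>
          artinian_cat (slice_interval P {t - \<eta> <..< t + \<eta>})))"

definition Stab ::
    "((real \<Rightarrow> 'k::field cpx set) \<times> (('k cpx \<Rightarrow>\<^sub>0 int) set \<Rightarrow> complex)) set" where
  "Stab = {(P, W). slicing P \<and> W \<in> hom K_Db complex_add_group \<and>
     (\<forall>\<phi>. \<forall>X\<in>P \<phi>. Db_nonzero X \<longrightarrow>
        (\<exists>r>0. W (Db_class X) = of_real r * exp (\<i> * of_real pi * of_real \<phi>))) \<and>
     locally_finite P}"

text \<open>The heart is $\mathcal P((0,1])$, and the central charge is \<open>Z\<close> under the isomorphism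
  $K(\mathcal A) \cong K(D^b(\mathcal A))$ induced by the inclusion of the standard heart.\<close>

definition has_heart_and_charge ::
    "((real \<Rightarrow> 'k::field cpx set) \<times> (('k cpx \<Rightarrow>\<^sub>0 int) set \<Rightarrow> complex)) \<Rightarrow>
     (('k rep \<Rightarrow>\<^sub>0 int) set \<Rightarrow> complex) \<Rightarrow> bool" where
  "has_heart_and_charge \<sigma> Z \<longleftrightarrow> slice_interval (fst \<sigma>) {0 <.. 1} = std_heart \<and>
     (\<forall>V. is_rep V \<longrightarrow> snd \<sigma> (Db_class (stalk V)) = Z (rep_class V))"

text \<open>A nonzero object is semistable of phase \<open>\<phi>\<close> iff it lies in $\mathcal P(\phi)$.\<close>

definition stable_phases ::
    "(real \<Rightarrow> 'k::field cpx set) \<times> (('k cpx \<Rightarrow>\<^sub>0 int) set \<Rightarrow> complex) \<Rightarrow> complex set" where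
  "stable_phases \<sigma> = {exp (\<i> * of_real pi * of_real \<phi>) | \<phi> X. X \<in> fst \<sigma> \<phi> \<and> Db_nonzero X}"

end

theory Submission
  imports Defs "Jordan_Normal_Form.Char_Poly"
begin

text \<open>The limit points are the two directions \<open>\<plusminus> sgn \<delta>\<close>, where \<open>\<delta>\<close> is the charge of the
dimension vector $(1,1,1)$ that spans the radical of the Euler form.

No other limit points. Up to a shift, which changes the sign of $\exp(\mathrm i\pi\phi)$, a phase
comes from a representation \<open>V\<close> with \<open>stalk V \<in> P \<phi>\<close>. Among the slope-semistable
representations of this argument one of least dimension has only scalar endomorphisms, because the
kernel of an endomorphism is semistable of the same argument (\<open>semistable_brick\<close>). Endomorphisms
are the solutions of a linear system with $\sum_i d_i^2$ unknowns and $\sum_a d_{t(a)} d_{s(a)}$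
equations, so the Euler form of the dimension vector is at most 1 (\<open>brick_dims\<close>). It is half the
sum of the squares of the differences of the entries, so the entries differ by at most 1 and the
charge is \<open>n\<delta> + w\<close> with \<open>w\<close> in a finite set. For fixed \<open>w\<close> the directions of these charges
tend to that of \<open>\<delta>\<close>.

Both are limit points. The representations \<open>preproj n\<close> of dimension $(n,n,n+1)$ have charge
\<open>n\<delta> + e\<close>, whose argument tends to that of \<open>\<delta>\<close>, while all their nonzero subrepresentations have
argument strictly below that of \<open>\<delta>\<close> (\<open>preproj_sub_dims\<close>). The first Harder-Narasimhan piece of
\<open>preproj n\<close> is a subrepresentation of at least the same argument, so its phase is squeezed towards
that of \<open>\<delta>\<close> without reaching it.

Both halves need a passage from the derived category to representations. For a nonzero
representation, \<open>HN_sub\<close> provides a nonzero subrepresentation whose stalk complex lies in some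
\<open>P \<phi>\<close> with \<open>\<phi>\<close> not below the phase of the representation; since the stalk embedding is faithful
on morphisms (\<open>stalk_hom_faithful\<close>), the vanishing of morphisms to smaller phases then makes every
representation with stalk in \<open>P \<phi>\<close> slope-semistable (\<open>semistable_sub\<close>). All this is read off from
cohomology: a roof acts on cohomology through the converse of a relation given by a
quasi-isomorphism, and distinguished triangles give exact sequences (\<open>triangle_exact\<close>).\<close>

section \<open>Subspaces, cycles and boundaries\<close>

definition lin_subspace :: "nat \<Rightarrow> 'k::field vec set \<Rightarrow> bool" where
  "lin_subspace n S \<longleftrightarrow> S \<subseteq> carrier_vec n \<and> 0\<^sub>v n \<in> S \<and> (\<forall>x\<in>S. \<forall>y\<in>S. x + y \<in> S) \<and>
     (\<forall>c. \<forall>x\<in>S. c \<cdot>\<^sub>v x \<in> S)"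

lemma lin_subspaceD:
  assumes "lin_subspace n S"
  shows "x \<in> S \<Longrightarrow> x \<in> carrier_vec n" "0\<^sub>v n \<in> S" "x \<in> S \<Longrightarrow> y \<in> S \<Longrightarrow> x + y \<in> S"
    "x \<in> S \<Longrightarrow> c \<cdot>\<^sub>v x \<in> S"
  using assms by (auto simp: lin_subspace_def)

lemma lin_subspace_diff:
  assumes "lin_subspace n S" "x \<in> S" "y \<in> S"
  shows "x - y \<in> S"
proof -
  have "x + (-1) \<cdot>\<^sub>v y \<in> S" using lin_subspaceD[OF assms(1)] assms by blast
  moreover have "x + (-1) \<cdot>\<^sub>v y = x - y"
    using lin_subspaceD(1)[OF assms(1)] assms by (intro eq_vecI) auto
  ultimately show ?thesis by simp
qed

lemma lin_subspace_uminus: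
  assumes "lin_subspace n S" "x \<in> S"
  shows "- x \<in> S"
proof -
  have "(-1) \<cdot>\<^sub>v x \<in> S" using lin_subspaceD[OF assms(1)] assms by blast
  moreover have "(-1) \<cdot>\<^sub>v x = - x"
    using lin_subspaceD(1)[OF assms(1)] assms by (intro eq_vecI) auto
  ultimately show ?thesis by simp
qed

lemma mult_mat_vec_0:
  "A \<in> carrier_mat nr nc \<Longrightarrow> A *\<^sub>v 0\<^sub>v nc = (0\<^sub>v nr :: 'k::field vec)"
  by (intro eq_vecI) auto

lemma zero_mult_mat_vec: "x \<in> carrier_vec nc \<Longrightarrow> 0\<^sub>m nr nc *\<^sub>v x = (0\<^sub>v nr :: 'k::field vec)"
  by (intro eq_vecI) auto

lemma lin_subspace_kernel:
  assumes "A \<in> carrier_mat nr nc"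
  shows "lin_subspace nc {x \<in> carrier_vec nc. A *\<^sub>v x = (0\<^sub>v nr :: 'k::field vec)}"
  using assms
  by (auto simp: lin_subspace_def mult_mat_vec_0 mult_add_distrib_mat_vec[OF assms] mult_mat_vec[OF assms])

lemma lin_subspace_image:
  assumes A: "(A :: 'k::field mat) \<in> carrier_mat nr nc"
  shows "lin_subspace nr ((\<lambda>x. A *\<^sub>v x) ` carrier_vec nc)"
proof -
  have "A *\<^sub>v x + A *\<^sub>v y \<in> (\<lambda>x. A *\<^sub>v x) ` carrier_vec nc"
    if "x \<in> carrier_vec nc" "y \<in> carrier_vec nc" for x y
    using mult_add_distrib_mat_vec[OF A that] that by (metis add_carrier_vec imageI)
  moreover have "c \<cdot>\<^sub>v (A *\<^sub>v x) \<in> (\<lambda>x. A *\<^sub>v x) ` carrier_vec nc"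
    if "x \<in> carrier_vec nc" for x c
    using mult_mat_vec[OF A that] that by (metis smult_carrier_vec imageI)
  moreover have "0\<^sub>v nr \<in> (\<lambda>x. A *\<^sub>v x) ` carrier_vec nc"
    using mult_mat_vec_0[OF A] by (metis zero_carrier_vec imageI)
  ultimately show ?thesis using A by (auto simp: lin_subspace_def)
qed

abbreviation cvec :: "'k::field cpx \<Rightarrow> int \<Rightarrow> vertex \<Rightarrow> 'k vec set" where
  "cvec X n i \<equiv> carrier_vec (rdim (ob X n) i)"

lemma rep_hom_carrier: "f \<in> rep_hom V W \<Longrightarrow> f i \<in> carrier_mat (rdim W i) (rdim V i)"
  by (auto simp: rep_hom_def)

lemma rep_hom_arrow:
  assumes "f \<in> rep_hom V W" "is_rep V" "is_rep W" "x \<in> carrier_vec (rdim V (src a))"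
  shows "f (tgt a) *\<^sub>v (rmap V a *\<^sub>v x) = rmap W a *\<^sub>v (f (src a) *\<^sub>v x)"
proof -
  have 1: "f (tgt a) \<in> carrier_mat (rdim W (tgt a)) (rdim V (tgt a))"
    "f (src a) \<in> carrier_mat (rdim W (src a)) (rdim V (src a))"
    "rmap V a \<in> carrier_mat (rdim V (tgt a)) (rdim V (src a))"
    "rmap W a \<in> carrier_mat (rdim W (tgt a)) (rdim W (src a))"
    using assms by (auto simp: rep_hom_def is_rep_def)
  have "f (tgt a) * rmap V a = rmap W a * f (src a)"
    using assms by (auto simp: rep_hom_def)
  then show ?thesis using assoc_mult_mat_vec[OF 1(1) 1(3) assms(4)] assoc_mult_mat_vec[OF 1(4) 1(2) assms(4)]
    by simp
qed

lemma rmap_carrier_vec: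
  assumes "is_rep V" "x \<in> carrier_vec (rdim V (src a))"
  shows "rmap V a *\<^sub>v x \<in> carrier_vec (rdim V (tgt a))"
  using assms by (auto simp: is_rep_def intro!: mult_mat_vec_carrier)

lemma is_cpx_rep: "is_cpx X \<Longrightarrow> is_rep (ob X n)" by (auto simp: is_cpx_def)

lemma is_cpx_dif_hom: "is_cpx X \<Longrightarrow> dif X n \<in> rep_hom (ob X n) (ob X (n + 1))"
  by (auto simp: is_cpx_def)

lemma chain_map_hom: "chain_map X Y f \<Longrightarrow> f n \<in> rep_hom (ob X n) (ob Y n)"
  by (auto simp: chain_map_def)

lemma dif_carrier: "is_cpx X \<Longrightarrow> dif X n i \<in> carrier_mat (rdim (ob X (n+1)) i) (rdim (ob X n) i)"
  using is_cpx_dif_hom rep_hom_carrier by blast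

lemma dif_carrier_pred:
  "is_cpx X \<Longrightarrow> dif X (n-1) i \<in> carrier_mat (rdim (ob X n) i) (rdim (ob X (n-1)) i)"
  using dif_carrier[of X "n-1" i] by simp

lemma chain_map_carrier:
  "chain_map X Y f \<Longrightarrow> f n i \<in> carrier_mat (rdim (ob Y n) i) (rdim (ob X n) i)"
  using chain_map_hom rep_hom_carrier by blast

lemma dif_dif:
  assumes "is_cpx X" "x \<in> cvec X n i"
  shows "dif X (n+1) i *\<^sub>v (dif X n i *\<^sub>v x) = 0\<^sub>v (rdim (ob X (n+2)) i)"
proof -
  have 1: "dif X (n+1) i \<in> carrier_mat (rdim (ob X (n+2)) i) (rdim (ob X (n+1)) i)"
    using dif_carrier[OF assms(1), of "n+1" i] by (simp add: add.assoc)
  have "dif X (n+1) i * dif X n i = 0\<^sub>m (rdim (ob X (n + 2)) i) (rdim (ob X n) i)"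
    using assms by (auto simp: is_cpx_def)
  then show ?thesis using assoc_mult_mat_vec[OF 1 dif_carrier[OF assms(1)] assms(2)] assms(2)
    by (simp add: zero_mult_mat_vec[OF assms(2)])
qed

lemma chain_map_dif:
  assumes "is_cpx X" "is_cpx Y" "chain_map X Y f" "x \<in> cvec X n i"
  shows "dif Y n i *\<^sub>v (f n i *\<^sub>v x) = f (n+1) i *\<^sub>v (dif X n i *\<^sub>v x)"
proof -
  have "dif Y n i * f n i = f (n + 1) i * dif X n i" using assms by (auto simp: chain_map_def)
  then show ?thesis
    using assoc_mult_mat_vec[OF dif_carrier[OF assms(2)] chain_map_carrier[OF assms(3)] assms(4)]
      assoc_mult_mat_vec[OF chain_map_carrier[OF assms(3)] dif_carrier[OF assms(1)] assms(4)]
    by simp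
qed

lemma cycles_subspace:
  assumes "is_cpx X" shows "lin_subspace (rdim (ob X n) i) (cycles X n i)"
  unfolding cycles_def by (rule lin_subspace_kernel[OF dif_carrier[OF assms]])

lemma boundaries_subspace:
  assumes "is_cpx X" shows "lin_subspace (rdim (ob X n) i) (boundaries X n i)"
  unfolding boundaries_def by (rule lin_subspace_image[OF dif_carrier_pred[OF assms]])

lemma cycles_carrier: "x \<in> cycles X n i \<Longrightarrow> x \<in> cvec X n i"
  by (auto simp: cycles_def)

lemma dif_boundary:
  "x \<in> cvec X n i \<Longrightarrow> dif X n i *\<^sub>v x \<in> boundaries X (n+1) i"
  by (auto simp: boundaries_def)

lemma boundariesE:
  assumes "y \<in> boundaries X (n+1) i"
  obtains x where "x \<in> cvec X n i" "y = dif X n i *\<^sub>v x"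
  using assms by (auto simp: boundaries_def)

lemma chain_map_cycles:
  assumes "is_cpx X" "is_cpx Y" "chain_map X Y f" "x \<in> cycles X n i"
  shows "f n i *\<^sub>v x \<in> cycles Y n i"
proof -
  have x: "x \<in> cvec X n i" "dif X n i *\<^sub>v x = 0\<^sub>v (rdim (ob X (n+1)) i)"
    using assms by (auto simp: cycles_def)
  then show ?thesis
    using chain_map_dif[OF assms(1-3) x(1)] mult_mat_vec_0[OF chain_map_carrier[OF assms(3)], of "n+1" i]
      mult_mat_vec_carrier[OF chain_map_carrier[OF assms(3)] x(1)]
    by (auto simp: cycles_def)
qed

lemma chain_map_boundaries:
  assumes "is_cpx X" "is_cpx Y" "chain_map X Y f" "x \<in> boundaries X n i"
  shows "f n i *\<^sub>v x \<in> boundaries Y n i"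
proof -
  have "x \<in> boundaries X ((n-1)+1) i" using assms by simp
  then obtain w where w: "w \<in> cvec X (n-1) i" "x = dif X (n-1) i *\<^sub>v w"
    by (rule boundariesE)
  have "f n i *\<^sub>v x = dif Y (n-1) i *\<^sub>v (f (n-1) i *\<^sub>v w)"
    using chain_map_dif[OF assms(1-3) w(1)] w(2) by simp
  then show ?thesis
    using dif_boundary[of "f (n-1) i *\<^sub>v w" Y "n-1" i] mult_mat_vec_carrier[OF chain_map_carrier[OF assms(3)] w(1)]
    by simp
qed

lemma vec_diff_identities:
  assumes "x \<in> carrier_vec n" "y \<in> carrier_vec n" "z \<in> carrier_vec n" "w \<in> carrier_vec n"
  shows "x - x = (0\<^sub>v n :: 'k::field vec)"
    "x - y = - (y - x)" "(x - y) + (y - z) = x - z"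
    "(x + y) - (z + w) = (x - z) + (y - w)" "c \<cdot>\<^sub>v x - c \<cdot>\<^sub>v y = c \<cdot>\<^sub>v (x - y)"
    "(x - y) + y = x" "x - (x - y) = y" "0\<^sub>v n - x = - x"
  using assms by (auto intro!: eq_vecI simp: algebra_simps)

section \<open>Maps on cohomology as relations between cycles\<close>

text \<open>Cohomology is not formed as a quotient space. A map on cohomology is recorded as the relation between
cycles that holds when the image of the first has the same class as the second; composition of maps
is then relational composition, and the inverse of an isomorphism is the converse relation.\<close>

definition hmap :: "'k::field cpx \<Rightarrow> 'k cpx \<Rightarrow> 'k cmap \<Rightarrow> int \<Rightarrow> vertex \<Rightarrow> ('k vec \<times> 'k vec) set" where
  "hmap X Y f n i = {(x, y). x \<in> cycles X n i \<and> y \<in> cycles Y n i \<and> f n i *\<^sub>v x - y \<in> boundaries Y n i}"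

text \<open>Equality of cohomology classes: the identity morphism for relations of this kind.\<close>

definition hid :: "'k::field cpx \<Rightarrow> int \<Rightarrow> vertex \<Rightarrow> ('k vec \<times> 'k vec) set" where
  "hid X n i = {(x, y). x \<in> cycles X n i \<and> y \<in> cycles X n i \<and> x - y \<in> boundaries X n i}"

lemma hmap_id: "hmap X X (cm_id X) = hid X"
  by (auto simp: hmap_def hid_def cm_id_def cycles_def intro!: ext)

lemma hid_refl: "is_cpx X \<Longrightarrow> x \<in> cycles X n i \<Longrightarrow> (x, x) \<in> hid X n i"
  using lin_subspaceD(2)[OF boundaries_subspace] vec_diff_identities(1)
  by (fastforce simp: hid_def dest: cycles_carrier)

lemma hid_sym: "is_cpx X \<Longrightarrow> (x, y) \<in> hid X n i \<Longrightarrow> (y, x) \<in> hid X n i"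
  using lin_subspace_uminus[OF boundaries_subspace] vec_diff_identities(2)
  by (fastforce simp: hid_def dest: cycles_carrier)

lemma hid_trans:
  assumes "is_cpx X" "(x, y) \<in> hid X n i" "(y, z) \<in> hid X n i"
  shows "(x, z) \<in> hid X n i"
proof -
  have c: "x \<in> cvec X n i" "y \<in> cvec X n i" "z \<in> cvec X n i"
    using assms by (auto simp: hid_def dest: cycles_carrier)
  have "(x - y) + (y - z) \<in> boundaries X n i"
    using assms lin_subspaceD(3)[OF boundaries_subspace] by (auto simp: hid_def)
  then show ?thesis using assms vec_diff_identities(3)[OF c c(3)] by (auto simp: hid_def)
qed

lemma hid_mult:
  assumes "is_cpx X" "is_cpx Y" "chain_map X Y f" "(x, y) \<in> hid X n i"
  shows "(f n i *\<^sub>v x, f n i *\<^sub>v y) \<in> hid Y n i"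
proof -
  have c: "x \<in> cvec X n i" "y \<in> cvec X n i"
    using assms by (auto simp: hid_def dest: cycles_carrier)
  have "f n i *\<^sub>v (x - y) \<in> boundaries Y n i"
    using assms chain_map_boundaries by (auto simp: hid_def)
  then show ?thesis
    using assms mult_minus_distrib_mat_vec[OF chain_map_carrier[OF assms(3)] c]
      chain_map_cycles[OF assms(1-3)] by (auto simp: hid_def)
qed

lemma hmap_iff: "is_cpx X \<Longrightarrow> is_cpx Y \<Longrightarrow> chain_map X Y f \<Longrightarrow>
    (x, y) \<in> hmap X Y f n i \<longleftrightarrow> x \<in> cycles X n i \<and> (f n i *\<^sub>v x, y) \<in> hid Y n i"
  using chain_map_cycles[of X Y f _ n i] by (auto simp: hid_def hmap_def)

lemma hid_cycles: "(x, y) \<in> hid X n i \<Longrightarrow> x \<in> cycles X n i \<and> y \<in> cycles X n i"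
  by (auto simp: hid_def)

lemma hid_equiv:
  assumes "is_cpx X" shows "equiv (cycles X n i) (hid X n i)"
proof (rule equivI)
  show "hid X n i \<subseteq> cycles X n i \<times> cycles X n i" by (auto simp: hid_def)
  show "refl_on (cycles X n i) (hid X n i)"
    using hid_refl[OF assms] by (auto simp: refl_on_def)
  show "sym (hid X n i)" using hid_sym[OF assms] by (auto simp: sym_def)
  show "trans (hid X n i)" unfolding trans_def using hid_trans[OF assms] by blast
qed

text \<open>The next three lemmas isolate the purely set-theoretic content: a function \<open>F\<close> that respects two
equivalence relations is represented by the relation of all \<open>(x, y)\<close> with \<open>F x\<close> equivalent to
\<open>y\<close>.\<close>

lemma setoid_unit:
  assumes E: "equiv A E" and E': "equiv B E'"
    and cong: "\<And>x x'. (x, x') \<in> E \<Longrightarrow> (F x, F x') \<in> E'"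
    and R: "R = {(x, y). x \<in> A \<and> (F x, y) \<in> E'}"
  shows "E O R = R" "R O E' = R"
proof -
  have s: "sym E'" and t: "trans E'" and r: "refl_on A E"
    and E'B: "E' \<subseteq> B \<times> B" and EA: "E \<subseteq> A \<times> A" and r': "refl_on B E'"
    using E E' by (auto simp: equiv_def refl_on_def)
  show "E O R = R"
  proof
    show "E O R \<subseteq> R" using cong t EA unfolding R by (auto dest: transD)
    show "R \<subseteq> E O R"
    proof
      fix p assume "p \<in> R"
      then obtain x y where p: "p = (x, y)" "x \<in> A" "(x, y) \<in> R" unfolding R by auto
      then have "(x, x) \<in> E" using r by (auto simp: refl_on_def)
      then show "p \<in> E O R" using p by auto
    qed
  qed
  show "R O E' = R"
  proof
    show "R O E' \<subseteq> R" using t unfolding R by (auto dest: transD)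
    show "R \<subseteq> R O E'"
    proof
      fix p assume "p \<in> R"
      then obtain x y where p: "p = (x, y)" "(F x, y) \<in> E'" "(x, y) \<in> R" unfolding R by auto
      then have "(y, y) \<in> E'" using r' E'B by (auto simp: refl_on_def)
      then show "p \<in> R O E'" using p by auto
    qed
  qed
qed

lemma setoid_comp:
  assumes E': "equiv B E'" and E'': "equiv C E''"
    and F: "\<And>x. x \<in> A \<Longrightarrow> F x \<in> B"
    and cong: "\<And>x x'. (x, x') \<in> E' \<Longrightarrow> (G x, G x') \<in> E''"
    and R: "R = {(x, y). x \<in> A \<and> (F x, y) \<in> E'}"
    and S: "S = {(x, y). x \<in> B \<and> (G x, y) \<in> E''}"
    and T: "T = {(x, y). x \<in> A \<and> (G (F x), y) \<in> E''}"
  shows "T = R O S"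
proof
  have t: "trans E''" and E'B: "E' \<subseteq> B \<times> B" and r': "refl_on B E'"
    using E' E'' by (auto simp: equiv_def refl_on_def)
  show "R O S \<subseteq> T" using cong t unfolding R S T by (auto dest: transD)
  show "T \<subseteq> R O S"
  proof
    fix p assume "p \<in> T"
    then obtain x y where p: "p = (x, y)" "x \<in> A" "(G (F x), y) \<in> E''" unfolding T by auto
    then have "(x, F x) \<in> R" "(F x, y) \<in> S" using r' F unfolding R S by (auto simp: refl_on_def)
    then show "p \<in> R O S" using p by auto
  qed
qed

lemma setoid_bijection:
  assumes E: "equiv A E" and E': "equiv B E'"
    and cong: "\<And>x x'. (x, x') \<in> E \<Longrightarrow> (F x, F x') \<in> E'"
    and inj: "\<And>x x'. x \<in> A \<Longrightarrow> x' \<in> A \<Longrightarrow> (F x, F x') \<in> E' \<Longrightarrow> (x, x') \<in> E"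
    and sur: "\<And>y. y \<in> B \<Longrightarrow> \<exists>x\<in>A. (F x, y) \<in> E'"
    and R: "R = {(x, y). x \<in> A \<and> (F x, y) \<in> E'}"
  shows "R\<inverse> O R = E'" "R O R\<inverse> = E"
proof -
  have s: "sym E'" and t: "trans E'" and r: "refl_on A E"
    and E'B: "E' \<subseteq> B \<times> B" and EA: "E \<subseteq> A \<times> A" and r': "refl_on B E'"
    using E E' by (auto simp: equiv_def refl_on_def)
  show "R\<inverse> O R = E'"
  proof
    show "R\<inverse> O R \<subseteq> E'" using s t unfolding R by (auto dest: symD transD)
    show "E' \<subseteq> R\<inverse> O R"
    proof
      fix p assume p: "p \<in> E'"
      obtain y z where yz: "p = (y, z)" by (cases p)
      then have "y \<in> B" using p E'B by auto
      then obtain x where "x \<in> A" "(F x, y) \<in> E'" using sur by blast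
      then show "p \<in> R\<inverse> O R" using p yz t unfolding R by (auto dest: transD intro!: relcompI)
    qed
  qed
  show "R O R\<inverse> = E"
  proof
    show "R O R\<inverse> \<subseteq> E"
    proof
      fix p assume "p \<in> R O R\<inverse>"
      then obtain x y z where "p = (x, z)" "x \<in> A" "z \<in> A" "(F x, y) \<in> E'" "(F z, y) \<in> E'"
        unfolding R by auto
      then show "p \<in> E" using inj s t by (auto dest: symD transD)
    qed
    show "E \<subseteq> R O R\<inverse>"
    proof
      fix p assume p: "p \<in> E"
      obtain y z where yz: "p = (y, z)" by (cases p)
      have "(F y, F z) \<in> E'" using cong p yz by auto
      moreover have "(F z, F z) \<in> E'" using calculation E'B r' by (auto simp: refl_on_def)
      ultimately have "(y, F z) \<in> R" "(z, F z) \<in> R" using p yz EA unfolding R by auto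
      then show "p \<in> R O R\<inverse>" using yz by auto
    qed
  qed
qed

lemma hmap_eq: "is_cpx X \<Longrightarrow> is_cpx Y \<Longrightarrow> chain_map X Y f \<Longrightarrow>
    hmap X Y f n i = {(x, y). x \<in> cycles X n i \<and> (f n i *\<^sub>v x, y) \<in> hid Y n i}"
  using hmap_iff by fast

lemma hmap_unit:
  assumes "is_cpx X" "is_cpx Y" "chain_map X Y f"
  shows "hid X n i O hmap X Y f n i = hmap X Y f n i" "hmap X Y f n i O hid Y n i = hmap X Y f n i"
  using setoid_unit[OF hid_equiv[OF assms(1)] hid_equiv[OF assms(2)] hid_mult[OF assms] hmap_eq[OF assms]]
  by simp_all

lemma rep_hom_comp:
  assumes "f \<in> rep_hom U V" "g \<in> rep_hom V W" "is_rep U" "is_rep V" "is_rep W"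
  shows "(\<lambda>i. g i * f i) \<in> rep_hom U W"
proof -
  have c: "f i \<in> carrier_mat (rdim V i) (rdim U i)" "g i \<in> carrier_mat (rdim W i) (rdim V i)" for i
    using assms by (auto simp: rep_hom_def)
  have m: "rmap U a \<in> carrier_mat (rdim U (tgt a)) (rdim U (src a))"
    "rmap V a \<in> carrier_mat (rdim V (tgt a)) (rdim V (src a))"
    "rmap W a \<in> carrier_mat (rdim W (tgt a)) (rdim W (src a))" for a
    using assms by (auto simp: is_rep_def)
  have "g (tgt a) * f (tgt a) * rmap U a = rmap W a * (g (src a) * f (src a))" for a
  proof -
    have e: "f (tgt a) * rmap U a = rmap V a * f (src a)" "g (tgt a) * rmap V a = rmap W a * g (src a)"
      using assms by (auto simp: rep_hom_def)
    have "g (tgt a) * f (tgt a) * rmap U a = g (tgt a) * (rmap V a * f (src a))"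
      using assoc_mult_mat[OF c(2) c(1) m(1)] e(1) by simp
    also have "\<dots> = rmap W a * g (src a) * f (src a)"
      by (simp only: assoc_mult_mat[OF c(2) m(2) c(1), symmetric] e(2))
    also have "\<dots> = rmap W a * (g (src a) * f (src a))"
      using assoc_mult_mat[OF m(3) c(2) c(1)] by simp
    finally show ?thesis .
  qed
  then show ?thesis using c by (auto simp: rep_hom_def intro!: mult_carrier_mat)
qed

lemma chain_map_comp:
  assumes "is_cpx X" "is_cpx Y" "is_cpx Z" "chain_map X Y f" "chain_map Y Z g"
  shows "chain_map X Z (g \<circ>\<^sub>c f)"
proof -
  have "dif Z n i * (g n i * f n i) = g (n + 1) i * f (n + 1) i * dif X n i" for n i
  proof -
    have e: "dif Y n i * f n i = f (n + 1) i * dif X n i" "dif Z n i * g n i = g (n + 1) i * dif Y n i"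
      using assms by (auto simp: chain_map_def)
    have c: "f n i \<in> carrier_mat (rdim (ob Y n) i) (rdim (ob X n) i)"
      "g n i \<in> carrier_mat (rdim (ob Z n) i) (rdim (ob Y n) i)" for n i
      using assms chain_map_carrier by blast+
    note d = dif_carrier[OF assms(1)] dif_carrier[OF assms(2)] dif_carrier[OF assms(3)]
    have "dif Z n i * (g n i * f n i) = g (n+1) i * dif Y n i * f n i"
      by (simp only: assoc_mult_mat[OF d(3) c(2) c(1), symmetric] e(2))
    also have "\<dots> = g (n+1) i * (f (n+1) i * dif X n i)"
      using assoc_mult_mat[OF c(2) d(2) c(1)] e(1) by simp
    also have "\<dots> = g (n+1) i * f (n+1) i * dif X n i"
      using assoc_mult_mat[OF c(2) c(1) d(1)] by simp
    finally show ?thesis .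
  qed
  moreover have "(\<lambda>i. g n i * f n i) \<in> rep_hom (ob X n) (ob Z n)" for n
    using rep_hom_comp chain_map_hom[OF assms(4)] chain_map_hom[OF assms(5)] is_cpx_rep assms(1-3) by blast
  ultimately show ?thesis by (auto simp: chain_map_def cm_comp_def)
qed

lemma hmap_comp:
  assumes "is_cpx X" "is_cpx Y" "is_cpx Z" "chain_map X Y f" "chain_map Y Z g"
  shows "hmap X Z (g \<circ>\<^sub>c f) n i = hmap X Y f n i O hmap Y Z g n i"
proof -
  have e: "(g \<circ>\<^sub>c f) n i *\<^sub>v x = g n i *\<^sub>v (f n i *\<^sub>v x)" if "x \<in> cycles X n i" for x
    using assoc_mult_mat_vec[OF chain_map_carrier[OF assms(5)] chain_map_carrier[OF assms(4)] cycles_carrier[OF that]]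
    by (simp add: cm_comp_def)
  have "hmap X Z (g \<circ>\<^sub>c f) n i = {(x, y). x \<in> cycles X n i \<and> (g n i *\<^sub>v (f n i *\<^sub>v x), y) \<in> hid Z n i}"
    unfolding hmap_eq[OF assms(1,3) chain_map_comp[OF assms]] using e by (auto simp del: assoc_mult_mat_vec)
  then show ?thesis
    using setoid_comp[OF hid_equiv[OF assms(2)] hid_equiv[OF assms(3)] chain_map_cycles[OF assms(1,2,4)]
      hid_mult[OF assms(2,3,5)] hmap_eq[OF assms(1,2,4)] hmap_eq[OF assms(2,3,5)]]
    by metis
qed

lemma hmap_homotopic:
  assumes "is_cpx X" "is_cpx Y" "chain_map X Y f" "chain_map X Y g" "homotopic X Y f g"
  shows "hmap X Y f n i = hmap X Y g n i"
proof -
  have "(f n i *\<^sub>v x, g n i *\<^sub>v x) \<in> hid Y n i" if x: "x \<in> cycles X n i" for x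
  proof -
    obtain h where h: "\<And>n. h n \<in> rep_hom (ob X n) (ob Y (n - 1))"
      "\<And>n i. f n i - g n i = dif Y (n - 1) i * h n i + h (n + 1) i * dif X n i"
      using assms(5) by (auto simp: homotopic_def)
    have hc: "h n i \<in> carrier_mat (rdim (ob Y (n-1)) i) (rdim (ob X n) i)"
      "h (n+1) i \<in> carrier_mat (rdim (ob Y n) i) (rdim (ob X (n+1)) i)"
      using rep_hom_carrier[OF h(1)[of n]] rep_hom_carrier[OF h(1)[of "n+1"]] by simp_all
    have xc: "x \<in> cvec X n i" "dif X n i *\<^sub>v x = 0\<^sub>v (rdim (ob X (n+1)) i)"
      using x by (auto simp: cycles_def)
    have "f n i *\<^sub>v x - g n i *\<^sub>v x = (f n i - g n i) *\<^sub>v x"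
      using minus_mult_distrib_mat_vec[OF chain_map_carrier[OF assms(3)] chain_map_carrier[OF assms(4)] xc(1)]
      by simp
    also have "\<dots> = (dif Y (n - 1) i * h n i) *\<^sub>v x + (h (n + 1) i * dif X n i) *\<^sub>v x"
      unfolding h(2)
      by (rule add_mult_distrib_mat_vec[OF mult_carrier_mat[OF dif_carrier_pred[OF assms(2)] hc(1)]
            mult_carrier_mat[OF hc(2) dif_carrier[OF assms(1)]] xc(1)])
    also have "\<dots> = dif Y (n - 1) i *\<^sub>v (h n i *\<^sub>v x)"
      using assoc_mult_mat_vec[OF dif_carrier_pred[OF assms(2)] hc(1) xc(1)]
        assoc_mult_mat_vec[OF hc(2) dif_carrier[OF assms(1)] xc(1)] xc mult_mat_vec_0[OF hc(2)]
        mult_mat_vec_carrier[OF dif_carrier_pred[OF assms(2)] mult_mat_vec_carrier[OF hc(1) xc(1)]]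
      by simp
    finally show ?thesis
      using dif_boundary[OF mult_mat_vec_carrier[OF hc(1) xc(1)]] chain_map_cycles[OF assms(1-3) x]
        chain_map_cycles[OF assms(1,2,4) x] by (auto simp: hid_def)
  qed
  then have "(f n i *\<^sub>v x, y) \<in> hid Y n i \<longleftrightarrow> (g n i *\<^sub>v x, y) \<in> hid Y n i" if "x \<in> cycles X n i" for x y
    using hid_trans[OF assms(2)] hid_sym[OF assms(2)] that by blast
  then show ?thesis
    unfolding hmap_eq[OF assms(1-3)] hmap_eq[OF assms(1,2,4)] by auto
qed

text \<open>A quasi-isomorphism is bijective on classes, so its relation is inverted by taking the converse.\<close>

lemma hmap_quasi_iso:
  assumes "is_cpx X" "is_cpx Y" "quasi_iso X Y f"
  shows "(hmap X Y f n i)\<inverse> O hmap X Y f n i = hid Y n i"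
    "hmap X Y f n i O (hmap X Y f n i)\<inverse> = hid X n i"
proof -
  have f: "chain_map X Y f" using assms by (auto simp: quasi_iso_def)
  have inj: "x \<in> boundaries X n i" if "x \<in> cycles X n i" "f n i *\<^sub>v x \<in> boundaries Y n i" for x
    using assms that by (auto simp: quasi_iso_def)
  have sur: "\<exists>x\<in>cycles X n i. (f n i *\<^sub>v x, y) \<in> hid Y n i" if "y \<in> cycles Y n i" for y
  proof -
    have "\<exists>x\<in>cycles X n i. (y, f n i *\<^sub>v x) \<in> hid Y n i"
      using assms that chain_map_cycles[OF assms(1,2) f] by (fastforce simp: quasi_iso_def hid_def)
    then show ?thesis using hid_sym[OF assms(2)] by blast
  qed
  have inj2: "(x, x') \<in> hid X n i" if "x \<in> cycles X n i" "x' \<in> cycles X n i"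
     "(f n i *\<^sub>v x, f n i *\<^sub>v x') \<in> hid Y n i" for x x'
  proof -
    have "f n i *\<^sub>v (x - x') = f n i *\<^sub>v x - f n i *\<^sub>v x'"
      by (rule mult_minus_distrib_mat_vec[OF chain_map_carrier[OF f] cycles_carrier[OF that(1)] cycles_carrier[OF that(2)]])
    then show ?thesis using that inj[OF lin_subspace_diff[OF cycles_subspace[OF assms(1)]]]
      by (auto simp: hid_def)
  qed
  show "(hmap X Y f n i)\<inverse> O hmap X Y f n i = hid Y n i"
    "hmap X Y f n i O (hmap X Y f n i)\<inverse> = hid X n i"
    using setoid_bijection[OF hid_equiv[OF assms(1)] hid_equiv[OF assms(2)] hid_mult[OF assms(1,2) f] inj2 sur
      hmap_eq[OF assms(1,2) f]]
    by simp_all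
qed

section \<open>Roofs act on cohomology\<close>

lemma rep_hom_zero:
  assumes "is_rep V" "is_rep W"
  shows "(\<lambda>i. 0\<^sub>m (rdim W i) (rdim V i)) \<in> rep_hom V W"
proof -
  have "0\<^sub>m (rdim W (tgt a)) (rdim V (tgt a)) * rmap V a = rmap W a * 0\<^sub>m (rdim W (src a)) (rdim V (src a))" for a
    using assms left_mult_zero_mat right_mult_zero_mat unfolding is_rep_def by metis
  then show ?thesis by (auto simp: rep_hom_def)
qed

lemma rep_hom_id:
  assumes "is_rep V" shows "(\<lambda>i. 1\<^sub>m (rdim V i)) \<in> rep_hom V V"
proof -
  have c: "rmap V a \<in> carrier_mat (rdim V (tgt a)) (rdim V (src a))" for a
    using assms by (auto simp: is_rep_def)
  show ?thesis unfolding rep_hom_def using left_mult_one_mat[OF c] right_mult_one_mat[OF c] by simp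
qed

lemma chain_map_zero:
  assumes "is_cpx X" "is_cpx Y" shows "chain_map X Y (cm_zero X Y)"
proof -
  have "dif Y n i * 0\<^sub>m (rdim (ob Y n) i) (rdim (ob X n) i) =
     0\<^sub>m (rdim (ob Y (n+1)) i) (rdim (ob X (n+1)) i) * dif X n i" for n i
    using left_mult_zero_mat[OF dif_carrier[OF assms(1)]] right_mult_zero_mat[OF dif_carrier[OF assms(2)]] by metis
  then show ?thesis
    using rep_hom_zero[OF is_cpx_rep[OF assms(1)] is_cpx_rep[OF assms(2)]] by (auto simp: chain_map_def cm_zero_def)
qed

lemma chain_map_id:
  assumes "is_cpx X" shows "chain_map X X (cm_id X)"
  using left_mult_one_mat[OF dif_carrier[OF assms]] right_mult_one_mat[OF dif_carrier[OF assms]]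
    rep_hom_id[OF is_cpx_rep[OF assms]]
  by (auto simp: chain_map_def cm_id_def)

lemma cm_id_right: "chain_map X Y f \<Longrightarrow> f \<circ>\<^sub>c cm_id X = f"
  unfolding cm_comp_def cm_id_def by (intro ext right_mult_one_mat[OF chain_map_carrier])

lemma cm_id_left: "chain_map X Y f \<Longrightarrow> cm_id Y \<circ>\<^sub>c f = f"
  unfolding cm_comp_def cm_id_def by (intro ext left_mult_one_mat[OF chain_map_carrier])

lemma quasi_iso_id:
  assumes "is_cpx X" shows "quasi_iso X X (cm_id X)"
proof -
  have "y - cm_id X n i *\<^sub>v y \<in> boundaries X n i" if "y \<in> cycles X n i" for y n i
    using hid_refl[OF assms that] cycles_carrier[OF that] by (auto simp: hid_def cm_id_def)
  then show ?thesis using chain_map_id[OF assms]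
    by (auto simp: quasi_iso_def) (auto simp: cm_id_def dest: cycles_carrier)
qed

lemma homotopic_refl:
  assumes "is_cpx X" "is_cpx Y" "chain_map X Y f" shows "homotopic X Y f f"
proof -
  let ?h = "\<lambda>n i. 0\<^sub>m (rdim (ob Y (n-1)) i) (rdim (ob X n) i)"
  have "f n i - f n i = dif Y (n - 1) i * ?h n i + ?h (n + 1) i * dif X n i" for n i
    using right_mult_zero_mat[OF dif_carrier_pred[OF assms(2)]] left_mult_zero_mat[OF dif_carrier[OF assms(1)]]
      chain_map_carrier[OF assms(3)] by auto
  moreover have "?h n \<in> rep_hom (ob X n) (ob Y (n-1))" for n
    using rep_hom_zero is_cpx_rep assms by blast
  ultimately show ?thesis unfolding homotopic_def by (intro exI[of _ ?h]) auto
qed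

text \<open>The fraction $f s^{-1}$ on cohomology.\<close>

fun hroof :: "'k::field cpx \<Rightarrow> 'k cpx \<Rightarrow> 'k roof \<Rightarrow> int \<Rightarrow> vertex \<Rightarrow> ('k vec \<times> 'k vec) set" where
  "hroof X Y (W, s, f) n i = (hmap W X s n i)\<inverse> O hmap W Y f n i"

text \<open>Cancellation: with a common refinement \<open>u\<close>, \<open>v\<close> of the two roofs, both fractions equal the fraction
over the refined apex.\<close>

lemma hroof_roof_eq:
  assumes "is_cpx X" "is_cpx Y" "(r, r') \<in> roof_eq X Y"
  shows "hroof X Y r n i = hroof X Y r' n i"
proof -
  obtain W s f W' s' f' V u v where r: "r = (W, s, f)" "r' = (W', s', f')" and
    *: "is_cpx W" "quasi_iso W X s" "chain_map W Y f" "is_cpx W'" "quasi_iso W' X s'" "chain_map W' Y f'"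
    "is_cpx V" "quasi_iso V W u" "quasi_iso V W' v"
    "homotopic V X (s \<circ>\<^sub>c u) (s' \<circ>\<^sub>c v)" "homotopic V Y (f \<circ>\<^sub>c u) (f' \<circ>\<^sub>c v)"
    using assms(3) by (auto simp: roof_eq_def roofs_def)
  have c: "chain_map W X s" "chain_map W' X s'" "chain_map V W u" "chain_map V W' v"
    using * by (auto simp: quasi_iso_def)
  let ?S = "hmap W X s n i" and ?F = "hmap W Y f n i" and ?S' = "hmap W' X s' n i"
    and ?F' = "hmap W' Y f' n i" and ?U = "hmap V W u n i" and ?V = "hmap V W' v n i"
  have US: "?U O ?S = ?V O ?S'"
    using hmap_homotopic[OF *(7) assms(1) chain_map_comp[OF *(7,1) assms(1) c(3,1)]
       chain_map_comp[OF *(7,4) assms(1) c(4,2)] *(10)]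
      hmap_comp[OF *(7,1) assms(1) c(3,1)] hmap_comp[OF *(7,4) assms(1) c(4,2)] by simp
  have UF: "?U O ?F = ?V O ?F'"
    using hmap_homotopic[OF *(7) assms(2) chain_map_comp[OF *(7,1) assms(2) c(3) *(3)]
       chain_map_comp[OF *(7,4) assms(2) c(4) *(6)] *(11)]
      hmap_comp[OF *(7,1) assms(2) c(3) *(3)] hmap_comp[OF *(7,4) assms(2) c(4) *(6)] by simp
  have "?S\<inverse> O ?F = ?S\<inverse> O (?U\<inverse> O ?U) O ?F"
    using hmap_quasi_iso(1)[OF *(7,1,8)] hmap_unit(1)[OF *(1) assms(2) *(3)] by simp
  also have "\<dots> = (?U O ?S)\<inverse> O (?U O ?F)" by (simp add: converse_relcomp O_assoc)
  also have "\<dots> = (?V O ?S')\<inverse> O (?V O ?F')" using US UF by simp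
  also have "\<dots> = ?S'\<inverse> O (?V\<inverse> O ?V) O ?F'" by (simp add: converse_relcomp O_assoc)
  also have "\<dots> = ?S'\<inverse> O ?F'"
    using hmap_quasi_iso(1)[OF *(7,4,9)] hmap_unit(1)[OF *(4) assms(2) *(6)] by simp
  finally show ?thesis using r by simp
qed

text \<open>The square \<open>f h \<simeq> t k\<close> turns $k h^{-1}$ into $t^{-1} f$ on cohomology.\<close>

lemma hroof_comp:
  assumes X: "is_cpx X" and Y: "is_cpx Y" and Z: "is_cpx Z"
    and r: "(W, s, f) \<in> roofs X Y" "(W', t, g) \<in> roofs Y Z"
    and V: "is_cpx V" "quasi_iso V W h" "chain_map V W' k" "homotopic V Y (f \<circ>\<^sub>c h) (t \<circ>\<^sub>c k)"
  shows "hroof X Z (V, s \<circ>\<^sub>c h, g \<circ>\<^sub>c k) n i = hroof X Y (W, s, f) n i O hroof Y Z (W', t, g) n i"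
proof -
  have *: "is_cpx W" "quasi_iso W X s" "chain_map W Y f" "is_cpx W'" "quasi_iso W' Y t" "chain_map W' Z g"
    using r by (auto simp: roofs_def)
  have c: "chain_map W X s" "chain_map W' Y t" "chain_map V W h"
    using * V by (auto simp: quasi_iso_def)
  let ?S = "hmap W X s n i" and ?F = "hmap W Y f n i" and ?T = "hmap W' Y t n i"
    and ?G = "hmap W' Z g n i" and ?H = "hmap V W h n i" and ?K = "hmap V W' k n i"
  have eq: "?H O ?F = ?K O ?T"
    using hmap_homotopic[OF V(1) Y chain_map_comp[OF V(1) *(1) Y c(3) *(3)]
       chain_map_comp[OF V(1) *(4) Y V(3) c(2)] V(4)]
      hmap_comp[OF V(1) *(1) Y c(3) *(3)] hmap_comp[OF V(1) *(4) Y V(3) c(2)] by simp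
  have "?H\<inverse> O ?K = ?H\<inverse> O (?K O (?T O ?T\<inverse>))"
    using hmap_quasi_iso(2)[OF *(4) Y *(5)] hmap_unit(2)[OF V(1) *(4) V(3)] by simp
  also have "\<dots> = ?H\<inverse> O (?K O ?T) O ?T\<inverse>" by (simp add: O_assoc)
  also have "\<dots> = (?H\<inverse> O ?H) O ?F O ?T\<inverse>" unfolding eq[symmetric] by (simp add: O_assoc)
  also have "\<dots> = ((?H\<inverse> O ?H) O ?F) O ?T\<inverse>" by (simp only: O_assoc)
  also have "\<dots> = ?F O ?T\<inverse>"
    using hmap_quasi_iso(1)[OF V(1) *(1) V(2)] hmap_unit(1)[OF *(1) Y *(3)] by simp
  finally have HK: "?H\<inverse> O ?K = ?F O ?T\<inverse>" .
  have "hroof X Z (V, s \<circ>\<^sub>c h, g \<circ>\<^sub>c k) n i = (?H O ?S)\<inverse> O (?K O ?G)"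
    using hmap_comp[OF V(1) *(1) X c(3,1)] hmap_comp[OF V(1) *(4) Z V(3) *(6)] by simp
  also have "\<dots> = ?S\<inverse> O (?H\<inverse> O ?K) O ?G" by (simp add: converse_relcomp O_assoc)
  also have "\<dots> = hroof X Y (W, s, f) n i O hroof Y Z (W', t, g) n i"
    unfolding HK by (simp add: O_assoc)
  finally show ?thesis .
qed

definition hrel :: "'k::field cpx \<Rightarrow> 'k cpx \<Rightarrow> 'k roof set \<Rightarrow> int \<Rightarrow> vertex \<Rightarrow> ('k vec \<times> 'k vec) set" where
  "hrel X Y \<phi> n i = (\<Union>r\<in>\<phi>. hroof X Y r n i)"

lemma roof_eq_refl:
  assumes "is_cpx X" "is_cpx Y" "r \<in> roofs X Y" shows "(r, r) \<in> roof_eq X Y"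
proof -
  obtain W s f where r: "r = (W, s, f)" by (cases r)
  have *: "is_cpx W" "quasi_iso W X s" "chain_map W X s" "chain_map W Y f"
    using assms r by (auto simp: roofs_def quasi_iso_def)
  have h: "homotopic W X (s \<circ>\<^sub>c cm_id W) (s \<circ>\<^sub>c cm_id W)" "homotopic W Y (f \<circ>\<^sub>c cm_id W) (f \<circ>\<^sub>c cm_id W)"
    using homotopic_refl[OF *(1) assms(1) *(3)] homotopic_refl[OF *(1) assms(2) *(4)]
      cm_id_right[OF *(3)] cm_id_right[OF *(4)] by simp_all
  have "(W, s, f) \<in> roofs X Y" using assms r by simp
  then show ?thesis using r *(1) quasi_iso_id[OF *(1)] h
    unfolding r roof_eq_def mem_Collect_eq prod.case by (intro exI[of _ W] exI[of _ "cm_id W"] conjI) auto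
qed

lemma Db_hom_hrel:
  assumes "is_cpx X" "is_cpx Y" "\<phi> \<in> Db_hom X Y" "r \<in> \<phi>"
  shows "r \<in> roofs X Y" "hrel X Y \<phi> n i = hroof X Y r n i"
proof -
  obtain r0 where r0: "\<phi> = roof_eq X Y `` {r0}" using assms(3) by (auto simp: Db_hom_def quotient_def)
  then show "r \<in> roofs X Y" using assms(4) by (auto simp: roof_eq_def)
  have "hroof X Y r' n i = hroof X Y r0 n i" if "r' \<in> \<phi>" for r'
    using that hroof_roof_eq[OF assms(1,2)] r0 by auto
  then show "hrel X Y \<phi> n i = hroof X Y r n i" using assms(4) unfolding hrel_def by auto
qed

lemma Db_hom_nonempty:
  assumes "is_cpx X" "is_cpx Y" "\<phi> \<in> Db_hom X Y"
  obtains r where "r \<in> \<phi>"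
proof -
  obtain r0 where "r0 \<in> roofs X Y" "\<phi> = roof_eq X Y `` {r0}"
    using assms(3) by (auto simp: Db_hom_def quotient_def)
  then show ?thesis using that roof_eq_refl[OF assms(1,2)] by blast
qed

lemma id_roof: "is_cpx X \<Longrightarrow> chain_map X Y f \<Longrightarrow> (X, cm_id X, f) \<in> roofs X Y"
  using quasi_iso_id by (auto simp: roofs_def)

lemma Db_of_hom:
  assumes "is_cpx X" "is_cpx Y" "chain_map X Y f"
  shows "Db_of X Y f \<in> Db_hom X Y" "(X, cm_id X, f) \<in> Db_of X Y f"
  using id_roof[OF assms(1,3)] roof_eq_refl[OF assms(1,2)] by (auto simp: Db_of_def Db_hom_def quotient_def)

lemma hroof_id:
  assumes "is_cpx X" "is_cpx Y" "chain_map X Y f"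
  shows "hroof X Y (X, cm_id X, f) n i = hmap X Y f n i"
  using hmap_unit(1)[OF assms] hid_equiv[OF assms(1)] by (simp add: hmap_id equiv_def sym_conv_converse_eq)

lemma hrel_Db_of:
  assumes "is_cpx X" "is_cpx Y" "chain_map X Y f"
  shows "hrel X Y (Db_of X Y f) n i = hmap X Y f n i"
  using Db_hom_hrel(2)[OF assms(1,2) Db_of_hom[OF assms]] hroof_id[OF assms] by simp

text \<open>\<open>Db_comp\<close> collects all composites of representatives. Since every member has the same effect on
cohomology, functoriality does not require any two composites to be known equivalent.\<close>

lemma hroof_Db_comp:
  assumes "is_cpx X" "is_cpx Y" "is_cpx Z" "\<phi> \<in> Db_hom X Y" "\<psi> \<in> Db_hom Y Z" "r \<in> Db_comp X Y Z \<psi> \<phi>"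
  shows "hroof X Z r n i = hrel X Y \<phi> n i O hrel Y Z \<psi> n i"
proof -
  obtain W s f W' t g V h k where *: "(W, s, f) \<in> \<phi>" "(W', t, g) \<in> \<psi>"
    "is_cpx V" "quasi_iso V W h" "chain_map V W' k" "homotopic V Y (f \<circ>\<^sub>c h) (t \<circ>\<^sub>c k)"
    "((V, s \<circ>\<^sub>c h, g \<circ>\<^sub>c k), r) \<in> roof_eq X Z"
    using assms(6) unfolding Db_comp_def by blast
  show ?thesis
    using hroof_roof_eq[OF assms(1,3) *(7)] hroof_comp[OF assms(1-3) Db_hom_hrel(1)[OF assms(1,2,4) *(1)]
        Db_hom_hrel(1)[OF assms(2,3,5) *(2)] *(3-6)]
      Db_hom_hrel(2)[OF assms(1,2,4) *(1)] Db_hom_hrel(2)[OF assms(2,3,5) *(2)] by simp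
qed

text \<open>An equation between sets \<open>Db_comp\<close> is informative only if the sets are inhabited. After a roof, an
honest chain map can be composed directly on the same apex, so no completion of squares is
required.\<close>

lemma Db_comp_Db_of_nonempty:
  assumes "is_cpx X" "is_cpx Y" "is_cpx Z" "\<phi> \<in> Db_hom X Y" "chain_map Y Z g"
  obtains r where "r \<in> Db_comp X Y Z (Db_of Y Z g) \<phi>"
proof -
  obtain W s f where r: "(W, s, f) \<in> \<phi>" using Db_hom_nonempty[OF assms(1,2,4)] by (metis prod_cases3)
  have *: "is_cpx W" "quasi_iso W X s" "chain_map W X s" "chain_map W Y f"
    using Db_hom_hrel(1)[OF assms(1,2,4) r] by (auto simp: roofs_def quasi_iso_def)
  have "(W, s, g \<circ>\<^sub>c f) \<in> roofs X Z" using * chain_map_comp[OF *(1) assms(2,3) *(4) assms(5)] by (auto simp: roofs_def)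
  then have e: "((W, s \<circ>\<^sub>c cm_id W, g \<circ>\<^sub>c f), (W, s, g \<circ>\<^sub>c f)) \<in> roof_eq X Z"
    using roof_eq_refl[OF assms(1,3)] cm_id_right[OF *(3)] by simp
  have "homotopic W Y (f \<circ>\<^sub>c cm_id W) (cm_id Y \<circ>\<^sub>c f)"
    using cm_id_right[OF *(4)] cm_id_left[OF *(4)] homotopic_refl[OF *(1) assms(2) *(4)] by simp
  then have "(W, s, g \<circ>\<^sub>c f) \<in> Db_comp X Y Z (Db_of Y Z g) \<phi>"
    unfolding Db_comp_def using r Db_of_hom(2)[OF assms(2,3,5)] *(1) quasi_iso_id[OF *(1)] *(4) e by blast
  then show ?thesis by (rule that)
qed

text \<open>Closed like a subrepresentation of \<open>V \<oplus> W\<close>: this records linearity and compatibility with the arrows in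
a form that survives composition and converse.\<close>

definition rep_rel :: "'k::field rep \<Rightarrow> 'k rep \<Rightarrow> (vertex \<Rightarrow> ('k vec \<times> 'k vec) set) \<Rightarrow> bool" where
  "rep_rel V W R \<longleftrightarrow> (\<forall>i x y. (x, y) \<in> R i \<longrightarrow> x \<in> carrier_vec (rdim V i) \<and> y \<in> carrier_vec (rdim W i)) \<and>
     (\<forall>i x y x' y'. (x, y) \<in> R i \<longrightarrow> (x', y') \<in> R i \<longrightarrow> (x + x', y + y') \<in> R i) \<and>
     (\<forall>i c x y. (x, y) \<in> R i \<longrightarrow> (c \<cdot>\<^sub>v x, c \<cdot>\<^sub>v y) \<in> R i) \<and>
     (\<forall>a x y. (x, y) \<in> R (src a) \<longrightarrow> (rmap V a *\<^sub>v x, rmap W a *\<^sub>v y) \<in> R (tgt a))"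

lemma rep_rel_converse: "rep_rel V W R \<Longrightarrow> rep_rel W V (\<lambda>i. (R i)\<inverse>)"
  by (auto simp: rep_rel_def)

lemma rep_relD:
  assumes "rep_rel V W R"
  shows "(x, y) \<in> R i \<Longrightarrow> x \<in> carrier_vec (rdim V i)" "(x, y) \<in> R i \<Longrightarrow> y \<in> carrier_vec (rdim W i)"
    "(x, y) \<in> R i \<Longrightarrow> (x', y') \<in> R i \<Longrightarrow> (x + x', y + y') \<in> R i"
    "(x, y) \<in> R i \<Longrightarrow> (c \<cdot>\<^sub>v x, c \<cdot>\<^sub>v y) \<in> R i"
    "(x, y) \<in> R (src a) \<Longrightarrow> (rmap V a *\<^sub>v x, rmap W a *\<^sub>v y) \<in> R (tgt a)"
  using assms unfolding rep_rel_def by metis+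

lemma rep_rel_comp:
  assumes R: "rep_rel U V R" and S: "rep_rel V W S"
  shows "rep_rel U W (\<lambda>i. R i O S i)"
  unfolding rep_rel_def
proof (intro conjI allI impI)
  fix i x y assume "(x, y) \<in> R i O S i"
  then obtain z where z: "(x, z) \<in> R i" "(z, y) \<in> S i" by auto
  show "x \<in> carrier_vec (rdim U i)" "y \<in> carrier_vec (rdim W i)"
    using rep_relD(1)[OF R z(1)] rep_relD(2)[OF S z(2)] .
  show "(c \<cdot>\<^sub>v x, c \<cdot>\<^sub>v y) \<in> R i O S i" for c
    using rep_relD(4)[OF R z(1)] rep_relD(4)[OF S z(2)] by blast
  fix x' y' assume "(x', y') \<in> R i O S i"
  then obtain z' where z': "(x', z') \<in> R i" "(z', y') \<in> S i" by auto
  show "(x + x', y + y') \<in> R i O S i"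
    using rep_relD(3)[OF R z(1) z'(1)] rep_relD(3)[OF S z(2) z'(2)] by blast
next
  fix a x y assume "(x, y) \<in> R (src a) O S (src a)"
  then obtain z where z: "(x, z) \<in> R (src a)" "(z, y) \<in> S (src a)" by auto
  show "(rmap U a *\<^sub>v x, rmap W a *\<^sub>v y) \<in> R (tgt a) O S (tgt a)"
    using rep_relD(5)[OF R z(1)] rep_relD(5)[OF S z(2)] by blast
qed

lemma rep_rel_diff:
  assumes "rep_rel V W R" "(x, y) \<in> R i" "(x', y') \<in> R i"
  shows "(x - x', y - y') \<in> R i"
proof -
  have "(x + (-1) \<cdot>\<^sub>v x', y + (-1) \<cdot>\<^sub>v y') \<in> R i"
    using rep_relD(3)[OF assms(1,2) rep_relD(4)[OF assms(1,3)]] .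
  moreover have "x + (-1) \<cdot>\<^sub>v x' = x - x'" "y + (-1) \<cdot>\<^sub>v y' = y - y'"
    using rep_relD(1,2)[OF assms(1,2)] rep_relD(1,2)[OF assms(1,3)] by (auto intro!: eq_vecI)
  ultimately show ?thesis by simp
qed

lemma rep_hom_cycles:
  assumes "is_cpx X" "x \<in> cycles X n (src a)"
  shows "rmap (ob X n) a *\<^sub>v x \<in> cycles X n (tgt a)"
proof -
  have x: "x \<in> cvec X n (src a)" "dif X n (src a) *\<^sub>v x = 0\<^sub>v (rdim (ob X (n+1)) (src a))"
    using assms by (auto simp: cycles_def)
  have c: "rmap (ob X (n+1)) a \<in> carrier_mat (rdim (ob X (n+1)) (tgt a)) (rdim (ob X (n+1)) (src a))"
    using is_cpx_rep[OF assms(1)] by (auto simp: is_rep_def)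
  show ?thesis
    using rep_hom_arrow[OF is_cpx_dif_hom[OF assms(1)] is_cpx_rep[OF assms(1)] is_cpx_rep[OF assms(1)] x(1)]
      x(2) rmap_carrier_vec[OF is_cpx_rep[OF assms(1)] x(1)] mult_mat_vec_0[OF c]
    unfolding cycles_def by simp
qed

lemma rep_hom_boundaries:
  assumes "is_cpx X" "x \<in> boundaries X n (src a)"
  shows "rmap (ob X n) a *\<^sub>v x \<in> boundaries X n (tgt a)"
proof -
  have "x \<in> boundaries X ((n-1)+1) (src a)" using assms by simp
  then obtain w where w: "w \<in> cvec X (n-1) (src a)" "x = dif X (n-1) (src a) *\<^sub>v w"
    by (rule boundariesE)
  show ?thesis
    using rep_hom_arrow[OF is_cpx_dif_hom[OF assms(1), of "n-1"] is_cpx_rep[OF assms(1)] is_cpx_rep[OF assms(1)] w(1)]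
      dif_boundary[OF rmap_carrier_vec[OF is_cpx_rep[OF assms(1)] w(1)]] w(2) by simp
qed

lemma rep_rel_hmap:
  assumes "is_cpx X" "is_cpx Y" "chain_map X Y f"
  shows "rep_rel (ob X n) (ob Y n) (hmap X Y f n)"
proof -
  have fc: "f n i \<in> carrier_mat (rdim (ob Y n) i) (rdim (ob X n) i)" for i using chain_map_carrier[OF assms(3)] .
  have add: "(x + x', y + y') \<in> hmap X Y f n i" if h: "(x, y) \<in> hmap X Y f n i" "(x', y') \<in> hmap X Y f n i" for x y x' y' i
  proof -
    have c: "x \<in> cvec X n i" "x' \<in> cvec X n i" "y \<in> cvec Y n i" "y' \<in> cvec Y n i"
      using h by (auto simp: hmap_def dest: cycles_carrier)
    have "f n i *\<^sub>v (x + x') - (y + y') = (f n i *\<^sub>v x - y) + (f n i *\<^sub>v x' - y')"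
      using mult_add_distrib_mat_vec[OF fc c(1,2)] c
        vec_diff_identities(4)[of "f n i *\<^sub>v x" _ "f n i *\<^sub>v x'" y y'] mult_mat_vec_carrier[OF fc] by auto
    then show ?thesis using h lin_subspaceD(3)[OF cycles_subspace[OF assms(1)]]
       lin_subspaceD(3)[OF cycles_subspace[OF assms(2)]] lin_subspaceD(3)[OF boundaries_subspace[OF assms(2)]]
      by (auto simp: hmap_def)
  qed
  have sm: "(b \<cdot>\<^sub>v x, b \<cdot>\<^sub>v y) \<in> hmap X Y f n i" if h: "(x, y) \<in> hmap X Y f n i" for x y b i
  proof -
    have c: "x \<in> cvec X n i" "y \<in> cvec Y n i"
      using h by (auto simp: hmap_def dest: cycles_carrier)
    have "f n i *\<^sub>v (b \<cdot>\<^sub>v x) - b \<cdot>\<^sub>v y = b \<cdot>\<^sub>v (f n i *\<^sub>v x - y)"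
      using mult_mat_vec[OF fc c(1)] c
        vec_diff_identities(5)[of "f n i *\<^sub>v x" _ y y y b] mult_mat_vec_carrier[OF fc] by auto
    then show ?thesis using h lin_subspaceD(4)[OF cycles_subspace[OF assms(1)]]
       lin_subspaceD(4)[OF cycles_subspace[OF assms(2)]] lin_subspaceD(4)[OF boundaries_subspace[OF assms(2)]]
      by (auto simp: hmap_def)
  qed
  have ar: "(rmap (ob X n) a *\<^sub>v x, rmap (ob Y n) a *\<^sub>v y) \<in> hmap X Y f n (tgt a)"
    if h: "(x, y) \<in> hmap X Y f n (src a)" for x y a
  proof -
    have c: "x \<in> cvec X n (src a)" "y \<in> cvec Y n (src a)"
      using h by (auto simp: hmap_def dest: cycles_carrier)
    have rc: "rmap (ob Y n) a \<in> carrier_mat (rdim (ob Y n) (tgt a)) (rdim (ob Y n) (src a))"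
      using is_cpx_rep[OF assms(2)] by (auto simp: is_rep_def)
    have "f n (tgt a) *\<^sub>v (rmap (ob X n) a *\<^sub>v x) - rmap (ob Y n) a *\<^sub>v y
        = rmap (ob Y n) a *\<^sub>v (f n (src a) *\<^sub>v x - y)"
      using rep_hom_arrow[OF chain_map_hom[OF assms(3)] is_cpx_rep[OF assms(1)] is_cpx_rep[OF assms(2)] c(1)]
        mult_minus_distrib_mat_vec[OF rc mult_mat_vec_carrier[OF fc c(1)] c(2)] by simp
    then show ?thesis using h rep_hom_cycles[OF assms(1)] rep_hom_cycles[OF assms(2)] rep_hom_boundaries[OF assms(2)]
      by (auto simp: hmap_def)
  qed
  have "x \<in> cvec X n i \<and> y \<in> cvec Y n i" if "(x, y) \<in> hmap X Y f n i" for x y i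
    using that by (auto simp: hmap_def dest: cycles_carrier)
  then show ?thesis unfolding rep_rel_def using add sm ar by blast
qed

lemma rep_rel_hroof:
  assumes "is_cpx X" "is_cpx Y" "r \<in> roofs X Y"
  shows "rep_rel (ob X n) (ob Y n) (hroof X Y r n)"
proof -
  obtain W s f where r: "r = (W, s, f)" by (cases r)
  have *: "is_cpx W" "chain_map W X s" "chain_map W Y f"
    using assms r by (auto simp: roofs_def quasi_iso_def)
  have "hroof X Y r n = (\<lambda>i. (hmap W X s n i)\<inverse> O hmap W Y f n i)" unfolding r by (rule ext) simp
  then show ?thesis using rep_rel_comp[OF rep_rel_converse[OF rep_rel_hmap[OF *(1) assms(1) *(2)]] rep_rel_hmap[OF *(1) assms(2) *(3)]]
    by (simp only:)
qed

section \<open>Cohomological maps and acyclic complexes\<close>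

text \<open>A relation that represents a linear map $H^n(X) \to H^n(Y)$ of representations: it is saturated under
equality of classes, defined on all classes, and sends zero to zero.\<close>

definition coh_map :: "'k::field cpx \<Rightarrow> 'k cpx \<Rightarrow> int \<Rightarrow> (vertex \<Rightarrow> ('k vec \<times> 'k vec) set) \<Rightarrow> bool" where
  "coh_map X Y n R \<longleftrightarrow> rep_rel (ob X n) (ob Y n) R \<and>
     (\<forall>i. hid X n i O R i = R i \<and> R i O hid Y n i = R i) \<and>
     (\<forall>i. \<forall>x\<in>cycles X n i. \<exists>y. (x, y) \<in> R i) \<and>
     (\<forall>i x y. (x, y) \<in> R i \<longrightarrow> x \<in> boundaries X n i \<longrightarrow> y \<in> boundaries Y n i)"

definition coh_inj :: "'k::field cpx \<Rightarrow> 'k cpx \<Rightarrow> int \<Rightarrow> (vertex \<Rightarrow> ('k vec \<times> 'k vec) set) \<Rightarrow> bool" where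
  "coh_inj X Y n R \<longleftrightarrow> (\<forall>i x y. (x, y) \<in> R i \<longrightarrow> y \<in> boundaries Y n i \<longrightarrow> x \<in> boundaries X n i)"

definition coh_sur :: "'k::field cpx \<Rightarrow> int \<Rightarrow> (vertex \<Rightarrow> ('k vec \<times> 'k vec) set) \<Rightarrow> bool" where
  "coh_sur Y n R \<longleftrightarrow> (\<forall>i. \<forall>y\<in>cycles Y n i. \<exists>x. (x, y) \<in> R i)"

definition coh_zero :: "'k::field cpx \<Rightarrow> int \<Rightarrow> bool" where
  "coh_zero X n \<longleftrightarrow> (\<forall>i. cycles X n i \<subseteq> boundaries X n i)"

lemma hid_boundaries:
  assumes "is_cpx X" "(x, y) \<in> hid X n i"
  shows "x \<in> boundaries X n i \<longleftrightarrow> y \<in> boundaries X n i"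
proof -
  have c: "x \<in> cvec X n i" "y \<in> cvec X n i" "x - y \<in> boundaries X n i"
    using assms(2) by (auto simp: hid_def dest: cycles_carrier)
  have "(x - y) + y = x" "x - (x - y) = y" using vec_diff_identities(6,7)[OF c(1,2,2,2)] .
  then show ?thesis
    using lin_subspaceD(3)[OF boundaries_subspace[OF assms(1)] c(3)]
      lin_subspace_diff[OF boundaries_subspace[OF assms(1)] _ c(3)] by metis
qed

lemma coh_mapD:
  assumes "coh_map X Y n R"
  shows "rep_rel (ob X n) (ob Y n) R" "hid X n i O R i = R i" "R i O hid Y n i = R i"
    "x \<in> cycles X n i \<Longrightarrow> \<exists>y. (x, y) \<in> R i"
    "(x, y) \<in> R i \<Longrightarrow> x \<in> boundaries X n i \<Longrightarrow> y \<in> boundaries Y n i"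
  using assms unfolding coh_map_def by metis+

lemma coh_map_cycles:
  assumes "coh_map X Y n R" "(x, y) \<in> R i"
  shows "x \<in> cycles X n i" "y \<in> cycles Y n i"
proof -
  have "(x, y) \<in> hid X n i O R i" "(x, y) \<in> R i O hid Y n i"
    using coh_mapD(2,3)[OF assms(1)] assms(2) by blast+
  then show "x \<in> cycles X n i" "y \<in> cycles Y n i" by (auto dest: hid_cycles)
qed

lemma coh_map_hmap:
  assumes "is_cpx X" "is_cpx Y" "chain_map X Y f"
  shows "coh_map X Y n (hmap X Y f n)"
  unfolding coh_map_def
proof (intro conjI allI ballI impI)
  fix i x y assume "(x, y) \<in> hmap X Y f n i" "x \<in> boundaries X n i"
  then show "y \<in> boundaries Y n i"
    using hid_boundaries[OF assms(2), of "f n i *\<^sub>v x" y n i] chain_map_boundaries[OF assms]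
    by (auto simp: hmap_eq[OF assms])
next
  fix i x assume "x \<in> cycles X n i"
  then show "\<exists>y. (x, y) \<in> hmap X Y f n i"
    using hid_refl[OF assms(2) chain_map_cycles[OF assms]] by (auto simp: hmap_eq[OF assms])
qed (use rep_rel_hmap[OF assms] hmap_unit[OF assms] in auto)

lemma coh_map_roof:
  assumes "is_cpx X" "is_cpx Y" "r \<in> roofs X Y"
  shows "coh_map X Y n (hroof X Y r n)"
proof -
  obtain W s f where r: "r = (W, s, f)" by (cases r)
  have *: "is_cpx W" "chain_map W X s" "chain_map W Y f" "quasi_iso W X s"
    using assms r by (auto simp: roofs_def quasi_iso_def)
  let ?S = "hmap W X s n" and ?F = "hmap W Y f n"
  have e: "hroof X Y r n i = (?S i)\<inverse> O ?F i" for i unfolding r by simp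
  have "sym (hid X n i)" for i using hid_equiv[OF assms(1)] by (auto simp: equiv_def)
  then have "hid X n i O (?S i)\<inverse> = (?S i O hid X n i)\<inverse>" for i
    by (simp add: converse_relcomp sym_conv_converse_eq)
  then have 1: "hid X n i O (?S i)\<inverse> = (?S i)\<inverse>" for i using hmap_unit(2)[OF *(1) assms(1) *(2)] by simp
  have tot: "\<exists>y. (x, y) \<in> hroof X Y r n i" if "x \<in> cycles X n i" for x i
  proof -
    have "(x, x) \<in> (?S i)\<inverse> O ?S i" using hmap_quasi_iso(1)[OF *(1) assms(1) *(4)] hid_refl[OF assms(1) that] by simp
    then obtain w where "(w, x) \<in> ?S i" by auto
    then show ?thesis using coh_mapD(4)[OF coh_map_hmap[OF *(1) assms(2) *(3)], of w n i]
        coh_map_cycles(1)[OF coh_map_hmap[OF *(1) assms(1) *(2)]] unfolding e by blast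
  qed
  have sv: "y \<in> boundaries Y n i" if xy: "(x, y) \<in> hroof X Y r n i" "x \<in> boundaries X n i" for x y i
  proof -
    obtain w where w: "(w, x) \<in> ?S i" "(w, y) \<in> ?F i" using xy(1) unfolding e by blast
    have "w \<in> cycles W n i" "s n i *\<^sub>v w \<in> boundaries X n i"
      using w(1) xy(2) hid_boundaries[OF assms(1)] unfolding hmap_eq[OF *(1) assms(1) *(2)] by blast+
    then have "w \<in> boundaries W n i" using *(4) by (auto simp: quasi_iso_def)
    then show ?thesis using coh_mapD(5)[OF coh_map_hmap[OF *(1) assms(2) *(3)] w(2)] by blast
  qed
  have "hid X n i O hroof X Y r n i = hroof X Y r n i" "hroof X Y r n i O hid Y n i = hroof X Y r n i" for i
    unfolding e using 1 hmap_unit(2)[OF *(1) assms(2) *(3)] by (simp_all add: O_assoc) (simp add: O_assoc[symmetric])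
  then show ?thesis unfolding coh_map_def using rep_rel_hroof[OF assms] tot sv by blast
qed

lemma coh_map_hrel:
  assumes "is_cpx X" "is_cpx Y" "\<phi> \<in> Db_hom X Y"
  shows "coh_map X Y n (hrel X Y \<phi> n)"
proof -
  obtain r where r: "r \<in> \<phi>" using Db_hom_nonempty[OF assms] .
  have "hrel X Y \<phi> n = hroof X Y r n" using Db_hom_hrel(2)[OF assms r] by (intro ext)
  then show ?thesis using coh_map_roof[OF assms(1,2) Db_hom_hrel(1)[OF assms r]] by simp
qed

lemma coh_map_comp:
  assumes R: "coh_map X Y n R" and S: "coh_map Y Z n S"
  shows "coh_map X Z n (\<lambda>i. R i O S i)"
  unfolding coh_map_def
proof (intro conjI allI ballI impI)
  show "rep_rel (ob X n) (ob Z n) (\<lambda>i. R i O S i)" using rep_rel_comp coh_mapD(1)[OF R] coh_mapD(1)[OF S] by blast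
  show "hid X n i O R i O S i = R i O S i" "(R i O S i) O hid Z n i = R i O S i" for i
    using coh_mapD(2)[OF R, of i] coh_mapD(3)[OF S, of i] by (simp_all add: O_assoc) (simp add: O_assoc[symmetric])
  show "\<exists>y. (x, y) \<in> R i O S i" if "x \<in> cycles X n i" for x i
    using coh_mapD(4)[OF R that] coh_mapD(4)[OF S] coh_map_cycles(2)[OF R] by blast
  show "y \<in> boundaries Z n i" if "(x, y) \<in> R i O S i" "x \<in> boundaries X n i" for x y i
    using that coh_mapD(5)[OF R] coh_mapD(5)[OF S] by blast
qed

lemma coh_inj_comp:
  "coh_inj X Y n R \<Longrightarrow> coh_inj Y Z n S \<Longrightarrow> coh_inj X Z n (\<lambda>i. R i O S i)"
  unfolding coh_inj_def by blast

lemma coh_map_converse: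
  assumes X: "is_cpx X" and Y: "is_cpx Y" and R: "coh_map X Y n R" and i: "coh_inj X Y n R" and s: "coh_sur Y n R"
  shows "coh_map Y X n (\<lambda>i. (R i)\<inverse>)" "coh_inj Y X n (\<lambda>i. (R i)\<inverse>)"
proof -
  have "hid Y n i O (R i)\<inverse> = (R i)\<inverse>" "(R i)\<inverse> O hid X n i = (R i)\<inverse>" for i
  proof -
    have "sym (hid X n i)" "sym (hid Y n i)" using hid_equiv[OF X] hid_equiv[OF Y] by (auto simp: equiv_def)
    then have "hid Y n i O (R i)\<inverse> = (R i O hid Y n i)\<inverse>" "(R i)\<inverse> O hid X n i = (hid X n i O R i)\<inverse>"
      by (simp_all add: converse_relcomp sym_conv_converse_eq)
    then show "hid Y n i O (R i)\<inverse> = (R i)\<inverse>" "(R i)\<inverse> O hid X n i = (R i)\<inverse>"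
      using coh_mapD(2,3)[OF R] by simp_all
  qed
  then show "coh_map Y X n (\<lambda>i. (R i)\<inverse>)"
    unfolding coh_map_def using rep_rel_converse[OF coh_mapD(1)[OF R]] i s by (simp add: coh_inj_def coh_sur_def)
  show "coh_inj Y X n (\<lambda>i. (R i)\<inverse>)" using coh_mapD(5)[OF R] unfolding coh_inj_def by blast
qed

lemma coh_inj_eq:
  assumes X: "is_cpx X" and Y: "is_cpx Y" and R: "coh_map X Y n R" and i: "coh_inj X Y n R"
    and xy: "(x, y) \<in> R i" "(x', y') \<in> R i" "(y, y') \<in> hid Y n i"
  shows "(x, x') \<in> hid X n i"
proof -
  have "(x - x', y - y') \<in> R i" by (rule rep_rel_diff[OF coh_mapD(1)[OF R] xy(1,2)])
  then show ?thesis using xy coh_map_cycles[OF R] i by (auto simp: hid_def coh_inj_def)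
qed

text \<open>The two composites of an isomorphism with its inverse act as the identity on cohomology.\<close>

lemma Db_iso_coh:
  assumes X: "is_cpx X" and Y: "is_cpx Y" and iso: "Db_iso X Y \<phi>"
  shows "coh_map X Y n (hrel X Y \<phi> n)" "coh_inj X Y n (hrel X Y \<phi> n)" "coh_sur Y n (hrel X Y \<phi> n)"
proof -
  obtain \<psi> where *: "\<phi> \<in> Db_hom X Y" "\<psi> \<in> Db_hom Y X" "Db_comp X Y X \<psi> \<phi> = Db_id X" "Db_comp Y X Y \<phi> \<psi> = Db_id Y"
    using iso by (auto simp: Db_iso_def)
  have m: "(X, cm_id X, cm_id X) \<in> Db_comp X Y X \<psi> \<phi>" "(Y, cm_id Y, cm_id Y) \<in> Db_comp Y X Y \<phi> \<psi>"
    using *(3,4) Db_of_hom(2)[OF X X chain_map_id[OF X]] Db_of_hom(2)[OF Y Y chain_map_id[OF Y]]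
    by (simp_all add: Db_id_def)
  have 1: "hrel X Y \<phi> n i O hrel Y X \<psi> n i = hid X n i" for i
    using hroof_Db_comp[OF X Y X *(1,2) m(1)] hroof_id[OF X X chain_map_id[OF X]] by (simp add: hmap_id)
  have 2: "hrel Y X \<psi> n i O hrel X Y \<phi> n i = hid Y n i" for i
    using hroof_Db_comp[OF Y X Y *(2,1) m(2)] hroof_id[OF Y Y chain_map_id[OF Y]] by (simp add: hmap_id)
  show A: "coh_map X Y n (hrel X Y \<phi> n)" by (rule coh_map_hrel[OF X Y *(1)])
  have B: "coh_map Y X n (hrel Y X \<psi> n)" by (rule coh_map_hrel[OF Y X *(2)])
  show "coh_inj X Y n (hrel X Y \<phi> n)"
    unfolding coh_inj_def
  proof (intro allI impI)
    fix i x y assume xy: "(x, y) \<in> hrel X Y \<phi> n i" "y \<in> boundaries Y n i"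
    obtain z where z: "(y, z) \<in> hrel Y X \<psi> n i" using coh_mapD(4)[OF B] coh_map_cycles(2)[OF A xy(1)] by blast
    have "z \<in> boundaries X n i" using coh_mapD(5)[OF B z] xy by blast
    moreover have "(x, z) \<in> hid X n i" using xy z 1 by blast
    ultimately show "x \<in> boundaries X n i" using hid_boundaries[OF X] by blast
  qed
  show "coh_sur Y n (hrel X Y \<phi> n)"
    unfolding coh_sur_def using 2 hid_refl[OF Y] by blast
qed

lemma coh_zero_transfer:
  assumes R: "coh_map X Y n R" and i: "coh_inj X Y n R" and Y: "coh_zero Y n"
  shows "coh_zero X n"
  unfolding coh_zero_def
proof (intro allI subsetI)
  fix i x assume "x \<in> cycles X n i"
  then obtain y where "(x, y) \<in> R i" using coh_mapD(4)[OF R] by blast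
  then show "x \<in> boundaries X n i" using i Y coh_map_cycles(2)[OF R] unfolding coh_inj_def coh_zero_def by blast
qed

lemma coh_zero_image:
  assumes R: "coh_map X Y n R" and s: "coh_sur Y n R" and X: "coh_zero X n"
  shows "coh_zero Y n"
  unfolding coh_zero_def
proof (intro allI subsetI)
  fix i y assume "y \<in> cycles Y n i"
  then obtain x where "(x, y) \<in> R i" using s by (auto simp: coh_sur_def)
  then show "y \<in> boundaries Y n i" using X coh_map_cycles(1)[OF R] coh_mapD(5)[OF R] unfolding coh_zero_def by blast
qed

lemma Db_isomorphic_coh_zero:
  assumes "is_cpx X" "is_cpx Y" "Db_isomorphic X Y"
  shows "coh_zero X n \<longleftrightarrow> coh_zero Y n"
  using assms coh_zero_transfer[OF Db_iso_coh(1,2)] coh_zero_image[OF Db_iso_coh(1,3)]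
  unfolding Db_isomorphic_def by blast

definition acyclic_cpx :: "'k::field cpx \<Rightarrow> bool" where
  "acyclic_cpx X \<longleftrightarrow> (\<forall>n. coh_zero X n)"

lemma nonzero_zero_rep: "\<not> nonzero_rep (zero_rep :: 'k::field rep)"
  by (simp add: nonzero_rep_def zero_rep_def)

lemma is_rep_zero: "is_rep zero_rep"
  by (auto simp: is_rep_def zero_rep_def)

lemma is_cpx_zero: "is_cpx (zero_cpx :: 'k::field cpx)"
  using rep_hom_zero[OF is_rep_zero is_rep_zero] is_rep_zero nonzero_zero_rep
  by (auto simp: is_cpx_def zero_cpx_def) (auto simp: zero_rep_def)

lemma acyclic_zero: "acyclic_cpx (zero_cpx :: 'k::field cpx)"
proof -
  have "x \<in> boundaries zero_cpx n i" if "x \<in> cycles (zero_cpx :: 'k cpx) n i" for x n i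
  proof -
    have z: "rdim (ob (zero_cpx :: 'k cpx) n) i = 0" by (simp add: zero_cpx_def zero_rep_def)
    have "x = 0\<^sub>v (rdim (ob (zero_cpx :: 'k cpx) n) i)" using cycles_carrier[OF that] unfolding z by (intro eq_vecI) auto
    then show ?thesis using lin_subspaceD(2)[OF boundaries_subspace[OF is_cpx_zero]] by simp
  qed
  then show ?thesis by (auto simp: acyclic_cpx_def coh_zero_def)
qed

lemma quasi_iso_acyclic:
  assumes "is_cpx X" "is_cpx Y" "chain_map X Y f" "acyclic_cpx X" "acyclic_cpx Y"
  shows "quasi_iso X Y f"
proof -
  have "\<exists>x\<in>cycles X n i. y - f n i *\<^sub>v x \<in> boundaries Y n i" if "y \<in> cycles Y n i" for y n i
  proof -
    have "y \<in> boundaries Y n i" using that assms(5) by (auto simp: acyclic_cpx_def coh_zero_def)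
    moreover have "0\<^sub>v (rdim (ob X n) i) \<in> cycles X n i" using lin_subspaceD(2)[OF cycles_subspace[OF assms(1)]] .
    ultimately show ?thesis
      using lin_subspace_diff[OF boundaries_subspace[OF assms(2)]] mult_mat_vec_0[OF chain_map_carrier[OF assms(3)]]
        lin_subspaceD(2)[OF boundaries_subspace[OF assms(2)]] by metis
  qed
  then show ?thesis using assms unfolding quasi_iso_def acyclic_cpx_def coh_zero_def by blast
qed

lemma acyclic_quasi_iso:
  assumes "is_cpx W" "is_cpx X" "quasi_iso W X s" "acyclic_cpx X"
  shows "acyclic_cpx W"
  unfolding acyclic_cpx_def coh_zero_def
proof (intro allI subsetI)
  fix n i x assume x: "x \<in> cycles W n i"
  have "s n i *\<^sub>v x \<in> cycles X n i" using chain_map_cycles[OF assms(1,2)] x assms(3) by (auto simp: quasi_iso_def)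
  then show "x \<in> boundaries W n i" using x assms(3,4) unfolding quasi_iso_def acyclic_cpx_def coh_zero_def by blast
qed

lemma homotopic_from_zero:
  assumes "is_cpx Y" "chain_map zero_cpx Y f" "chain_map zero_cpx Y g"
  shows "homotopic zero_cpx Y f g"
proof -
  have "f n i = g n i" for n i
    using chain_map_carrier[OF assms(2), of n i] chain_map_carrier[OF assms(3), of n i]
    by (intro eq_matI) (auto simp: zero_cpx_def zero_rep_def)
  then have "f = g" by (intro ext)
  then show ?thesis using homotopic_refl[OF is_cpx_zero assms(1,2)] by simp
qed

text \<open>The zero complex refines any two roofs out of an acyclic complex, because its map to an acyclic apex is
a quasi-isomorphism and any two maps out of it agree. Hence morphism sets between acyclic
complexes are singletons, which makes all the diagrams in the next lemmas commute trivially.\<close>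

lemma roof_eq_acyclic:
  assumes X: "is_cpx X" and Y: "is_cpx Y" and aX: "acyclic_cpx X"
  shows "roof_eq X Y = roofs X Y \<times> roofs X Y"
proof -
  have "((W, s, f), (W', s', f')) \<in> roof_eq X Y" if r: "(W, s, f) \<in> roofs X Y" "(W', s', f') \<in> roofs X Y"
    for W s f W' s' f'
  proof -
    have *: "is_cpx W" "quasi_iso W X s" "chain_map W X s" "chain_map W Y f"
      "is_cpx W'" "quasi_iso W' X s'" "chain_map W' X s'" "chain_map W' Y f'"
      using r by (auto simp: roofs_def quasi_iso_def)
    let ?u = "cm_zero zero_cpx W" and ?v = "cm_zero zero_cpx W'"
    have z: "chain_map zero_cpx W ?u" "chain_map zero_cpx W' ?v"
      using chain_map_zero[OF is_cpx_zero] * by blast+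
    have q: "quasi_iso zero_cpx W ?u" "quasi_iso zero_cpx W' ?v"
      using quasi_iso_acyclic[OF is_cpx_zero *(1) z(1) acyclic_zero acyclic_quasi_iso[OF *(1) X *(2) aX]]
        quasi_iso_acyclic[OF is_cpx_zero *(5) z(2) acyclic_zero acyclic_quasi_iso[OF *(5) X *(6) aX]] .
    have h: "homotopic zero_cpx X (s \<circ>\<^sub>c ?u) (s' \<circ>\<^sub>c ?v)" "homotopic zero_cpx Y (f \<circ>\<^sub>c ?u) (f' \<circ>\<^sub>c ?v)"
      using homotopic_from_zero[OF X] homotopic_from_zero[OF Y] chain_map_comp[OF is_cpx_zero] * z X Y by blast+
    show ?thesis unfolding roof_eq_def mem_Collect_eq prod.case using r q h is_cpx_zero by blast
  qed
  then show ?thesis by (auto simp: roof_eq_def)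
qed

lemma Db_of_acyclic:
  assumes "is_cpx X" "is_cpx Y" "acyclic_cpx X" "chain_map X Y f"
  shows "Db_of X Y f = roofs X Y"
  using roof_eq_acyclic[OF assms(1-3)] id_roof[OF assms(1,4)] by (auto simp: Db_of_def)

lemma roofs_nonempty: "is_cpx X \<Longrightarrow> is_cpx Y \<Longrightarrow> roofs X Y \<noteq> {}"
  using id_roof[OF _ chain_map_zero] by blast

lemma Db_hom_acyclic:
  assumes "is_cpx X" "is_cpx Y" "acyclic_cpx X"
  shows "Db_hom X Y = {roofs X Y}"
  using roof_eq_acyclic[OF assms] roofs_nonempty[OF assms(1,2)] by (auto simp: Db_hom_def quotient_def)

lemma Db_comp_acyclic:
  assumes X: "is_cpx X" and Y: "is_cpx Y" and Z: "is_cpx Z" and a: "acyclic_cpx X" "acyclic_cpx Y"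
    and ne: "\<phi> \<inter> roofs X Y \<noteq> {}" "\<psi> \<inter> roofs Y Z \<noteq> {}"
  shows "Db_comp X Y Z \<psi> \<phi> = roofs X Z"
proof -
  obtain W s f where 1: "(W, s, f) \<in> \<phi>" "(W, s, f) \<in> roofs X Y" using ne(1) by auto
  obtain W' t g where 2: "(W', t, g) \<in> \<psi>" "(W', t, g) \<in> roofs Y Z" using ne(2) by auto
  have *: "is_cpx W" "quasi_iso W X s" "chain_map W X s" "chain_map W Y f"
      "is_cpx W'" "quasi_iso W' Y t" "chain_map W' Y t" "chain_map W' Z g"
    using 1(2) 2(2) by (auto simp: roofs_def quasi_iso_def)
  \<comment> \<open>The zero complex serves as the apex of a composite.\<close>
  let ?h = "cm_zero zero_cpx W" and ?k = "cm_zero zero_cpx W'"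
  have z: "chain_map zero_cpx W ?h" "chain_map zero_cpx W' ?k"
    using chain_map_zero[OF is_cpx_zero] * by blast+
  have q: "quasi_iso zero_cpx W ?h"
    using quasi_iso_acyclic[OF is_cpx_zero *(1) z(1) acyclic_zero acyclic_quasi_iso[OF *(1) X *(2) a(1)]] .
  have h: "homotopic zero_cpx Y (f \<circ>\<^sub>c ?h) (t \<circ>\<^sub>c ?k)"
    using homotopic_from_zero[OF Y] chain_map_comp[OF is_cpx_zero] * z Y by blast
  have c: "chain_map zero_cpx X (s \<circ>\<^sub>c ?h)" "chain_map zero_cpx Z (g \<circ>\<^sub>c ?k)"
    using chain_map_comp[OF is_cpx_zero *(1) X z(1) *(3)] chain_map_comp[OF is_cpx_zero *(5) Z z(2) *(8)] .
  have "(zero_cpx, s \<circ>\<^sub>c ?h, g \<circ>\<^sub>c ?k) \<in> roofs X Z"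
    using quasi_iso_acyclic[OF is_cpx_zero X c(1) acyclic_zero a(1)] c(2) is_cpx_zero by (auto simp: roofs_def)
  then have "((zero_cpx, s \<circ>\<^sub>c ?h, g \<circ>\<^sub>c ?k), r) \<in> roof_eq X Z" if "r \<in> roofs X Z" for r
    using that roof_eq_acyclic[OF X Z a(1)] by blast
  then have "roofs X Z \<subseteq> Db_comp X Y Z \<psi> \<phi>"
    unfolding Db_comp_def using 1(1) 2(1) is_cpx_zero q z(2) h by blast
  moreover have "Db_comp X Y Z \<psi> \<phi> \<subseteq> roofs X Z"
    unfolding Db_comp_def roof_eq_def by blast
  ultimately show ?thesis by blast
qed

lemma Db_iso_acyclic:
  assumes "is_cpx X" "is_cpx Y" "acyclic_cpx X" "acyclic_cpx Y"
  shows "Db_iso X Y (roofs X Y)"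
  using Db_hom_acyclic[OF assms(1,2,3)] Db_hom_acyclic[OF assms(2,1,4)]
    Db_comp_acyclic[OF assms(1,2,1,3,4), of "roofs X Y" "roofs Y X"]
    Db_comp_acyclic[OF assms(2,1,2,4,3), of "roofs Y X" "roofs X Y"]
    roofs_nonempty[OF assms(1,2)] roofs_nonempty[OF assms(2,1)]
    Db_of_acyclic[OF assms(1,1,3) chain_map_id[OF assms(1)]] Db_of_acyclic[OF assms(2,2,4) chain_map_id[OF assms(2)]]
  by (auto simp: Db_iso_def Db_id_def)

text \<open>An isomorphism with the zero complex kills cohomology; conversely the unique morphisms between acyclic
complexes are mutually inverse.\<close>

lemma Db_nonzero_iff:
  assumes "is_cpx X" shows "Db_nonzero X \<longleftrightarrow> \<not> acyclic_cpx X"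
  using Db_iso_acyclic[OF assms is_cpx_zero _ acyclic_zero] Db_isomorphic_coh_zero[OF assms is_cpx_zero]
    acyclic_zero unfolding Db_nonzero_def Db_isomorphic_def acyclic_cpx_def by blast

section \<open>Mapping cones and distinguished triangles\<close>

lemma mat_eq_mult_vecI:
  assumes A: "(A :: 'k::field mat) \<in> carrier_mat nr nc" and B: "B \<in> carrier_mat nr nc"
    and e: "\<And>x. x \<in> carrier_vec nc \<Longrightarrow> A *\<^sub>v x = B *\<^sub>v x"
  shows "A = B"
proof (rule eq_matI)
  fix i j assume ij: "i < dim_row B" "j < dim_col B"
  have "(A *\<^sub>v unit_vec nc j) $ i = (B *\<^sub>v unit_vec nc j) $ i" using e by simp
  then show "A $$ (i, j) = B $$ (i, j)" using A B ij by simp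
qed (use A B in auto)

lemma mult_mat_uminus_vec:
  assumes A: "(A :: 'k::field mat) \<in> carrier_mat nr nc" and x: "x \<in> carrier_vec nc"
  shows "A *\<^sub>v (- x) = - (A *\<^sub>v x)"
  using mult_minus_distrib_mat_vec[OF A zero_carrier_vec x] mult_mat_vec_0[OF A]
    vec_diff_identities(8)[OF x x x x] vec_diff_identities(8)[of "A *\<^sub>v x" nr] mult_mat_vec_carrier[OF A x]
  by simp

lemma append_vec_cases:
  assumes "v \<in> carrier_vec (n + m)"
  obtains x y where "x \<in> carrier_vec n" "y \<in> carrier_vec m" "v = x @\<^sub>v y"
  using vec_first_last_append[OF assms] by (metis vec_first_carrier vec_last_carrier)

lemma append_vec_zero: "0\<^sub>v n @\<^sub>v 0\<^sub>v m = 0\<^sub>v (n + m)"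
  by (rule eq_vecI) (auto simp: append_vec_def)

lemma append_vec_diff:
  assumes "x \<in> carrier_vec n" "x' \<in> carrier_vec n" "y \<in> carrier_vec m" "y' \<in> carrier_vec m"
  shows "(x @\<^sub>v y) - (x' @\<^sub>v y') = (x - x') @\<^sub>v (y - (y' :: 'k::field vec))"
  using assms by (intro eq_vecI) (auto simp: append_vec_def)

lemma block_diag_carrier:
  "A \<in> carrier_mat nr nc \<Longrightarrow> B \<in> carrier_mat mr mc \<Longrightarrow> block_diag A B \<in> carrier_mat (nr + mr) (nc + mc)"
  unfolding block_diag_def by simp

lemma block_diag_mult_vec:
  assumes A: "(A :: 'k::field mat) \<in> carrier_mat nr nc" and B: "B \<in> carrier_mat mr mc"
    and x: "x \<in> carrier_vec nc" and y: "y \<in> carrier_vec mc"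
  shows "block_diag A B *\<^sub>v (x @\<^sub>v y) = (A *\<^sub>v x) @\<^sub>v (B *\<^sub>v y)"
proof -
  have d: "dim_row A = nr" "dim_col B = mc" "dim_row B = mr" "dim_col A = nc" using A B by auto
  show ?thesis
    unfolding block_diag_def d
    using four_block_mat_mult_vec[OF A _ _ B x y, of "0\<^sub>m nr mc" "0\<^sub>m mr nc"]
      zero_mult_mat_vec[OF y, of nr] zero_mult_mat_vec[OF x, of mr] mult_mat_vec_carrier[OF A x] mult_mat_vec_carrier[OF B y]
    by simp
qed

lemma is_rep_sum: "is_rep V \<Longrightarrow> is_rep W \<Longrightarrow> is_rep (rep_sum V W)"
  by (auto simp: is_rep_def rep_sum_def intro!: block_diag_carrier)

context
  fixes X Y :: "'k::field cpx" and f :: "'k cmap"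
  assumes X: "is_cpx X" and Y: "is_cpx Y" and f: "chain_map X Y f"
begin

lemma cone_dim: "rdim (ob (cone X Y f) n) i = rdim (ob X (n+1)) i + rdim (ob Y n) i"
  by (simp add: cone_def rep_sum_def)

lemma cone_dif_carrier:
  "dif (cone X Y f) n i \<in> carrier_mat (rdim (ob (cone X Y f) (n+1)) i) (rdim (ob (cone X Y f) n) i)"
proof -
  have "- dif X (n+1) i \<in> carrier_mat (rdim (ob X (n+2)) i) (rdim (ob X (n+1)) i)"
    using dif_carrier[OF X, of "n+1" i] by (simp add: add.assoc)
  then show ?thesis unfolding cone_dim using dif_carrier[OF Y, of n i] by (simp add: cone_def add.assoc)
qed

lemma cone_dif_vec:
  assumes x: "x \<in> cvec X (n+1) i" and y: "y \<in> cvec Y n i"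
  shows "dif (cone X Y f) n i *\<^sub>v (x @\<^sub>v y) = (- (dif X (n+1) i *\<^sub>v x)) @\<^sub>v (f (n+1) i *\<^sub>v x + dif Y n i *\<^sub>v y)"
proof -
  have d: "dif X (n+1) i \<in> carrier_mat (rdim (ob X (n+2)) i) (rdim (ob X (n+1)) i)"
    using dif_carrier[OF X, of "n+1" i] by (simp add: add.assoc)
  have "- dif X (n+1) i \<in> carrier_mat (rdim (ob X (n+2)) i) (rdim (ob X (n+1)) i)" using d by simp
  note e = four_block_mat_mult_vec[OF this zero_carrier_mat chain_map_carrier[OF f] dif_carrier[OF Y] x y]
  show ?thesis
    using e x d zero_mult_mat_vec[OF y] mult_mat_vec_carrier[OF d x] by (simp add: cone_def)
qed

lemma cone_is_rep: "is_rep (ob (cone X Y f) n)"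
  using is_rep_sum[OF is_cpx_rep[OF X, of "n+1"] is_cpx_rep[OF Y, of n]] by (simp add: cone_def)

lemma cone_rmap_vec:
  assumes "x \<in> cvec X (n+1) (src a)" and "y \<in> cvec Y n (src a)"
  shows "rmap (ob (cone X Y f) n) a *\<^sub>v (x @\<^sub>v y) = (rmap (ob X (n+1)) a *\<^sub>v x) @\<^sub>v (rmap (ob Y n) a *\<^sub>v y)"
proof -
  have "rmap (ob X (n+1)) a \<in> carrier_mat (rdim (ob X (n+1)) (tgt a)) (rdim (ob X (n+1)) (src a))"
    "rmap (ob Y n) a \<in> carrier_mat (rdim (ob Y n) (tgt a)) (rdim (ob Y n) (src a))"
    using is_cpx_rep[OF X] is_cpx_rep[OF Y] unfolding is_rep_def by blast+
  from block_diag_mult_vec[OF this assms] show ?thesis by (simp add: cone_def rep_sum_def)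
qed

text \<open>The terms \<open>f d\<close> and \<open>d f\<close> of the squared differential cancel because the differential of the shifted
summand carries a sign.\<close>

lemma is_cpx_cone: "is_cpx (cone X Y f)"
proof -
  let ?C = "cone X Y f"
  have arrow: "dif ?C n (tgt a) * rmap (ob ?C n) a = rmap (ob ?C (n+1)) a * dif ?C n (src a)" for n a
  proof (rule mat_eq_mult_vecI)
    have r: "rmap (ob ?C n) a \<in> carrier_mat (rdim (ob ?C n) (tgt a)) (rdim (ob ?C n) (src a))" for n
      using cone_is_rep by (auto simp: is_rep_def)
    show "dif ?C n (tgt a) * rmap (ob ?C n) a \<in> carrier_mat (rdim (ob ?C (n+1)) (tgt a)) (rdim (ob ?C n) (src a))"
      "rmap (ob ?C (n+1)) a * dif ?C n (src a) \<in> carrier_mat (rdim (ob ?C (n+1)) (tgt a)) (rdim (ob ?C n) (src a))"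
      using mult_carrier_mat[OF cone_dif_carrier r] mult_carrier_mat[OF r cone_dif_carrier] .
    fix v assume v: "v \<in> cvec ?C n (src a)"
    then obtain x y where xy: "x \<in> cvec X (n+1) (src a)" "y \<in> cvec Y n (src a)" "v = x @\<^sub>v y"
      unfolding cone_dim by (rule append_vec_cases)
    have xc: "rmap (ob X (n+1)) a *\<^sub>v x \<in> cvec X (n+1) (tgt a)" "rmap (ob Y n) a *\<^sub>v y \<in> cvec Y n (tgt a)"
      using rmap_carrier_vec[OF is_cpx_rep[OF X] xy(1)] rmap_carrier_vec[OF is_cpx_rep[OF Y] xy(2)] .
    have dxc: "dif X (n+1) (src a) *\<^sub>v x \<in> cvec X (n+1+1) (src a)"
      "f (n+1) (src a) *\<^sub>v x \<in> cvec Y (n+1) (src a)" "dif Y n (src a) *\<^sub>v y \<in> cvec Y (n+1) (src a)"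
      using mult_mat_vec_carrier[OF dif_carrier[OF X] xy(1)] mult_mat_vec_carrier[OF chain_map_carrier[OF f] xy(1)]
        mult_mat_vec_carrier[OF dif_carrier[OF Y] xy(2)] .
    have rY: "rmap (ob Y (n+1)) a \<in> carrier_mat (rdim (ob Y (n+1)) (tgt a)) (rdim (ob Y (n+1)) (src a))"
      and rX: "rmap (ob X (n+1+1)) a \<in> carrier_mat (rdim (ob X (n+1+1)) (tgt a)) (rdim (ob X (n+1+1)) (src a))"
      using is_cpx_rep[OF X] is_cpx_rep[OF Y] by (auto simp: is_rep_def)
    have neg: "- (rmap (ob X (n+1+1)) a *\<^sub>v (dif X (n+1) (src a) *\<^sub>v x)) =
        rmap (ob X (n+1+1)) a *\<^sub>v (- (dif X (n+1) (src a) *\<^sub>v x))"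
      using mult_mat_uminus_vec[OF rX dxc(1)] by simp
    have "(dif ?C n (tgt a) * rmap (ob ?C n) a) *\<^sub>v v = dif ?C n (tgt a) *\<^sub>v (rmap (ob ?C n) a *\<^sub>v v)"
      using assoc_mult_mat_vec[OF cone_dif_carrier r v] .
    also have "\<dots> = (- (dif X (n+1) (tgt a) *\<^sub>v (rmap (ob X (n+1)) a *\<^sub>v x))) @\<^sub>v
        (f (n+1) (tgt a) *\<^sub>v (rmap (ob X (n+1)) a *\<^sub>v x) + dif Y n (tgt a) *\<^sub>v (rmap (ob Y n) a *\<^sub>v y))"
      unfolding xy(3) cone_rmap_vec[OF xy(1,2)] cone_dif_vec[OF xc] ..
    also have "\<dots> = (rmap (ob X (n+1+1)) a *\<^sub>v (- (dif X (n+1) (src a) *\<^sub>v x))) @\<^sub>v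
        (rmap (ob Y (n+1)) a *\<^sub>v (f (n+1) (src a) *\<^sub>v x + dif Y n (src a) *\<^sub>v y))"
      unfolding neg[symmetric] mult_add_distrib_mat_vec[OF rY dxc(2,3)]
        rep_hom_arrow[OF is_cpx_dif_hom[OF X] is_cpx_rep[OF X] is_cpx_rep[OF X] xy(1)]
        rep_hom_arrow[OF is_cpx_dif_hom[OF Y] is_cpx_rep[OF Y] is_cpx_rep[OF Y] xy(2)]
        rep_hom_arrow[OF chain_map_hom[OF f] is_cpx_rep[OF X] is_cpx_rep[OF Y] xy(1)] ..
    also have "\<dots> = rmap (ob ?C (n+1)) a *\<^sub>v (dif ?C n (src a) *\<^sub>v v)"
      unfolding xy(3) cone_dif_vec[OF xy(1,2)]
      by (rule cone_rmap_vec[symmetric]) (use dxc in simp_all)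
    also have "\<dots> = (rmap (ob ?C (n+1)) a * dif ?C n (src a)) *\<^sub>v v"
      using assoc_mult_mat_vec[OF r cone_dif_carrier v] by simp
    finally show "(dif ?C n (tgt a) * rmap (ob ?C n) a) *\<^sub>v v = (rmap (ob ?C (n+1)) a * dif ?C n (src a)) *\<^sub>v v" .
  qed
  have dd: "dif ?C (n+1) i * dif ?C n i = 0\<^sub>m (rdim (ob ?C (n+2)) i) (rdim (ob ?C n) i)" for n i
  proof (rule mat_eq_mult_vecI)
    have c: "dif ?C (n+1) i \<in> carrier_mat (rdim (ob ?C (n+2)) i) (rdim (ob ?C (n+1)) i)"
      using cone_dif_carrier[of "n+1" i] by (simp add: add.assoc)
    show "dif ?C (n+1) i * dif ?C n i \<in> carrier_mat (rdim (ob ?C (n+2)) i) (rdim (ob ?C n) i)"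
      using mult_carrier_mat[OF c cone_dif_carrier] .
    fix v assume v: "v \<in> cvec ?C n i"
    then obtain x y where xy: "x \<in> cvec X (n+1) i" "y \<in> cvec Y n i" "v = x @\<^sub>v y"
      unfolding cone_dim by (rule append_vec_cases)
    have dxc: "dif X (n+1) i *\<^sub>v x \<in> cvec X (n+1+1) i"
      "f (n+1) i *\<^sub>v x \<in> cvec Y (n+1) i" "dif Y n i *\<^sub>v y \<in> cvec Y (n+1) i"
      using mult_mat_vec_carrier[OF dif_carrier[OF X] xy(1)] mult_mat_vec_carrier[OF chain_map_carrier[OF f] xy(1)]
        mult_mat_vec_carrier[OF dif_carrier[OF Y] xy(2)] .
    have mdx: "- (dif X (n+1) i *\<^sub>v x) \<in> cvec X (n+1+1) i" using dxc(1) by simp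
    have neg: "A *\<^sub>v (- (dif X (n+1) i *\<^sub>v x)) = - (A *\<^sub>v (dif X (n+1) i *\<^sub>v x))"
      if "A \<in> carrier_mat m (rdim (ob X (n+1+1)) i)" for A m
      using mult_mat_uminus_vec[OF that dxc(1)] .
    have fd: "f (n+1+1) i *\<^sub>v (dif X (n+1) i *\<^sub>v x) = dif Y (n+1) i *\<^sub>v (f (n+1) i *\<^sub>v x)"
      using chain_map_dif[OF X Y f xy(1)] by simp
    have fc: "dif Y (n+1) i *\<^sub>v (f (n+1) i *\<^sub>v x) \<in> cvec Y (n+1+1) i"
      using mult_mat_vec_carrier[OF dif_carrier[OF Y] dxc(2)] .
    have ddX: "dif X (n+1+1) i *\<^sub>v (dif X (n+1) i *\<^sub>v x) = 0\<^sub>v (rdim (ob X (n+3)) i)"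
      using dif_dif[OF X xy(1)] by (simp add: add.assoc)
    have ddY: "dif Y (n+1) i *\<^sub>v (dif Y n i *\<^sub>v y) = 0\<^sub>v (rdim (ob Y (n+1+1)) i)"
      using dif_dif[OF Y xy(2)] by (simp add: add.assoc)
    have "(dif ?C (n+1) i * dif ?C n i) *\<^sub>v v = dif ?C (n+1) i *\<^sub>v (dif ?C n i *\<^sub>v v)"
      using assoc_mult_mat_vec[OF c cone_dif_carrier v] .
    also have "\<dots> = (- (dif X (n+1+1) i *\<^sub>v (- (dif X (n+1) i *\<^sub>v x)))) @\<^sub>v
       (f (n+1+1) i *\<^sub>v (- (dif X (n+1) i *\<^sub>v x)) + dif Y (n+1) i *\<^sub>v (f (n+1) i *\<^sub>v x + dif Y n i *\<^sub>v y))"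
      unfolding xy(3) cone_dif_vec[OF xy(1,2)]
      by (rule cone_dif_vec) (use dxc in simp_all)
    also have "\<dots> = 0\<^sub>v (rdim (ob X (n+3)) i) @\<^sub>v 0\<^sub>v (rdim (ob Y (n+1+1)) i)"
      unfolding neg[OF dif_carrier[OF X]] neg[OF chain_map_carrier[OF f]] fd
        mult_add_distrib_mat_vec[OF dif_carrier[OF Y] dxc(2,3)] ddX ddY
      using fc by (auto intro!: eq_vecI)
    also have "\<dots> = 0\<^sub>v (rdim (ob ?C (n+2)) i)" unfolding append_vec_zero cone_dim by (simp add: add.assoc)
    finally show "(dif ?C (n+1) i * dif ?C n i) *\<^sub>v v = 0\<^sub>m (rdim (ob ?C (n+2)) i) (rdim (ob ?C n) i) *\<^sub>v v"
      using zero_mult_mat_vec[OF v] by simp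
  qed simp
  have bd: "\<exists>N. \<forall>n. \<bar>n\<bar> > N \<longrightarrow> \<not> nonzero_rep (ob ?C n)"
  proof -
    obtain N M where N: "\<And>n. \<bar>n\<bar> > N \<Longrightarrow> \<not> nonzero_rep (ob X n)" and M: "\<And>n. \<bar>n\<bar> > M \<Longrightarrow> \<not> nonzero_rep (ob Y n)"
      using X Y unfolding is_cpx_def by meson
    have "\<not> nonzero_rep (ob ?C n)" if "\<bar>n\<bar> > max N M + 1" for n
      using that N[of "n+1"] M[of n] unfolding nonzero_rep_def cone_dim by auto
    then show ?thesis by blast
  qed
  show ?thesis unfolding is_cpx_def rep_hom_def
    using cone_is_rep arrow dd bd cone_dif_carrier by simp
qed

lemma cone_incl_carrier: "cone_incl X Y n i \<in> carrier_mat (rdim (ob (cone X Y f) n) i) (rdim (ob Y n) i)"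
  unfolding cone_dim cone_incl_def Let_def by (rule four_block_carrier_mat[THEN carrier_matD(1), THEN carrier_matI]) auto

lemma cone_incl_vec:
  assumes y: "y \<in> cvec Y n i"
  shows "cone_incl X Y n i *\<^sub>v y = 0\<^sub>v (rdim (ob X (n+1)) i) @\<^sub>v y"
proof -
  have "y = y @\<^sub>v 0\<^sub>v 0" by (rule eq_vecI) auto
  then have "cone_incl X Y n i *\<^sub>v y = cone_incl X Y n i *\<^sub>v (y @\<^sub>v 0\<^sub>v 0)" by simp
  also have "\<dots> = (0\<^sub>m (rdim (ob X (n+1)) i) (rdim (ob Y n) i) *\<^sub>v y + 0\<^sub>m (rdim (ob X (n+1)) i) 0 *\<^sub>v 0\<^sub>v 0) @\<^sub>v
       (1\<^sub>m (rdim (ob Y n) i) *\<^sub>v y + 0\<^sub>m (rdim (ob Y n) i) 0 *\<^sub>v 0\<^sub>v 0)"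
    unfolding cone_incl_def Let_def by (rule four_block_mat_mult_vec) (use y in auto)
  also have "\<dots> = 0\<^sub>v (rdim (ob X (n+1)) i) @\<^sub>v y"
    using y by (intro arg_cong2[where f=append_vec] eq_vecI) auto
  finally show ?thesis .
qed

lemma chain_map_cone_incl: "chain_map Y (cone X Y f) (cone_incl X Y)"
proof -
  let ?C = "cone X Y f"
  have arrow: "cone_incl X Y n (tgt a) * rmap (ob Y n) a = rmap (ob ?C n) a * cone_incl X Y n (src a)" for n a
  proof (rule mat_eq_mult_vecI)
    have r: "rmap (ob ?C n) a \<in> carrier_mat (rdim (ob ?C n) (tgt a)) (rdim (ob ?C n) (src a))"
      "rmap (ob Y n) a \<in> carrier_mat (rdim (ob Y n) (tgt a)) (rdim (ob Y n) (src a))"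
      and rX: "rmap (ob X (n+1)) a \<in> carrier_mat (rdim (ob X (n+1)) (tgt a)) (rdim (ob X (n+1)) (src a))"
      using cone_is_rep is_cpx_rep[OF Y] is_cpx_rep[OF X] by (auto simp: is_rep_def)
    show "cone_incl X Y n (tgt a) * rmap (ob Y n) a \<in> carrier_mat (rdim (ob ?C n) (tgt a)) (rdim (ob Y n) (src a))"
      "rmap (ob ?C n) a * cone_incl X Y n (src a) \<in> carrier_mat (rdim (ob ?C n) (tgt a)) (rdim (ob Y n) (src a))"
      using mult_carrier_mat[OF cone_incl_carrier r(2)] mult_carrier_mat[OF r(1) cone_incl_carrier] .
    fix y assume y: "y \<in> cvec Y n (src a)"
    have ry: "rmap (ob Y n) a *\<^sub>v y \<in> cvec Y n (tgt a)" using rmap_carrier_vec[OF is_cpx_rep[OF Y] y] .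
    show "(cone_incl X Y n (tgt a) * rmap (ob Y n) a) *\<^sub>v y = (rmap (ob ?C n) a * cone_incl X Y n (src a)) *\<^sub>v y"
      unfolding assoc_mult_mat_vec[OF cone_incl_carrier r(2) y] assoc_mult_mat_vec[OF r(1) cone_incl_carrier y]
        cone_incl_vec[OF y] cone_incl_vec[OF ry] cone_rmap_vec[OF zero_carrier_vec y] mult_mat_vec_0[OF rX] ..
  qed
  have dif: "dif ?C n i * cone_incl X Y n i = cone_incl X Y (n+1) i * dif Y n i" for n i
  proof (rule mat_eq_mult_vecI)
    show "dif ?C n i * cone_incl X Y n i \<in> carrier_mat (rdim (ob ?C (n+1)) i) (rdim (ob Y n) i)"
      "cone_incl X Y (n+1) i * dif Y n i \<in> carrier_mat (rdim (ob ?C (n+1)) i) (rdim (ob Y n) i)"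
      using mult_carrier_mat[OF cone_dif_carrier cone_incl_carrier] mult_carrier_mat[OF cone_incl_carrier dif_carrier[OF Y]] .
    fix y assume y: "y \<in> cvec Y n i"
    have ry: "dif Y n i *\<^sub>v y \<in> cvec Y (n+1) i" using mult_mat_vec_carrier[OF dif_carrier[OF Y] y] .
    have z: "- 0\<^sub>v m = (0\<^sub>v m :: 'k vec)" for m by (rule eq_vecI) auto
    show "(dif ?C n i * cone_incl X Y n i) *\<^sub>v y = (cone_incl X Y (n+1) i * dif Y n i) *\<^sub>v y"
      unfolding assoc_mult_mat_vec[OF cone_incl_carrier dif_carrier[OF Y] y] assoc_mult_mat_vec[OF cone_dif_carrier cone_incl_carrier y]
        cone_incl_vec[OF y] cone_incl_vec[OF ry] cone_dif_vec[OF zero_carrier_vec y] mult_mat_vec_0[OF dif_carrier[OF X]]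
        mult_mat_vec_0[OF chain_map_carrier[OF f]] z
      using ry by simp
  qed
  show ?thesis unfolding chain_map_def rep_hom_def using arrow dif cone_incl_carrier by simp
qed

lemma cone_cycles:
  assumes x: "x \<in> cvec X (n+1) i" and y: "y \<in> cvec Y n i"
  shows "x @\<^sub>v y \<in> cycles (cone X Y f) n i \<longleftrightarrow>
    dif X (n+1) i *\<^sub>v x = 0\<^sub>v (rdim (ob X (n+1+1)) i) \<and>
    f (n+1) i *\<^sub>v x + dif Y n i *\<^sub>v y = 0\<^sub>v (rdim (ob Y (n+1)) i)"
proof -
  have dx: "dif X (n+1) i *\<^sub>v x \<in> cvec X (n+1+1) i" using mult_mat_vec_carrier[OF dif_carrier[OF X] x] .
  have "x @\<^sub>v y \<in> cycles (cone X Y f) n i \<longleftrightarrow>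
    (- (dif X (n+1) i *\<^sub>v x)) @\<^sub>v (f (n+1) i *\<^sub>v x + dif Y n i *\<^sub>v y) =
      0\<^sub>v (rdim (ob X (n+1+1)) i) @\<^sub>v 0\<^sub>v (rdim (ob Y (n+1)) i)"
    unfolding cycles_def using x y by (simp add: cone_dif_vec[OF x y] cone_dim append_vec_zero)
  also have "\<dots> \<longleftrightarrow> - (dif X (n+1) i *\<^sub>v x) = 0\<^sub>v (rdim (ob X (n+1+1)) i) \<and>
    f (n+1) i *\<^sub>v x + dif Y n i *\<^sub>v y = 0\<^sub>v (rdim (ob Y (n+1)) i)"
    by (rule append_vec_eq) (use dx in auto)
  also have "- (dif X (n+1) i *\<^sub>v x) = 0\<^sub>v (rdim (ob X (n+1+1)) i) \<longleftrightarrow> dif X (n+1) i *\<^sub>v x = 0\<^sub>v (rdim (ob X (n+1+1)) i)"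
  proof -
    have z: "- 0\<^sub>v m = (0\<^sub>v m :: 'k vec)" for m by (rule eq_vecI) auto
    show ?thesis by (metis uminus_uminus_vec z)
  qed
  finally show ?thesis .
qed

lemma cone_boundaryE:
  assumes "c \<in> boundaries (cone X Y f) (n+1) i"
  obtains x y where "x \<in> cvec X (n+1) i" "y \<in> cvec Y n i"
    "c = (- (dif X (n+1) i *\<^sub>v x)) @\<^sub>v (f (n+1) i *\<^sub>v x + dif Y n i *\<^sub>v y)"
proof -
  obtain v where v: "v \<in> cvec (cone X Y f) n i" "c = dif (cone X Y f) n i *\<^sub>v v"
    using assms by (rule boundariesE)
  from v(1) obtain x y where xy: "x \<in> cvec X (n+1) i" "y \<in> cvec Y n i" "v = x @\<^sub>v y"
    unfolding cone_dim by (rule append_vec_cases)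
  show ?thesis using that[OF xy(1,2)] v(2) unfolding xy(3) cone_dif_vec[OF xy(1,2)] by blast
qed

end

text \<open>Exactness of the long exact sequence of a cone, in the form in which a neighbouring cohomology group
vanishes. The proof is the usual chase: a class that dies under \<open>f\<close> lifts to a cycle
\<open>(x, -w)\<close> of the cone, a cycle \<open>(x, y)\<close> of the cone with \<open>x = d x0\<close> is homologous to
\<open>(0, y + f x0)\<close>, and a bounding chain of \<open>(0, y)\<close> has a cycle as its first component.\<close>

lemma cone_exact:
  fixes X Y :: "'k::field cpx" and f :: "'k cmap"
  assumes X: "is_cpx X" and Y: "is_cpx Y" and f: "chain_map X Y f"
  shows "coh_zero (cone X Y f) (n-1) \<Longrightarrow> coh_inj X Y n (hmap X Y f n)"
    "coh_zero X (n+1) \<Longrightarrow> coh_sur (cone X Y f) n (hmap Y (cone X Y f) (cone_incl X Y) n)"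
    "coh_zero X n \<Longrightarrow> coh_inj Y (cone X Y f) n (hmap Y (cone X Y f) (cone_incl X Y) n)"
proof -
  let ?C = "cone X Y f"
  note C = is_cpx_cone[OF X Y f]
  note I = chain_map_cone_incl[OF X Y f]
  show "coh_inj X Y n (hmap X Y f n)" if z: "coh_zero ?C (n-1)"
    unfolding coh_inj_def
  proof (intro allI impI)
    fix i x y assume xy: "(x, y) \<in> hmap X Y f n i" "y \<in> boundaries Y n i"
    then have xc: "x \<in> cycles X n i" "f n i *\<^sub>v x \<in> boundaries Y n i"
      using hid_boundaries[OF Y] by (auto simp: hmap_eq[OF X Y f])
    then have "f n i *\<^sub>v x \<in> boundaries Y ((n-1)+1) i" by simp
    then obtain w where w: "w \<in> cvec Y (n-1) i" "f n i *\<^sub>v x = dif Y (n-1) i *\<^sub>v w" by (rule boundariesE)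
    have x': "x \<in> cvec X ((n-1)+1) i" "dif X n i *\<^sub>v x = 0\<^sub>v (rdim (ob X (n+1)) i)"
      using xc by (auto simp: cycles_def)
    have dw: "dif Y (n-1) i *\<^sub>v w \<in> cvec Y n i" using mult_mat_vec_carrier[OF dif_carrier_pred[OF Y] w(1)] .
    have mw: "- w \<in> cvec Y (n-1) i" using w by simp
    have "dif Y (n-1) i *\<^sub>v w + dif Y (n-1) i *\<^sub>v (- w) = 0\<^sub>v (rdim (ob Y n) i)"
      unfolding mult_mat_uminus_vec[OF dif_carrier_pred[OF Y] w(1)] using dw by (intro eq_vecI) auto
    then have "x @\<^sub>v (- w) \<in> cycles ?C (n-1) i"
      using cone_cycles[OF X Y f x'(1) mw] x' w(2) by simp
    then have "x @\<^sub>v (- w) \<in> boundaries ?C ((n-2)+1) i" using z by (auto simp: coh_zero_def)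
    then obtain x1 y1 where 1: "x1 \<in> cvec X (n-2+1) i" "y1 \<in> cvec Y (n-2) i"
      "x @\<^sub>v (- w) = (- (dif X (n-2+1) i *\<^sub>v x1)) @\<^sub>v (f (n-2+1) i *\<^sub>v x1 + dif Y (n-2) i *\<^sub>v y1)"
      by (rule cone_boundaryE[OF X Y f])
    \<comment> \<open>The bounding chain lives in degree \<open>n - 2\<close> of the cone, so its first component has degree \<open>n - 1\<close>.\<close>
    have n2: "n - 2 + 1 = n - 1" by simp
    have x1: "x1 \<in> cvec X (n-1) i" using 1(1) unfolding n2 .
    have dx1: "dif X (n-1) i *\<^sub>v x1 \<in> cvec X n i" using mult_mat_vec_carrier[OF dif_carrier_pred[OF X] x1] .
    have "x = - (dif X (n-1) i *\<^sub>v x1)"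
      using 1(3) append_vec_eq[of x "rdim (ob X n) i" "- (dif X (n-1) i *\<^sub>v x1)"] x'(1) dx1 unfolding n2 by simp
    then show "x \<in> boundaries X n i"
      using lin_subspace_uminus[OF boundaries_subspace[OF X]] x1 by (simp add: boundaries_def)
  qed
  show "coh_sur ?C n (hmap Y ?C (cone_incl X Y) n)" if z: "coh_zero X (n+1)"
    unfolding coh_sur_def
  proof (intro allI ballI)
    fix i c assume c: "c \<in> cycles ?C n i"
    obtain x y where xy: "x \<in> cvec X (n+1) i" "y \<in> cvec Y n i" "c = x @\<^sub>v y"
      using cycles_carrier[OF c] unfolding cone_dim[OF X Y f] by (rule append_vec_cases)
    have *: "dif X (n+1) i *\<^sub>v x = 0\<^sub>v (rdim (ob X (n+1+1)) i)"
      "f (n+1) i *\<^sub>v x + dif Y n i *\<^sub>v y = 0\<^sub>v (rdim (ob Y (n+1)) i)"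
      using c cone_cycles[OF X Y f xy(1,2)] unfolding xy(3) by auto
    then have "x \<in> boundaries X (n+1) i" using z xy(1) by (auto simp: coh_zero_def cycles_def)
    then obtain x0 where x0: "x0 \<in> cvec X n i" "x = dif X n i *\<^sub>v x0" by (rule boundariesE)
    let ?y = "y + f n i *\<^sub>v x0"
    have fx0: "f n i *\<^sub>v x0 \<in> cvec Y n i" using mult_mat_vec_carrier[OF chain_map_carrier[OF f] x0(1)] .
    have yc: "?y \<in> cvec Y n i" using xy(2) fx0 by simp
    have fx: "f (n+1) i *\<^sub>v x \<in> cvec Y (n+1) i" "dif Y n i *\<^sub>v y \<in> cvec Y (n+1) i"
      using mult_mat_vec_carrier[OF chain_map_carrier[OF f] xy(1)] mult_mat_vec_carrier[OF dif_carrier[OF Y] xy(2)] .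
    have "dif Y n i *\<^sub>v ?y = dif Y n i *\<^sub>v y + f (n+1) i *\<^sub>v x"
      unfolding mult_add_distrib_mat_vec[OF dif_carrier[OF Y] xy(2) fx0] chain_map_dif[OF X Y f x0(1)] x0(2) ..
    also have "\<dots> = 0\<^sub>v (rdim (ob Y (n+1)) i)" using *(2) comm_add_vec[OF fx] by simp
    finally have cyc: "?y \<in> cycles Y n i" using yc by (simp add: cycles_def)
    have n1: "x0 \<in> cvec X (n-1+1) i" using x0 by simp
    have d: "dif ?C (n-1) i *\<^sub>v (x0 @\<^sub>v 0\<^sub>v (rdim (ob Y (n-1)) i)) = (- x) @\<^sub>v (f n i *\<^sub>v x0)"
      using cone_dif_vec[OF X Y f n1 zero_carrier_vec] x0(2) mult_mat_vec_0[OF dif_carrier_pred[OF Y]] fx0 by simp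
    have "x0 @\<^sub>v 0\<^sub>v (rdim (ob Y (n-1)) i) \<in> cvec ?C (n-1) i" unfolding cone_dim[OF X Y f] using n1 by simp
    from dif_boundary[OF this] have "(- x) @\<^sub>v (f n i *\<^sub>v x0) \<in> boundaries ?C n i" unfolding d by simp
    moreover have "cone_incl X Y n i *\<^sub>v ?y - c = (- x) @\<^sub>v (f n i *\<^sub>v x0)"
    proof -
      have "(y + w) - y = w" if "w \<in> cvec Y n i" for w
        using that xy(2) by (intro eq_vecI) auto
      from this[OF fx0] have "0\<^sub>v (rdim (ob X (n+1)) i) - x = - x" "?y - y = f n i *\<^sub>v x0"
        using xy(1) by (auto intro!: eq_vecI)
      then show ?thesis
        unfolding cone_incl_vec[OF X Y f yc] xy(3) append_vec_diff[OF zero_carrier_vec xy(1) yc xy(2)] by simp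
    qed
    ultimately show "\<exists>y. (y, c) \<in> hmap Y ?C (cone_incl X Y) n i"
      using cyc c by (intro exI[of _ ?y]) (simp add: hmap_def)
  qed
  show "coh_inj Y ?C n (hmap Y ?C (cone_incl X Y) n)" if z: "coh_zero X n"
    unfolding coh_inj_def
  proof (intro allI impI)
    fix i y c assume h: "(y, c) \<in> hmap Y ?C (cone_incl X Y) n i" "c \<in> boundaries ?C n i"
    then have yc: "y \<in> cycles Y n i" "cone_incl X Y n i *\<^sub>v y \<in> boundaries ?C n i"
      using hid_boundaries[OF C] by (auto simp: hmap_eq[OF Y C I])
    have y: "y \<in> cvec Y n i" using cycles_carrier[OF yc(1)] .
    have "0\<^sub>v (rdim (ob X (n+1)) i) @\<^sub>v y \<in> boundaries ?C (n-1+1) i"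
      using yc(2) cone_incl_vec[OF X Y f y] by simp
    then obtain x1 y1 where 1: "x1 \<in> cvec X (n-1+1) i" "y1 \<in> cvec Y (n-1) i"
      "0\<^sub>v (rdim (ob X (n+1)) i) @\<^sub>v y = (- (dif X (n-1+1) i *\<^sub>v x1)) @\<^sub>v (f (n-1+1) i *\<^sub>v x1 + dif Y (n-1) i *\<^sub>v y1)"
      by (rule cone_boundaryE[OF X Y f])
    have x1: "x1 \<in> cvec X n i" using 1(1) by simp
    have dx1: "- (dif X n i *\<^sub>v x1) \<in> cvec X (n+1) i"
      using mult_mat_vec_carrier[OF dif_carrier[OF X] x1] by simp
    have e: "0\<^sub>v (rdim (ob X (n+1)) i) = - (dif X n i *\<^sub>v x1)" "y = f n i *\<^sub>v x1 + dif Y (n-1) i *\<^sub>v y1"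
      using 1(3) append_vec_eq[OF zero_carrier_vec dx1] by simp_all
    have "- 0\<^sub>v m = (0\<^sub>v m :: 'k vec)" for m by (rule eq_vecI) auto
    then have "dif X n i *\<^sub>v x1 = 0\<^sub>v (rdim (ob X (n+1)) i)" using e(1) by (metis uminus_uminus_vec)
    then have "x1 \<in> boundaries X n i" using z x1 by (auto simp: coh_zero_def cycles_def)
    then have "f n i *\<^sub>v x1 \<in> boundaries Y n i" by (rule chain_map_boundaries[OF X Y f])
    moreover have "dif Y (n-1) i *\<^sub>v y1 \<in> boundaries Y n i" using 1(2) by (simp add: boundaries_def)
    ultimately show "y \<in> boundaries Y n i" unfolding e(2) using lin_subspaceD(3)[OF boundaries_subspace[OF Y]] by blast
  qed
qed

text \<open>The form of the two commuting squares in the definition of a distinguished triangle.\<close>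

lemma square_hrel:
  assumes Y: "is_cpx Y" and A: "is_cpx A" and Z: "is_cpx Z" and B: "is_cpx B"
    and u: "u \<in> Db_hom Y Z" and b: "b \<in> Db_hom Y A" and c: "c \<in> Db_hom Z B" and g: "chain_map A B g"
    and e: "Db_comp Y Z B c u = Db_comp Y A B (Db_of A B g) b"
  shows "hrel Y Z u n i O hrel Z B c n i = hrel Y A b n i O hmap A B g n i"
proof -
  obtain r where r: "r \<in> Db_comp Y A B (Db_of A B g) b" using Db_comp_Db_of_nonempty[OF Y A B b g] .
  show ?thesis
    using hroof_Db_comp[OF Y A B b Db_of_hom(1)[OF A B g] r] hroof_Db_comp[OF Y Z B u c, of r] r e
      hrel_Db_of[OF A B g] by simp
qed

text \<open>The part of the long exact sequence of a triangle that the Harder-Narasimhan argument uses.\<close>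

definition coh_exact :: "'k::field cpx \<Rightarrow> 'k cpx \<Rightarrow> 'k cpx \<Rightarrow>
    (int \<Rightarrow> vertex \<Rightarrow> ('k vec \<times> 'k vec) set) \<Rightarrow> (int \<Rightarrow> vertex \<Rightarrow> ('k vec \<times> 'k vec) set) \<Rightarrow> bool" where
  "coh_exact X Y Z U V \<longleftrightarrow> (\<forall>n. coh_map X Y n (U n) \<and> coh_map Y Z n (V n) \<and>
    (coh_zero Z (n-1) \<longrightarrow> coh_inj X Y n (U n)) \<and>
    (coh_zero X (n+1) \<longrightarrow> coh_sur Z n (V n)) \<and>
    (coh_zero X n \<longrightarrow> coh_inj Y Z n (V n)))"

text \<open>Transport of the exactness for the cone along the isomorphism of triangles.\<close>

lemma triangle_exact:
  fixes X Y Z :: "'k::field cpx"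
  assumes "triangle X Y Z"
  shows "\<exists>U V. coh_exact X Y Z U V"
proof -
  obtain u v w X' Y' f a b c where
    ob: "is_cpx X" "is_cpx Y" "is_cpx Z" "is_cpx X'" "is_cpx Y'"
    and uv: "u \<in> Db_hom X Y" "v \<in> Db_hom Y Z" and f: "chain_map X' Y' f"
    and iso: "Db_iso X X' a" "Db_iso Y Y' b" "Db_iso Z (cone X' Y' f) c"
    and sq: "Db_comp X Y Y' b u = Db_comp X X' Y' (Db_of X' Y' f) a"
      "Db_comp Y Z (cone X' Y' f) c v = Db_comp Y Y' (cone X' Y' f) (Db_of Y' (cone X' Y' f) (cone_incl X' Y')) b"
    using assms unfolding triangle_def dist_triangle_def Db_obj_def Let_def by blast
  let ?C = "cone X' Y' f"
  note C = is_cpx_cone[OF ob(4,5) f]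
  note I = chain_map_cone_incl[OF ob(4,5) f]
  have abc: "a \<in> Db_hom X X'" "b \<in> Db_hom Y Y'" "c \<in> Db_hom Z ?C" using iso by (auto simp: Db_iso_def)
  define U where "U = hrel X Y u"
  define V where "V = hrel Y Z v"
  define A where "A = hrel X X' a"
  define B where "B = hrel Y Y' b"
  define D where "D = hrel Z ?C c"
  have U: "coh_map X Y n (U n)" and V: "coh_map Y Z n (V n)" for n
    unfolding U_def V_def using coh_map_hrel uv ob by blast+
  note A = Db_iso_coh[OF ob(1,4) iso(1), folded A_def]
  note B = Db_iso_coh[OF ob(2,5) iso(2), folded B_def]
  note D = Db_iso_coh[OF ob(3) C iso(3), folded D_def]
  have s1: "U n i O B n i = A n i O hmap X' Y' f n i" for n i
    unfolding U_def A_def B_def by (rule square_hrel[OF ob(1,4,2,5) uv(1) abc(1,2) f sq(1)])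
  have s2: "V n i O D n i = B n i O hmap Y' ?C (cone_incl X' Y') n i" for n i
    unfolding V_def B_def D_def by (rule square_hrel[OF ob(2,5,3) C uv(2) abc(2,3) I sq(2)])
  have 1: "coh_inj X Y n (U n)" if z: "coh_zero Z (n-1)" for n
    unfolding coh_inj_def
  proof (intro allI impI)
    fix i x y assume xy: "(x, y) \<in> U n i" "y \<in> boundaries Y n i"
    have inj: "coh_inj X' Y' n (hmap X' Y' f n)"
      using cone_exact(1)[OF ob(4,5) f] coh_zero_image[OF D(1,3) z] by blast
    obtain y' where y': "(y, y') \<in> B n i" using coh_mapD(4)[OF B(1)] coh_map_cycles(2)[OF U xy(1)] by blast
    then have "y' \<in> boundaries Y' n i" using coh_mapD(5)[OF B(1)] xy by blast
    moreover obtain x' where "(x, x') \<in> A n i" "(x', y') \<in> hmap X' Y' f n i" using s1 xy(1) y' by blast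
    ultimately show "x \<in> boundaries X n i" using inj A(2) unfolding coh_inj_def by blast
  qed
  have 2: "coh_sur Z n (V n)" if z: "coh_zero X (n+1)" for n
    unfolding coh_sur_def
  proof (intro allI ballI)
    fix i z assume "z \<in> cycles Z n i"
    then obtain c' where c': "(z, c') \<in> D n i" using coh_mapD(4)[OF D(1)] by blast
    have "coh_sur ?C n (hmap Y' ?C (cone_incl X' Y') n)"
      using cone_exact(2)[OF ob(4,5) f] coh_zero_image[OF A(1,3) z] by blast
    then obtain y' where y': "(y', c') \<in> hmap Y' ?C (cone_incl X' Y') n i"
      using coh_map_cycles(2)[OF D(1) c'] unfolding coh_sur_def by blast
    obtain y where y: "(y, y') \<in> B n i"
      using B(3) coh_map_cycles(1)[OF coh_map_hmap[OF ob(5) C I] y'] unfolding coh_sur_def by blast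
    obtain z' where z': "(y, z') \<in> V n i" "(z', c') \<in> D n i" using s2 y y' by blast
    have "(z', z) \<in> hid Z n i"
      using coh_inj_eq[OF ob(3) C D(1,2) z'(2) c'] hid_refl[OF C coh_map_cycles(2)[OF D(1) c']] by blast
    then show "\<exists>y. (y, z) \<in> V n i" using z'(1) coh_mapD(3)[OF V] by blast
  qed
  have 3: "coh_inj Y Z n (V n)" if z: "coh_zero X n" for n
    unfolding coh_inj_def
  proof (intro allI impI)
    fix i y z' assume yz: "(y, z') \<in> V n i" "z' \<in> boundaries Z n i"
    have inj: "coh_inj Y' ?C n (hmap Y' ?C (cone_incl X' Y') n)"
      using cone_exact(3)[OF ob(4,5) f] coh_zero_image[OF A(1,3) z] by blast
    obtain c' where c': "(z', c') \<in> D n i" using coh_mapD(4)[OF D(1)] coh_map_cycles(2)[OF V yz(1)] by blast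
    then have "c' \<in> boundaries ?C n i" using coh_mapD(5)[OF D(1)] yz by blast
    moreover obtain y' where "(y, y') \<in> B n i" "(y', c') \<in> hmap Y' ?C (cone_incl X' Y') n i" using s2 yz(1) c' by blast
    ultimately show "y \<in> boundaries Y n i" using inj B(2) unfolding coh_inj_def by blast
  qed
  show ?thesis unfolding coh_exact_def using U V 1 2 3 by blast
qed

section \<open>Grothendieck groups, stalk complexes and shifts\<close>

text \<open>The relation \<open>frag_of B - frag_of A - frag_of C\<close> lies in the subgroup divided out, so the cosets of
\<open>B\<close> and of \<open>A + C\<close> coincide.\<close>

lemma K_class_additive:
  assumes W: "W \<in> hom (K_group Ob T) complex_add_group"
    and ob: "A \<in> Ob" "B \<in> Ob" "C \<in> Ob" and T: "T A B C"
  shows "W (K_class Ob T B) = W (K_class Ob T A) + W (K_class Ob T C)"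
proof -
  let ?G = "free_Abelian_group Ob"
  let ?H = "K_rel Ob T"
  interpret G: comm_group ?G by (rule abelian_free_Abelian_group)
  let ?S = "{frag_of B - frag_of A - frag_of C | A B C. A \<in> Ob \<and> B \<in> Ob \<and> C \<in> Ob \<and> T A B C}"
  have fr: "frag_of X \<in> carrier ?G" if "X \<in> Ob" for X using that by simp
  have S: "?S \<subseteq> carrier ?G"
  proof
    fix s assume "s \<in> ?S"
    then obtain A B C where s: "s = frag_of B - frag_of A - frag_of C" "A \<in> Ob" "B \<in> Ob" "C \<in> Ob" by blast
    have "Poly_Mapping.keys s \<subseteq> Poly_Mapping.keys (frag_of B - frag_of A) \<union> Poly_Mapping.keys (frag_of C :: 'a \<Rightarrow>\<^sub>0 int)"
      unfolding s(1) by (rule keys_diff)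
    also have "\<dots> \<subseteq> Ob" using keys_diff[of "frag_of B" "frag_of A :: 'a \<Rightarrow>\<^sub>0 int"] s by auto
    finally show "s \<in> carrier ?G" by simp
  qed
  have H: "subgroup ?H ?G" unfolding K_rel_def by (rule G.generate_is_subgroup[OF S])
  then have N: "?H \<lhd> ?G" by (simp add: G.normal_iff_subgroup)
  interpret N: normal ?H ?G by (rule N)
  let ?r = "frag_of B - frag_of A - frag_of C :: 'a \<Rightarrow>\<^sub>0 int"
  have "?r \<in> ?S" unfolding mem_Collect_eq using ob T by (intro exI[of _ A] exI[of _ B] exI[of _ C] conjI refl)
  then have r: "?r \<in> ?H" unfolding K_rel_def by (rule generate.incl)
  have rC: "?r \<in> carrier ?G" using S \<open>?r \<in> ?S\<close> by blast
  have AC: "frag_of A \<otimes>\<^bsub>?G\<^esub> frag_of C \<in> carrier ?G" using fr ob by blast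
  have B: "frag_of B = ?r \<otimes>\<^bsub>?G\<^esub> (frag_of A \<otimes>\<^bsub>?G\<^esub> frag_of C)" by simp
  have "K_class Ob T B = (?H #>\<^bsub>?G\<^esub> ?r) #>\<^bsub>?G\<^esub> (frag_of A \<otimes>\<^bsub>?G\<^esub> frag_of C)"
    unfolding G.coset_mult_assoc[OF N.subset rC AC] by (simp only: K_class_def B[symmetric])
  also have "?H #>\<^bsub>?G\<^esub> ?r = ?H" by (rule G.coset_join2[OF rC H r])
  also have "?H #>\<^bsub>?G\<^esub> (frag_of A \<otimes>\<^bsub>?G\<^esub> frag_of C) = K_class Ob T A <#>\<^bsub>?G\<^esub> K_class Ob T C"
    unfolding K_class_def using N.rcos_sum[OF fr fr] ob by simp
  finally have e: "K_class Ob T B = K_class Ob T A \<otimes>\<^bsub>K_group Ob T\<^esub> K_class Ob T C"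
    by (simp add: K_group_def FactGroup_def)
  have "K_class Ob T X \<in> carrier (K_group Ob T)" if "X \<in> Ob" for X
    unfolding K_group_def K_class_def FactGroup_def using G.rcosetsI[OF N.subset fr[OF that]] by simp
  then show ?thesis using hom_mult[OF W] ob unfolding e by (simp add: complex_add_group_def)
qed

lemma zero_matI: "A \<in> carrier_mat 0 m \<Longrightarrow> B \<in> carrier_mat 0 m \<Longrightarrow> A = B"
  by (intro eq_matI) auto

lemma shift_zero: "shift zero_cpx = (zero_cpx :: 'k::field cpx)"
proof -
  have "- (0\<^sub>m 0 0 :: 'k mat) = 0\<^sub>m 0 0" by (intro eq_matI) auto
  then show ?thesis by (simp add: shift_def zero_cpx_def)
qed

lemma cone_zero: "cone zero_cpx zero_cpx (cm_zero zero_cpx zero_cpx) = (zero_cpx :: 'k::field cpx)"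
proof -
  have "block_diag (0\<^sub>m 0 0) (0\<^sub>m 0 0 :: 'k mat) = 0\<^sub>m 0 0" by (intro zero_matI[of _ 0]) (auto simp: block_diag_def)
  then have r: "rep_sum zero_rep zero_rep = (zero_rep :: 'k rep)" by (simp add: rep_sum_def zero_rep_def)
  have "four_block_mat (- 0\<^sub>m 0 0) (0\<^sub>m 0 0) (0\<^sub>m 0 0) (0\<^sub>m 0 0) = (0\<^sub>m 0 0 :: 'k mat)" by (intro zero_matI[of _ 0]) auto
  then have d: "(\<lambda>(n::int) (i::vertex). four_block_mat (- 0\<^sub>m 0 0) (0\<^sub>m 0 0) (0\<^sub>m 0 0) (0\<^sub>m 0 0)) = (\<lambda>_ _. 0\<^sub>m 0 0 :: 'k mat)"
    by (intro ext)
  have "rdim (zero_rep :: 'k rep) i = 0" for i by (simp add: zero_rep_def)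
  then show ?thesis using r d by (simp add: cone_def zero_cpx_def cm_zero_def)
qed

text \<open>This triangle gives every acyclic complex the class zero, so that zero objects may occur among the
pieces of a filtration without affecting charges.\<close>

lemma triangle_acyclic:
  fixes A :: "'k::field cpx"
  assumes A: "is_cpx A" and a: "acyclic_cpx A"
  shows "triangle zero_cpx zero_cpx A"
proof -
  let ?O = "zero_cpx :: 'k cpx"
  let ?z = "cm_zero ?O ?O"
  note O = is_cpx_zero[where 'k='k]
  note aO = acyclic_zero[where 'k='k]
  note z = chain_map_zero[OF O O]
  have ne: "roofs ?O ?O \<noteq> {}" "roofs ?O A \<noteq> {}" "roofs A ?O \<noteq> {}" using roofs_nonempty O A by blast+
  have inc: "chain_map ?O ?O (cone_incl ?O ?O)" using chain_map_cone_incl[OF O O z] unfolding cone_zero .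
  have r0: "rdim (ob ?O n) i = 0" for n i by (simp add: zero_cpx_def zero_rep_def)
  have "cone_proj ?O ?O n i = cm_zero ?O ?O n i" for n i
    unfolding cone_proj_def cm_zero_def r0 Let_def
    by (intro eq_matI) auto
  then have "cone_proj ?O ?O = cm_zero ?O ?O" by (intro ext)
  then have pr: "chain_map ?O ?O (cone_proj ?O ?O)" using z by simp
  have "cm_shift (cm_id ?O) = cm_id ?O" "cm_shift ?z = ?z" by (simp_all add: cm_shift_def cm_id_def cm_zero_def r0)
  then have "(?O, cm_id ?O, ?z) \<in> Db_shift (roofs ?O ?O)"
    using id_roof[OF O z] unfolding Db_shift_def by (auto simp: shift_zero intro!: rev_image_eqI)
  then have sh: "Db_shift (roofs ?O ?O) \<inter> roofs ?O ?O \<noteq> {}" using id_roof[OF O z] by blast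
  have comp: "Db_comp X Y Z \<psi> \<phi> = roofs X Z" if "X \<in> {?O, A}" "Y \<in> {?O, A}" "Z \<in> {?O, A}"
     "\<phi> \<inter> roofs X Y \<noteq> {}" "\<psi> \<inter> roofs Y Z \<noteq> {}" for X Y Z \<phi> \<psi>
    using Db_comp_acyclic[of X Y Z \<phi> \<psi>] that O A a aO by auto
  have "Db_of ?O ?O ?z = roofs ?O ?O" "Db_of ?O ?O (cone_incl ?O ?O) = roofs ?O ?O" "Db_of ?O ?O (cone_proj ?O ?O) = roofs ?O ?O"
    using Db_of_acyclic[OF O O aO] z inc pr by blast+
  moreover have "Db_iso ?O ?O (roofs ?O ?O)" "Db_iso A ?O (roofs A ?O)"
    using Db_iso_acyclic O A a aO by blast+
  moreover have "Db_hom ?O ?O = {roofs ?O ?O}" "Db_hom ?O A = {roofs ?O A}" "Db_hom A ?O = {roofs A ?O}"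
    using Db_hom_acyclic O A a aO by blast+
  ultimately have "dist_triangle ?O ?O A (roofs ?O ?O) (roofs ?O A) (roofs A ?O)"
    unfolding dist_triangle_def Db_obj_def Let_def
    using O A z ne sh comp
    by (intro conjI exI[of _ ?O] exI[of _ ?z] exI[of _ "roofs ?O ?O"] exI[of _ "roofs A ?O"])
      (simp_all add: cone_zero shift_zero)
  then show ?thesis unfolding triangle_def by blast
qed

lemma is_cpx_stalk:
  assumes V: "is_rep V" shows "is_cpx (stalk V)"
proof -
  define A where "A = (\<lambda>n::int. if n = 0 then V else zero_rep)"
  have A: "is_rep (A n)" for n using V is_rep_zero by (auto simp: A_def)
  have s: "stalk V = \<lparr>ob = A, dif = (\<lambda>n i. 0\<^sub>m (rdim (A (n + 1)) i) (rdim (A n) i))\<rparr>"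
    by (simp add: stalk_def Let_def A_def)
  have "\<exists>N. \<forall>n. \<bar>n\<bar> > N \<longrightarrow> \<not> nonzero_rep (A n)"
    by (rule exI[of _ 0]) (auto simp: A_def nonzero_zero_rep)
  then show ?thesis unfolding s is_cpx_def using A rep_hom_zero[OF A A] by (simp add: add.assoc)
qed

lemma stalk_ob: "ob (stalk V) n = (if n = 0 then V else zero_rep)"
  by (simp add: stalk_def Let_def)

lemma stalk_cycles:
  fixes V :: "'k::field rep"
  assumes V: "is_rep V"
  shows "cycles (stalk V) 0 i = carrier_vec (rdim V i)" "boundaries (stalk V) 0 i = {0\<^sub>v (rdim V i)}"
    "n \<noteq> 0 \<Longrightarrow> coh_zero (stalk V) n"
proof -
  have d: "dif (stalk V) n i *\<^sub>v x = 0\<^sub>v (rdim (ob (stalk V) (n+1)) i)" if "x \<in> cvec (stalk V) n i" for n i x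
    using zero_mult_mat_vec[OF that] by (simp add: stalk_def Let_def)
  show "cycles (stalk V) 0 i = carrier_vec (rdim V i)" using d[of _ 0 i] by (auto simp: cycles_def stalk_ob)
  have d1: "dif (stalk V) (-1) i *\<^sub>v x = 0\<^sub>v (rdim V i)" if "x \<in> cvec (stalk V) (-1) i" for x
    using d[OF that] by (simp add: stalk_ob)
  have "0\<^sub>v (rdim V i) \<in> boundaries (stalk V) 0 i"
    using lin_subspaceD(2)[OF boundaries_subspace[OF is_cpx_stalk[OF V]], of 0 i] by (simp add: stalk_ob)
  then show "boundaries (stalk V) 0 i = {0\<^sub>v (rdim V i)}" using d1 by (auto simp: boundaries_def)
  show "coh_zero (stalk V) n" if "n \<noteq> 0"
    unfolding coh_zero_def
  proof (intro allI subsetI)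
    fix i x assume "x \<in> cycles (stalk V) n i"
    then have "x \<in> carrier_vec 0" using that by (auto dest!: cycles_carrier simp: stalk_ob zero_rep_def)
    then have "x = 0\<^sub>v (rdim (ob (stalk V) n) i)" using that by (auto simp: stalk_ob zero_rep_def)
    then show "x \<in> boundaries (stalk V) n i"
      using lin_subspaceD(2)[OF boundaries_subspace[OF is_cpx_stalk[OF V]]] by simp
  qed
qed

lemma acyclic_stalk:
  fixes V :: "'k::field rep"
  assumes V: "is_rep V" shows "acyclic_cpx (stalk V) \<longleftrightarrow> \<not> nonzero_rep V"
proof -
  have "acyclic_cpx (stalk V) \<longleftrightarrow> coh_zero (stalk V) 0"
    using stalk_cycles(3)[OF V] unfolding acyclic_cpx_def by metis
  also have "\<dots> \<longleftrightarrow> (\<forall>i. carrier_vec (rdim V i) \<subseteq> {0\<^sub>v (rdim V i) :: 'k vec})"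
    unfolding coh_zero_def stalk_cycles(1,2)[OF V] ..
  also have "\<dots> \<longleftrightarrow> (\<forall>i. rdim V i = 0)"
  proof -
    have "n = 0" if "carrier_vec n \<subseteq> {0\<^sub>v n :: 'k vec}" for n
    proof (rule ccontr)
      assume "n \<noteq> 0"
      then have "0 < n" by simp
      have "unit_vec n 0 \<in> {0\<^sub>v n :: 'k vec}" using that unit_vec_carrier by (rule subsetD)
      then have "unit_vec n 0 = (0\<^sub>v n :: 'k vec)" by (rule singletonD)
      then have "(unit_vec n 0 :: 'k vec) $ 0 = 0" using \<open>0 < n\<close> by (simp del: index_unit_vec)
      then show False using \<open>0 < n\<close> by simp
    qed
    moreover have "carrier_vec 0 \<subseteq> {0\<^sub>v 0 :: 'k vec}" by (auto intro!: eq_vecI)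
    ultimately show ?thesis by metis
  qed
  finally show ?thesis by (simp add: nonzero_rep_def)
qed

lemma shift_coh_zero:
  fixes X :: "'k::field cpx"
  assumes X: "is_cpx X"
  shows "coh_zero (shift X) n \<longleftrightarrow> coh_zero X (n+1)"
proof -
  have u: "- u = - v \<longleftrightarrow> u = v" "- u = 0\<^sub>v m \<longleftrightarrow> u = 0\<^sub>v m" for u v :: "'k vec" and m
  proof -
    show "- u = - v \<longleftrightarrow> u = v" by (metis uminus_uminus_vec)
    have z: "- 0\<^sub>v m = (0\<^sub>v m :: 'k vec)" by (rule eq_vecI) auto
    show "- u = 0\<^sub>v m \<longleftrightarrow> u = 0\<^sub>v m" by (metis uminus_uminus_vec z)
  qed
  have d: "dif (shift X) n i *\<^sub>v x = - (dif X (n+1) i *\<^sub>v x)" if "x \<in> cvec X (n+1) i" for x n i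
    using that dif_carrier[OF X, of "n+1" i] by (simp add: shift_def)
  have c: "cycles (shift X) n i = cycles X (n+1) i" for i
    unfolding cycles_def using d[of _ n i] u(2) by (auto simp: shift_def add.assoc)
  have "boundaries (shift X) n i = uminus ` boundaries X (n+1) i" for i
  proof -
    have "boundaries (shift X) n i = (\<lambda>x. dif (shift X) (n-1) i *\<^sub>v x) ` cvec X n i"
      by (simp add: boundaries_def shift_def)
    also have "\<dots> = (\<lambda>x. - (dif X n i *\<^sub>v x)) ` cvec X n i"
      using d[of _ "n-1" i] by (intro image_cong refl) simp
    finally show ?thesis by (simp add: boundaries_def image_image)
  qed
  moreover have "uminus ` boundaries X (n+1) i = boundaries X (n+1) i" for i
  proof
    show "uminus ` boundaries X (n+1) i \<subseteq> boundaries X (n+1) i"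
      using lin_subspace_uminus[OF boundaries_subspace[OF X]] by auto
    show "boundaries X (n+1) i \<subseteq> uminus ` boundaries X (n+1) i"
    proof
      fix x assume "x \<in> boundaries X (n+1) i"
      then have "- x \<in> boundaries X (n+1) i" by (rule lin_subspace_uminus[OF boundaries_subspace[OF X]])
      then have "- (- x) \<in> uminus ` boundaries X (n+1) i" by (rule imageI)
      then show "x \<in> uminus ` boundaries X (n+1) i" by simp
    qed
  qed
  ultimately show ?thesis unfolding coh_zero_def c by simp
qed

lemma shift_acyclic:
  assumes "is_cpx X" shows "acyclic_cpx (shift X) \<longleftrightarrow> acyclic_cpx X"
  unfolding acyclic_cpx_def shift_coh_zero[OF assms] by (metis diff_add_cancel)

text \<open>The matrix has the images of the unit vectors as columns; agreement on all vectors is proved by filling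
in one coordinate after the other.\<close>

lemma linear_fun_mat:
  fixes F :: "'k::field vec \<Rightarrow> 'k vec"
  assumes F: "\<And>x. x \<in> carrier_vec n \<Longrightarrow> F x \<in> carrier_vec m"
    and add: "\<And>x y. x \<in> carrier_vec n \<Longrightarrow> y \<in> carrier_vec n \<Longrightarrow> F (x + y) = F x + F y"
    and smult: "\<And>c x. x \<in> carrier_vec n \<Longrightarrow> F (c \<cdot>\<^sub>v x) = c \<cdot>\<^sub>v F x"
  obtains A where "A \<in> carrier_mat m n" "\<And>x. x \<in> carrier_vec n \<Longrightarrow> F x = A *\<^sub>v x"
proof -
  define A where "A = mat m n (\<lambda>(r, c). F (unit_vec n c) $ r)"
  have A: "A \<in> carrier_mat m n" by (simp add: A_def)
  have u: "F (unit_vec n j) = A *\<^sub>v unit_vec n j" if "j < n" for j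
    using that F[OF unit_vec_carrier] by (intro eq_vecI) (auto simp: A_def)
  have "F (vec n (\<lambda>j. if j < k then x $ j else 0)) = A *\<^sub>v vec n (\<lambda>j. if j < k then x $ j else 0)" if "k \<le> n" for x k
    using that
  proof (induction k)
    case 0
    have z: "vec n (\<lambda>j. if j < 0 then x $ j else 0) = 0\<^sub>v n" by (intro eq_vecI) auto
    have "F (0 \<cdot>\<^sub>v 0\<^sub>v n) = 0 \<cdot>\<^sub>v F (0\<^sub>v n)" using smult by simp
    moreover have "0 \<cdot>\<^sub>v 0\<^sub>v n = (0\<^sub>v n :: 'k vec)" by (intro eq_vecI) auto
    moreover have "0 \<cdot>\<^sub>v F (0\<^sub>v n) = 0\<^sub>v m" using F[OF zero_carrier_vec] by (intro eq_vecI) auto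
    ultimately have "F (0\<^sub>v n) = 0\<^sub>v m" by simp
    then show ?case unfolding z using mult_mat_vec_0[OF A] by simp
  next
    case (Suc k)
    let ?v = "\<lambda>k. vec n (\<lambda>j. if j < k then x $ j else 0)"
    have e: "?v (Suc k) = ?v k + x $ k \<cdot>\<^sub>v unit_vec n k" using Suc.prems by (intro eq_vecI) (auto simp: less_Suc_eq)
    show ?case unfolding e
      using add[of "?v k" "x $ k \<cdot>\<^sub>v unit_vec n k"] smult[OF unit_vec_carrier] u[of k] Suc
        mult_add_distrib_mat_vec[OF A, of "?v k" "x $ k \<cdot>\<^sub>v unit_vec n k"] mult_mat_vec[OF A unit_vec_carrier]
      by simp
  qed
  from this[of n] have "F x = A *\<^sub>v x" if "x \<in> carrier_vec n" for x
  proof -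
    have "vec n (\<lambda>j. if j < n then x $ j else 0) = x" using that by (intro eq_vecI) auto
    then show ?thesis using \<open>\<And>x. n \<le> n \<Longrightarrow> _ x\<close>[of x] by simp
  qed
  then show ?thesis using that A by blast
qed

definition rep_inj :: "'k::field rep \<Rightarrow> 'k rep \<Rightarrow> 'k rmor \<Rightarrow> bool" where
  "rep_inj U V g \<longleftrightarrow> g \<in> rep_hom U V \<and>
     (\<forall>i. \<forall>x\<in>carrier_vec (rdim U i). g i *\<^sub>v x = 0\<^sub>v (rdim V i) \<longrightarrow> x = 0\<^sub>v (rdim U i))"

text \<open>In degree 0 a stalk complex has no nonzero boundaries, so there a map on cohomology is the graph of an
honest linear map, which is a morphism because the relation is stable under the arrows.\<close>

lemma coh_inj_stalk:
  fixes U V :: "'k::field rep"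
  assumes U: "is_rep U" and V: "is_rep V" and R: "coh_map (stalk U) (stalk V) 0 R" and i: "coh_inj (stalk U) (stalk V) 0 R"
  obtains g where "rep_inj U V g"
proof -
  have rr: "rep_rel U V R" using coh_mapD(1)[OF R] by (simp add: stalk_ob)
  note D = rep_relD[OF rr]
  have fn: "y = y'" if "(x, y) \<in> R i" "(x, y') \<in> R i" for x y y' i
  proof -
    have "(x - x, y - y') \<in> R i" using rep_rel_diff[OF rr that] .
    then have "y - y' \<in> boundaries (stalk V) 0 i"
      using coh_mapD(5)[OF R] D(1)[OF that(1)] stalk_cycles(2)[OF U] by auto
    then have "y - y' = 0\<^sub>v (rdim V i)" using stalk_cycles(2)[OF V] by auto
    then show ?thesis using D(2)[OF that(1)] D(2)[OF that(2)] vec_diff_identities(6)[of y _ y'] by fastforce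
  qed
  have ex: "\<exists>y. (x, y) \<in> R i" if "x \<in> carrier_vec (rdim U i)" for x i
    using coh_mapD(4)[OF R] that unfolding stalk_cycles(1)[OF U] by blast
  define F where "F i x = (SOME y. (x, y) \<in> R i)" for i x
  have F: "(x, F i x) \<in> R i" if "x \<in> carrier_vec (rdim U i)" for x i
    unfolding F_def by (rule someI_ex[OF ex[OF that]])
  have "\<exists>A\<in>carrier_mat (rdim V i) (rdim U i). \<forall>x\<in>carrier_vec (rdim U i). F i x = A *\<^sub>v x" for i
  proof (rule linear_fun_mat)
    show "F i x \<in> carrier_vec (rdim V i)" if "x \<in> carrier_vec (rdim U i)" for x using D(2)[OF F[OF that]] .
    show "F i (x + y) = F i x + F i y" if "x \<in> carrier_vec (rdim U i)" "y \<in> carrier_vec (rdim U i)" for x y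
      using fn[OF F D(3)[OF F[OF that(1)] F[OF that(2)]]] that by simp
    show "F i (c \<cdot>\<^sub>v x) = c \<cdot>\<^sub>v F i x" if "x \<in> carrier_vec (rdim U i)" for x c
      using fn[OF F D(4)[OF F[OF that]]] that by simp
  qed blast
  then obtain g where g: "\<And>i. g i \<in> carrier_mat (rdim V i) (rdim U i)"
    "\<And>i x. x \<in> carrier_vec (rdim U i) \<Longrightarrow> F i x = g i *\<^sub>v x" by metis
  have gR: "(x, g i *\<^sub>v x) \<in> R i" if "x \<in> carrier_vec (rdim U i)" for x i using F[OF that] g(2)[OF that] by simp
  have "g (tgt a) * rmap U a = rmap V a * g (src a)" for a
  proof (rule mat_eq_mult_vecI)
    have r: "rmap U a \<in> carrier_mat (rdim U (tgt a)) (rdim U (src a))" "rmap V a \<in> carrier_mat (rdim V (tgt a)) (rdim V (src a))"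
      using U V by (auto simp: is_rep_def)
    show "g (tgt a) * rmap U a \<in> carrier_mat (rdim V (tgt a)) (rdim U (src a))" "rmap V a * g (src a) \<in> carrier_mat (rdim V (tgt a)) (rdim U (src a))"
      using mult_carrier_mat[OF g(1) r(1)] mult_carrier_mat[OF r(2) g(1)] .
    fix x :: "'k vec" assume x: "x \<in> carrier_vec (rdim U (src a))"
    show "(g (tgt a) * rmap U a) *\<^sub>v x = (rmap V a * g (src a)) *\<^sub>v x"
      unfolding assoc_mult_mat_vec[OF g(1) r(1) x] assoc_mult_mat_vec[OF r(2) g(1) x]
      by (rule fn[OF gR[OF mult_mat_vec_carrier[OF r(1) x]] D(5)[OF gR[OF x]]])
  qed
  then have "g \<in> rep_hom U V" using g(1) by (simp add: rep_hom_def)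
  moreover have "x = 0\<^sub>v (rdim U j)" if x: "x \<in> carrier_vec (rdim U j)" "g j *\<^sub>v x = 0\<^sub>v (rdim V j)" for j x
    using gR[OF x(1)] x(2) i stalk_cycles(2)[OF U] stalk_cycles(2)[OF V] unfolding coh_inj_def by fastforce
  ultimately show ?thesis using that unfolding rep_inj_def by blast
qed

text \<open>A representative of a morphism is visible in its effect on $H^0$.\<close>

lemma stalk_hom_faithful:
  fixes V W :: "'k::field rep"
  assumes V: "is_rep V" and W: "is_rep W" and f: "f \<in> rep_hom V W"
    and z: "Db_hom (stalk V) (stalk W) = {Db_zero (stalk V) (stalk W)}" and x: "x \<in> carrier_vec (rdim V i)"
  shows "f i *\<^sub>v x = 0\<^sub>v (rdim W i)"
proof -
  let ?X = "stalk V" and ?Y = "stalk W"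
  note X = is_cpx_stalk[OF V] and Y = is_cpx_stalk[OF W]
  define F where "F = (\<lambda>n::int. if n = 0 then f else (\<lambda>_. 0\<^sub>m 0 0))"
  have fc: "f i \<in> carrier_mat (rdim W i) (rdim V i)" for i using rep_hom_carrier[OF f] .
  have F: "chain_map ?X ?Y F"
  proof -
    have "F n \<in> rep_hom (ob ?X n) (ob ?Y n)" for n
      using f rep_hom_zero[OF is_rep_zero is_rep_zero] by (auto simp: F_def stalk_ob) (simp add: zero_rep_def)
    moreover have "dif ?Y n i * F n i = F (n+1) i * dif ?X n i" for n i
    proof -
      have Fc: "F n i \<in> carrier_mat (rdim (ob ?Y n) i) (rdim (ob ?X n) i)" for n i
        using fc by (auto simp: F_def stalk_ob zero_rep_def)
      have d: "dif ?Y n i = 0\<^sub>m (rdim (ob ?Y (n+1)) i) (rdim (ob ?Y n) i)" "dif ?X n i = 0\<^sub>m (rdim (ob ?X (n+1)) i) (rdim (ob ?X n) i)"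
        by (simp_all add: stalk_def Let_def)
      show ?thesis unfolding d using left_mult_zero_mat[OF Fc] right_mult_zero_mat[OF Fc] by simp
    qed
    ultimately show ?thesis by (simp add: chain_map_def)
  qed
  have "Db_of ?X ?Y F = Db_zero ?X ?Y" using Db_of_hom(1)[OF X Y F] z by simp
  then have "hmap ?X ?Y F 0 i = hmap ?X ?Y (cm_zero ?X ?Y) 0 i"
    using hrel_Db_of[OF X Y F] hrel_Db_of[OF X Y chain_map_zero[OF X Y]] by (simp add: Db_zero_def)
  moreover have fx: "f i *\<^sub>v x \<in> carrier_vec (rdim W i)" using mult_mat_vec_carrier[OF fc x] .
  then have "(x, f i *\<^sub>v x) \<in> hmap ?X ?Y F 0 i"
    using x by (simp add: hmap_def stalk_cycles[OF V] stalk_cycles[OF W] F_def)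
  ultimately have "cm_zero ?X ?Y 0 i *\<^sub>v x - f i *\<^sub>v x = 0\<^sub>v (rdim W i)"
    by (auto simp: hmap_def stalk_cycles[OF V] stalk_cycles[OF W])
  then have "- (f i *\<^sub>v x) = 0\<^sub>v (rdim W i)"
    using zero_mult_mat_vec[OF x, of "rdim W i"] vec_diff_identities(8)[OF fx fx fx fx] by (simp add: cm_zero_def stalk_ob)
  moreover have "- 0\<^sub>v m = (0\<^sub>v m :: 'k vec)" for m by (rule eq_vecI) auto
  ultimately show ?thesis by (metis uminus_uminus_vec)
qed

section \<open>Harder-Narasimhan pieces of a representation\<close>

text \<open>Sums of charges are compared by rotating the reference ray to the real axis; this translates the
resulting sign condition back to arguments.\<close>

lemma Arg_le_of_rotated:
  assumes "Im z > 0" "0 < \<psi>" "\<psi> \<le> 1" "Im (z * cis (- (pi * \<psi>))) \<le> 0"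
  shows "Arg z \<le> pi * \<psi>"
proof (rule ccontr)
  assume "\<not> Arg z \<le> pi * \<psi>"
  moreover have "Arg z \<le> pi" by (rule Arg_le_pi)
  moreover have "0 < pi * \<psi>" using assms by simp
  ultimately have "sin (Arg z - pi * \<psi>) > 0" by (intro sin_gt_zero) linarith+
  moreover have "cmod z > 0" using assms(1) by auto
  ultimately have "Im (rcis (cmod z) (Arg z - pi * \<psi>)) > 0" by (simp add: rcis_def)
  moreover have "rcis (cmod z) (Arg z - pi * \<psi>) = rcis (cmod z) (Arg z) * cis (- (pi * \<psi>))"
    by (simp add: rcis_def cis_mult mult.assoc)
  ultimately show False using assms(4) by (simp add: rcis_cmod_Arg)
qed

locale charge =
  fixes Z :: "('k::field rep \<Rightarrow>\<^sub>0 int) set \<Rightarrow> complex"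
  assumes Z_hom: "Z \<in> hom K_rep complex_add_group"
    and Im_pos: "\<And>V. is_rep V \<Longrightarrow> nonzero_rep V \<Longrightarrow> Im (Z (rep_class V)) > 0"

locale stability_on_heart = charge Z
  for P :: "real \<Rightarrow> 'k::field cpx set" and W :: "('k cpx \<Rightarrow>\<^sub>0 int) set \<Rightarrow> complex"
    and Z :: "('k rep \<Rightarrow>\<^sub>0 int) set \<Rightarrow> complex" +
  assumes stab: "(P, W) \<in> Stab" and heart: "has_heart_and_charge (P, W) Z"
begin

lemma slicing: "slicing P" and W_hom: "W \<in> hom K_Db complex_add_group"
  using stab by (auto simp: Stab_def)

lemma P_cpx: "X \<in> P \<phi> \<Longrightarrow> is_cpx X"
proof -
  assume a: "X \<in> P \<phi>"
  have "additive_subcat (P \<phi>)" using slicing by (simp add: slicing_def)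
  then show "is_cpx X" using a by (auto simp: additive_subcat_def Db_obj_def)
qed

lemma P_iso: "X \<in> P \<phi> \<Longrightarrow> is_cpx Y \<Longrightarrow> Db_isomorphic X Y \<Longrightarrow> Y \<in> P \<phi>"
proof -
  assume a: "X \<in> P \<phi>" "is_cpx Y" "Db_isomorphic X Y"
  have "additive_subcat (P \<phi>)" using slicing by (simp add: slicing_def)
  then have "\<forall>X\<in>P \<phi>. \<forall>Y\<in>Db_obj. Db_isomorphic X Y \<longrightarrow> Y \<in> P \<phi>" unfolding additive_subcat_def by (elim conjE)
  then show "Y \<in> P \<phi>" using a by (auto simp: Db_obj_def)
qed

lemma P_shift: "P (\<phi> + 1) = shift ` P \<phi>"
  using slicing by (auto simp: slicing_def)

lemma P_hom: "\<phi> > \<psi> \<Longrightarrow> X \<in> P \<phi> \<Longrightarrow> Y \<in> P \<psi> \<Longrightarrow> Db_hom X Y = {Db_zero X Y}"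
  using slicing by (simp add: slicing_def)

lemma W_triangle:
  assumes "triangle X Y T" shows "W (Db_class Y) = W (Db_class X) + W (Db_class T)"
proof -
  have "X \<in> Db_obj" "Y \<in> Db_obj" "T \<in> Db_obj" using assms by (auto simp: triangle_def dist_triangle_def)
  then show ?thesis using K_class_additive[OF W_hom] assms by blast
qed

lemma W_acyclic:
  assumes "is_cpx A" "acyclic_cpx A" shows "W (Db_class A) = 0"
  using W_triangle[OF triangle_acyclic[OF assms]] by simp

lemma W_phase:
  assumes "X \<in> P \<phi>" "\<not> acyclic_cpx X"
  shows "\<exists>r>0. W (Db_class X) = of_real r * cis (pi * \<phi>)"
proof -
  have "Db_nonzero X" using Db_nonzero_iff[OF P_cpx[OF assms(1)]] assms(2) by simp
  then obtain r where "r > 0" "W (Db_class X) = of_real r * exp (\<i> * of_real pi * of_real \<phi>)"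
    using stab assms(1) by (fastforce simp: Stab_def)
  then show ?thesis by (auto simp: cis_conv_exp mult.assoc)
qed

lemma W_stalk: "is_rep V \<Longrightarrow> W (Db_class (stalk V)) = Z (rep_class V)"
  using heart by (auto simp: has_heart_and_charge_def)

lemma heart_rep:
  assumes "X \<in> P \<phi>" "0 < \<phi>" "\<phi> \<le> 1"
  obtains V where "is_rep V" "Db_isomorphic X (stalk V)" "stalk V \<in> P \<phi>"
proof -
  have "X \<in> slice_interval P {0<..1}" using assms by (intro slice_interval.slice[of \<phi>]) auto
  then have "X \<in> std_heart" using heart by (simp add: has_heart_and_charge_def)
  then obtain V where V: "is_rep V" "Db_isomorphic X (stalk V)" by (auto simp: std_heart_def)
  then show ?thesis using that P_iso[OF assms(1) is_cpx_stalk[OF V(1)]] by blast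
qed

lemma heart_coh_zero:
  assumes "X \<in> P \<phi>" "0 < \<phi>" "\<phi> \<le> 1" "k \<noteq> 0"
  shows "coh_zero X k"
proof -
  obtain V where V: "is_rep V" "Db_isomorphic X (stalk V)" using heart_rep[OF assms(1-3)] by blast
  show ?thesis using Db_isomorphic_coh_zero[OF P_cpx[OF assms(1)] is_cpx_stalk[OF V(1)] V(2)]
     stalk_cycles(3)[OF V(1) assms(4)] by blast
qed

text \<open>After \<open>-m\<close> shifts the object lies in the heart, hence is isomorphic to a stalk complex.\<close>

lemma slice_coh_zero:
  assumes "X \<in> P \<phi>" "0 < \<phi> - of_int m" "\<phi> - of_int m \<le> 1" "k \<noteq> - m"
  shows "coh_zero X k"
proof -
  have pos: "coh_zero X k" if "X \<in> P \<phi>" "0 < \<phi> - real l" "\<phi> - real l \<le> 1" "k \<noteq> - int l" for X \<phi> l k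
    using that
  proof (induction l arbitrary: X \<phi> k)
    case 0
    then show ?case using heart_coh_zero by simp
  next
    case (Suc l)
    then obtain Y where Y: "Y \<in> P (\<phi> - 1)" "X = shift Y" using P_shift[of "\<phi> - 1"] by auto
    have "coh_zero Y (k+1)" using Suc Y by (intro Suc.IH[of _ "\<phi> - 1"]) auto
    then show ?case using shift_coh_zero[OF P_cpx[OF Y(1)]] Y(2) by simp
  qed
  have neg: "coh_zero X k" if "X \<in> P \<phi>" "0 < \<phi> + real l" "\<phi> + real l \<le> 1" "k \<noteq> int l" for X \<phi> l k
    using that
  proof (induction l arbitrary: X \<phi> k)
    case 0
    then show ?case using heart_coh_zero by simp
  next
    case (Suc l)
    have "shift X \<in> P (\<phi> + 1)" using P_shift Suc by blast
    then have "coh_zero (shift X) (k-1)" using Suc by (intro Suc.IH[of _ "\<phi> + 1"]) auto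
    then show ?case using shift_coh_zero[OF P_cpx[OF Suc.prems(1)]] by simp
  qed
  show ?thesis
  proof (cases "m \<ge> 0")
    case True
    then show ?thesis using pos[of X \<phi> "nat m" k] assms by simp
  next
    case False
    then show ?thesis using neg[of X \<phi> "nat (-m)" k] assms by simp
  qed
qed

text \<open>Consider the Harder-Narasimhan tower of the stalk complex of \<open>V\<close>. The piece \<open>A j\<close> has cohomology only
in degree \<open>- c j\<close>, and these degrees weakly increase along the tower because the phases decrease.
Hence \<open>E j\<close> has no cohomology above the degrees of its own pieces, all connecting maps
$H^{k-1}(A_j) \to H^k(E_j)$ vanish, and the cohomology of each stage injects into that of the next.
As the top stage has cohomology only in degree 0, so do all stages, and every piece that is not a
zero object lies in the heart. The first such piece is then a subrepresentation of \<open>V\<close>, and it has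
the largest phase among the pieces that are not zero objects, whose charges add up to that of \<open>V\<close>.\<close>

lemma HN_sub:
  assumes V: "is_rep V" "nonzero_rep V"
  obtains U g \<phi> where "is_rep U" "nonzero_rep U" "rep_inj U V g" "0 < \<phi>" "\<phi> \<le> 1" "stalk U \<in> P \<phi>"
    "Arg (Z (rep_class V)) \<le> pi * \<phi>"
proof -
  let ?X = "stalk V"
  have "Db_nonzero ?X" "?X \<in> Db_obj"
    using Db_nonzero_iff[OF is_cpx_stalk] acyclic_stalk V is_cpx_stalk by (auto simp: Db_obj_def)
  moreover have "\<forall>X\<in>Db_obj. Db_nonzero X \<longrightarrow>
        (\<exists>(n::nat) \<phi> E A. E 0 = zero_cpx \<and> E n = X \<and> (\<forall>i j. i < j \<and> j < n \<longrightarrow> \<phi> i > \<phi> j) \<and>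
           (\<forall>i<n. A i \<in> P (\<phi> i) \<and> triangle (E i) (E (Suc i)) (A i)))"
    using slicing unfolding slicing_def by (elim conjE)
  ultimately obtain n \<phi> E A where *: "E (0::nat) = zero_cpx \<and> E n = ?X \<and> (\<forall>i j. i < j \<and> j < n \<longrightarrow> \<phi> i > \<phi> j) \<and>
           (\<forall>i<n. A i \<in> P (\<phi> i) \<and> triangle (E i) (E (Suc i)) (A i))" by blast
  have E: "E 0 = zero_cpx" "E n = ?X"
    and \<phi>: "\<And>i j. i < j \<Longrightarrow> j < n \<Longrightarrow> \<phi> i > \<phi> j"
    and A: "\<And>i. i < n \<Longrightarrow> A i \<in> P (\<phi> i)" and tri: "\<And>i. i < n \<Longrightarrow> triangle (E i) (E (Suc i)) (A i)"
    using * by simp_all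
  have cA: "is_cpx (A i)" if "i < n" for i using P_cpx[OF A[OF that]] .
  have cE: "is_cpx (E i)" if "i \<le> n" for i
  proof (cases i)
    case 0 then show ?thesis using E is_cpx_zero by simp
  next
    case (Suc j)
    then show ?thesis using tri[of j] that by (auto simp: triangle_def dist_triangle_def Db_obj_def)
  qed
  have "\<forall>j. \<exists>U V. j < n \<longrightarrow> coh_exact (E j) (E (Suc j)) (A j) U V" using triangle_exact[OF tri] by blast
  then obtain R where "\<forall>j. \<exists>V. j < n \<longrightarrow> coh_exact (E j) (E (Suc j)) (A j) (R j) V" by (rule choice[THEN exE])
  then obtain S where "\<forall>j. j < n \<longrightarrow> coh_exact (E j) (E (Suc j)) (A j) (R j) (S j)" by (rule choice[THEN exE])
  then have RS: "\<And>j. j < n \<Longrightarrow> coh_exact (E j) (E (Suc j)) (A j) (R j) (S j)" by blast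
  \<comment> \<open>The number of shifts that separates \<open>A j\<close> from the heart.\<close>
  define c where "c j = \<lceil>\<phi> j\<rceil> - 1" for j
  have c: "0 < \<phi> j - of_int (c j)" "\<phi> j - of_int (c j) \<le> 1" for j
    unfolding c_def by linarith+
  have cmono: "c j \<le> c i" if "i < j" "j < n" for i j
    using ceiling_mono[OF less_imp_le[OF \<phi>[OF that]]] unfolding c_def by simp
  have hA: "coh_zero (A j) k" if "j < n" "k \<noteq> - c j" for j k
    using slice_coh_zero[OF A[OF that(1)] c that(2)] .
  have R: "coh_map (E j) (E (Suc j)) k (R j k)" and S: "coh_map (E (Suc j)) (A j) k (S j k)"
    and Ri: "coh_zero (A j) (k-1) \<Longrightarrow> coh_inj (E j) (E (Suc j)) k (R j k)"
    and Ss: "coh_zero (E j) (k+1) \<Longrightarrow> coh_sur (A j) k (S j k)"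
    and Si: "coh_zero (E j) k \<Longrightarrow> coh_inj (E (Suc j)) (A j) k (S j k)" if "j < n" for j k
    using RS[OF that] unfolding coh_exact_def by auto
  have hE: "coh_zero (E j) k" if "j \<le> n" "\<And>i. i < j \<Longrightarrow> k > - c i" for j k
    using that
  proof (induction j)
    case 0
    then show ?case using E acyclic_zero[where 'k='k] by (simp add: acyclic_cpx_def)
  next
    case (Suc j)
    have "coh_zero (E j) k" using Suc by simp
    moreover have "coh_zero (A j) k" using hA[of j k] Suc.prems(1) Suc.prems(2)[of j] by simp
    ultimately show ?case using coh_zero_transfer[OF S Si] Suc.prems(1) by simp
  qed
  have hEc: "coh_zero (E j) (- c j + 1)" if "j < n" for j
  proof (rule hE)
    show "j \<le> n" using that by simp
    show "- c j + 1 > - c i" if "i < j" for i using cmono[OF that \<open>j < n\<close>] by simp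
  qed
  have Rinj: "coh_inj (E j) (E (Suc j)) k (R j k)" if j: "j < n" for j k
  proof (cases "k - 1 = - c j")
    case True
    then have "k = - c j + 1" by simp
    then have "coh_zero (E j) k" using hEc[OF j] by simp
    then show ?thesis using coh_map_cycles(1)[OF R[OF j]] unfolding coh_inj_def coh_zero_def by blast
  next
    case False
    then show ?thesis using Ri[OF j] hA[OF j] by blast
  qed
  have vanish: "coh_zero (E j) k" if "j \<le> n" "k \<noteq> 0" for j k
    using that(1)
  proof (induction j rule: inc_induct)
    case base
    then show ?case using E(2) stalk_cycles(3)[OF V(1) that(2)] by simp
  next
    case (step j)
    then show ?case using coh_zero_transfer[OF R Rinj] by blast
  qed
  have Ac: "acyclic_cpx (A j)" if "j < n" "coh_zero (E (Suc j)) (- c j)" for j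
  proof -
    have "coh_zero (A j) (- c j)" using coh_zero_image[OF S Ss that(2)] that(1) hEc[OF that(1)] by blast
    then show ?thesis using hA[OF that(1)] unfolding acyclic_cpx_def by metis
  qed
  have nac: "\<not> acyclic_cpx (E n)" using E(2) acyclic_stalk[OF V(1)] V(2) by simp
  \<comment> \<open>The first stage that is not acyclic; the piece \<open>A j0\<close> then carries all its cohomology.\<close>
  define j0 where "j0 = (LEAST j. \<not> acyclic_cpx (E (Suc j)))"
  have "n \<noteq> 0" using nac E(1) acyclic_zero by metis
  then obtain n' where n': "n = Suc n'" by (cases n) auto
  have j0: "\<not> acyclic_cpx (E (Suc j0))" "j0 \<le> n'"
    using LeastI[of "\<lambda>j. \<not> acyclic_cpx (E (Suc j))" n'] Least_le[of "\<lambda>j. \<not> acyclic_cpx (E (Suc j))" n'] nac n'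
    unfolding j0_def by auto
  have j0n: "j0 < n" using j0(2) n' by simp
  have less: "acyclic_cpx (E (Suc i))" if "i < j0" for i using not_less_Least[of i] that unfolding j0_def by blast
  have E0: "acyclic_cpx (E j0)" using less E(1) acyclic_zero by (cases j0) auto
  have A0: "\<not> acyclic_cpx (A j0)"
  proof
    assume "acyclic_cpx (A j0)"
    then have "coh_zero (E (Suc j0)) k" for k
      using coh_zero_transfer[OF S[OF j0n] Si[OF j0n], of k] E0 by (simp add: acyclic_cpx_def)
    then show False using j0(1) by (simp add: acyclic_cpx_def)
  qed
  have range: "0 < \<phi> j \<and> \<phi> j \<le> 1" if "j < n" "\<not> acyclic_cpx (A j)" for j
  proof -
    have "c j = 0" using Ac[OF that(1)] vanish[of "Suc j" "- c j"] that by auto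
    then show ?thesis using c[of j] by simp
  qed
  have r0: "0 < \<phi> j0" "\<phi> j0 \<le> 1" using range[OF j0n A0] by auto
  obtain U where U: "is_rep U" "Db_isomorphic (A j0) (stalk U)" "stalk U \<in> P (\<phi> j0)"
    using heart_rep[OF A[OF j0n] r0] by blast
  have cU: "is_cpx (stalk U)" using is_cpx_stalk[OF U(1)] .
  have "\<not> acyclic_cpx (stalk U)"
    using Db_isomorphic_coh_zero[OF cA[OF j0n] cU U(2)] A0 by (simp add: acyclic_cpx_def)
  then have Un: "nonzero_rep U" using acyclic_stalk[OF U(1)] by simp
  obtain G where G: "coh_map (A j0) (stalk U) 0 G" "coh_inj (A j0) (stalk U) 0 G" "coh_sur (stalk U) 0 G"
    using U(2) Db_iso_coh[OF cA[OF j0n] cU] unfolding Db_isomorphic_def by metis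
  have G': "coh_map (stalk U) (A j0) 0 (\<lambda>i. (G i)\<inverse>)" "coh_inj (stalk U) (A j0) 0 (\<lambda>i. (G i)\<inverse>)"
    using coh_map_converse[OF cA[OF j0n] cU G] .
  have "coh_zero (E j0) 0" "coh_zero (E j0) (0+1)" using E0 by (auto simp: acyclic_cpx_def)
  then have S': "coh_map (A j0) (E (Suc j0)) 0 (\<lambda>i. (S j0 0 i)\<inverse>)" "coh_inj (A j0) (E (Suc j0)) 0 (\<lambda>i. (S j0 0 i)\<inverse>)"
    using coh_map_converse[OF cE cA[OF j0n] S[OF j0n] Si[OF j0n] Ss[OF j0n]] j0n by auto
  have "\<exists>H. coh_map (stalk U) (E j) 0 H \<and> coh_inj (stalk U) (E j) 0 H" if "Suc j0 \<le> j" "j \<le> n" for j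
    using that
  proof (induction j rule: dec_induct)
    case base
    then show ?case using coh_map_comp[OF G'(1) S'(1)] coh_inj_comp[OF G'(2) S'(2)] by blast
  next
    case (step j)
    then obtain H where "coh_map (stalk U) (E j) 0 H" "coh_inj (stalk U) (E j) 0 H" by auto
    then show ?case using coh_map_comp[OF _ R] coh_inj_comp[OF _ Rinj] step by (meson Suc_le_lessD)
  qed
  from this[of n] obtain H where H: "coh_map (stalk U) ?X 0 H" "coh_inj (stalk U) ?X 0 H" using j0n E(2) by auto
  obtain g where g: "rep_inj U V g" using coh_inj_stalk[OF U(1) V(1) H] by blast
  have sum: "W (Db_class (E j)) = (\<Sum>i<j. W (Db_class (A i)))" if "j \<le> n" for j
    using that
  proof (induction j)
    case 0
    then show ?case using E(1) W_acyclic[OF is_cpx_zero acyclic_zero] by simp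
  next
    case (Suc j)
    then show ?case using W_triangle[OF tri[of j]] by simp
  qed
  \<comment> \<open>Pieces before \<open>j0\<close> are acyclic, and later ones have smaller phases within an interval of length 1.\<close>
  have summand: "Im (W (Db_class (A j)) * cis (- (pi * \<phi> j0))) \<le> 0" if jn: "j < n" for j
  proof (cases "acyclic_cpx (A j)")
    case True
    then show ?thesis using W_acyclic[OF cA[OF jn]] by simp
  next
    case False
    have "j0 \<le> j"
    proof (rule ccontr)
      assume "\<not> j0 \<le> j"
      then have "acyclic_cpx (E (Suc j))" using less by simp
      then show False using Ac[OF jn] False by (simp add: acyclic_cpx_def)
    qed
    then have le: "\<phi> j \<le> \<phi> j0" using \<phi>[of j0 j] jn by (cases "j = j0") auto
    obtain r where r: "r > 0" "W (Db_class (A j)) = of_real r * cis (pi * \<phi> j)" using W_phase[OF A[OF jn] False] by blast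
    have "W (Db_class (A j)) * cis (- (pi * \<phi> j0)) = of_real r * cis (pi * \<phi> j - pi * \<phi> j0)"
      unfolding r(2) by (simp add: cis_mult mult.assoc)
    moreover have "sin (pi * \<phi> j0 - pi * \<phi> j) \<ge> 0"
    proof (rule sin_ge_zero)
      show "0 \<le> pi * \<phi> j0 - pi * \<phi> j" using le by simp
      have "\<phi> j0 - \<phi> j \<le> 1" using range[OF jn False] r0 by simp
      then have "pi * (\<phi> j0 - \<phi> j) \<le> pi * 1" by (intro mult_left_mono) auto
      then show "pi * \<phi> j0 - pi * \<phi> j \<le> pi" by (simp add: right_diff_distrib)
    qed
    moreover have "sin (pi * \<phi> j - pi * \<phi> j0) = - sin (pi * \<phi> j0 - pi * \<phi> j)"
      by (metis minus_diff_eq sin_minus)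
    ultimately show ?thesis using r(1) by (simp add: mult_nonneg_nonneg)
  qed
  have "Z (rep_class V) = (\<Sum>i<n. W (Db_class (A i)))" using sum[of n] E(2) W_stalk[OF V(1)] by simp
  then have "Im (Z (rep_class V) * cis (- (pi * \<phi> j0))) = (\<Sum>i<n. Im (W (Db_class (A i)) * cis (- (pi * \<phi> j0))))"
    by (simp only: sum_distrib_right Im_sum)
  also have "\<dots> \<le> 0" by (rule sum_nonpos) (use summand in auto)
  finally have "Arg (Z (rep_class V)) \<le> pi * \<phi> j0"
    using Arg_le_of_rotated[OF Im_pos[OF V]] r0 by simp
  then show ?thesis using that[OF U(1) Un g r0 U(3)] by blast
qed

lemma stalk_phase:
  assumes "is_rep V" "nonzero_rep V" "stalk V \<in> P \<phi>" "0 < \<phi>" "\<phi> \<le> 1"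
  shows "Arg (Z (rep_class V)) = pi * \<phi>"
proof -
  obtain r where r: "r > 0" "Z (rep_class V) = of_real r * cis (pi * \<phi>)"
    using W_phase[OF assms(3)] acyclic_stalk[OF assms(1)] assms(2) W_stalk[OF assms(1)] by auto
  have "- pi < pi * \<phi>" "pi * \<phi> \<le> pi" using assms(4,5) by (auto intro: order.strict_trans1[of _ 0])
  then show ?thesis unfolding r(2) using r(1) by (intro Arg_unique[of r]) (auto simp: cis_conv_exp)
qed

text \<open>The first Harder-Narasimhan piece of \<open>U\<close> has at least the argument of \<open>U\<close>, and it maps to \<open>V\<close> by a
nonzero morphism; morphisms from larger to smaller phases vanish.\<close>

lemma semistable_sub:
  assumes V: "is_rep V" "stalk V \<in> P \<phi>" "0 < \<phi>" "\<phi> \<le> 1"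
    and U: "is_rep U" "nonzero_rep U" "rep_inj U V f"
  shows "Arg (Z (rep_class U)) \<le> pi * \<phi>"
proof -
  obtain T g \<psi> where T: "is_rep T" "nonzero_rep T" "rep_inj T U g" "0 < \<psi>" "\<psi> \<le> 1" "stalk T \<in> P \<psi>"
    "Arg (Z (rep_class U)) \<le> pi * \<psi>" using HN_sub[OF U(1,2)] .
  have "\<psi> \<le> \<phi>"
  proof (rule ccontr)
    assume "\<not> \<psi> \<le> \<phi>"
    then have z: "Db_hom (stalk T) (stalk V) = {Db_zero (stalk T) (stalk V)}"
      using P_hom[OF _ T(6) V(2)] by simp
    have h: "g \<in> rep_hom T U" "f \<in> rep_hom U V" using T(3) U(3) by (auto simp: rep_inj_def)
    obtain i where i: "rdim T i \<noteq> 0" using T(2) by (auto simp: nonzero_rep_def)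
    let ?x = "unit_vec (rdim T i) 0 :: 'k vec"
    have x: "?x \<in> carrier_vec (rdim T i)" by simp
    have gx: "g i *\<^sub>v ?x \<in> carrier_vec (rdim U i)" using mult_mat_vec_carrier[OF rep_hom_carrier[OF h(1)] x] .
    have "(f i * g i) *\<^sub>v ?x = 0\<^sub>v (rdim V i)"
      using stalk_hom_faithful[OF T(1) V(1) rep_hom_comp[OF h T(1) U(1) V(1)] z x] .
    then have "f i *\<^sub>v (g i *\<^sub>v ?x) = 0\<^sub>v (rdim V i)"
      using assoc_mult_mat_vec[OF rep_hom_carrier[OF h(2)] rep_hom_carrier[OF h(1)] x] by simp
    then have "?x = 0\<^sub>v (rdim T i)" using T(3) U(3) gx x unfolding rep_inj_def by blast
    then show False using i unit_vec_nonzero[of "rdim T i" 0] by simp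
  qed
  then have "pi * \<psi> \<le> pi * \<phi>" by simp
  with T(7) show ?thesis by (rule order_trans)
qed

end

section \<open>Linear algebra over a field\<close>

text \<open>Gaussian elimination: one equation is solved for an unknown \<open>\<alpha>0\<close> that it involves, and the others are
rewritten accordingly; an equation that involves no unknown is dropped. The equations are arbitrary linear functionals, so
the lemma applies to index sets of any shape.\<close>

lemma linear_system_nontrivial:
  fixes l :: "'b \<Rightarrow> ('a \<Rightarrow> 'k::field) \<Rightarrow> 'k"
  assumes "finite A" "finite B" "card B < card A"
    and "\<And>\<beta> x y. l \<beta> (\<lambda>\<alpha>. x \<alpha> + y \<alpha>) = l \<beta> x + l \<beta> y"
    and "\<And>\<beta> c x. l \<beta> (\<lambda>\<alpha>. c * x \<alpha>) = c * l \<beta> x"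
  shows "\<exists>x. (\<exists>\<alpha>\<in>A. x \<alpha> \<noteq> 0) \<and> (\<forall>\<beta>\<in>B. l \<beta> x = 0)"
proof -
  have "\<exists>x. (\<exists>\<alpha>\<in>A. x \<alpha> \<noteq> 0) \<and> (\<forall>\<alpha>. \<alpha> \<notin> A \<longrightarrow> x \<alpha> = 0) \<and> (\<forall>\<beta>\<in>B. l \<beta> x = 0)"
    using assms(2,1,3-5)
  proof (induction B arbitrary: A l rule: finite_induct)
    case empty
    then obtain \<alpha> where "\<alpha> \<in> A" by fastforce
    then show ?case by (intro exI[of _ "\<lambda>\<alpha>'. if \<alpha>' = \<alpha> then 1 else 0"]) auto
  next
    case (insert \<beta> B)
    note add = insert.prems(3) and mult = insert.prems(4)
    define e :: "'a \<Rightarrow> 'a \<Rightarrow> 'k" where "e \<alpha> = (\<lambda>\<alpha>'. if \<alpha>' = \<alpha> then 1 else 0)" for \<alpha>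
    show ?case
    proof (cases "\<exists>\<alpha>\<in>A. l \<beta> (e \<alpha>) \<noteq> 0")
      case True
      then obtain \<alpha>0 where \<alpha>0: "\<alpha>0 \<in> A" "l \<beta> (e \<alpha>0) \<noteq> 0" by blast
      \<comment> \<open>\<open>r x\<close> is the correction of \<open>x\<close> in the coordinate \<open>\<alpha>0\<close> that solves the equation \<open>\<beta>\<close>.\<close>
      define c where "c x = - (l \<beta> x / l \<beta> (e \<alpha>0))" for x
      define r where "r x = (\<lambda>\<alpha>. x \<alpha> + c x * e \<alpha>0 \<alpha>)" for x
      have lr: "l b (r x) = l b x + c x * l b (e \<alpha>0)" for b x unfolding r_def add mult ..
      have "\<exists>x. (\<exists>\<alpha>\<in>A - {\<alpha>0}. x \<alpha> \<noteq> 0) \<and> (\<forall>\<alpha>. \<alpha> \<notin> A - {\<alpha>0} \<longrightarrow> x \<alpha> = 0) \<and> (\<forall>b\<in>B. l b (r x) = 0)"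
      proof (rule insert.IH)
        show "finite (A - {\<alpha>0})" "card B < card (A - {\<alpha>0})"
          using insert.prems(1,2) insert.hyps \<alpha>0 by auto
        show "l b (r (\<lambda>\<alpha>. x \<alpha> + y \<alpha>)) = l b (r x) + l b (r y)" for b x y
          unfolding lr c_def add by (simp add: algebra_simps add_divide_distrib)
        show "l b (r (\<lambda>\<alpha>. d * x \<alpha>)) = d * l b (r x)" for b d x
          unfolding lr c_def mult by (simp add: algebra_simps)
      qed
      then obtain x where x: "\<exists>\<alpha>\<in>A - {\<alpha>0}. x \<alpha> \<noteq> 0" "\<forall>\<alpha>. \<alpha> \<notin> A - {\<alpha>0} \<longrightarrow> x \<alpha> = 0" "\<forall>b\<in>B. l b (r x) = 0" by blast
      have "l \<beta> (r x) = 0" unfolding lr c_def using \<alpha>0(2) by simp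
      moreover have "\<exists>\<alpha>\<in>A. r x \<alpha> \<noteq> 0" using x(1) by (auto simp: r_def e_def)
      moreover have "\<forall>\<alpha>. \<alpha> \<notin> A \<longrightarrow> r x \<alpha> = 0" using x(2) \<alpha>0(1) unfolding r_def e_def by auto
      ultimately show ?thesis using x(3) by blast
    next
      case False
      then have z: "\<forall>\<alpha>\<in>A. l \<beta> (e \<alpha>) = 0" by blast
      have "l \<beta> x = 0" if "\<forall>\<alpha>. \<alpha> \<notin> A \<longrightarrow> x \<alpha> = 0" for x
      proof -
        have l0: "l \<beta> (\<lambda>_. 0) = 0" using mult[of \<beta> 0 "\<lambda>_. 0"] by simp
        have "l \<beta> (\<lambda>\<alpha>. if \<alpha> \<in> F then x \<alpha> else 0) = 0" if "finite F" "F \<subseteq> A" for F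
          using that
        proof (induction F rule: finite_induct)
          case empty
          then show ?case using l0 by simp
        next
          case (insert \<gamma> F)
          have "(\<lambda>\<alpha>. if \<alpha> \<in> insert \<gamma> F then x \<alpha> else 0) = (\<lambda>\<alpha>. (if \<alpha> \<in> F then x \<alpha> else 0) + x \<gamma> * e \<gamma> \<alpha>)"
            using insert.hyps by (auto simp: e_def)
          then show ?case using insert z by (simp add: add mult)
        qed
        from this[OF insert.prems(1) order_refl] have "l \<beta> (\<lambda>\<alpha>. if \<alpha> \<in> A then x \<alpha> else 0) = 0" .
        moreover have "(\<lambda>\<alpha>. if \<alpha> \<in> A then x \<alpha> else 0) = x" using that by auto
        ultimately show ?thesis by simp
      qed
      moreover have "\<exists>x. (\<exists>\<alpha>\<in>A. x \<alpha> \<noteq> 0) \<and> (\<forall>\<alpha>. \<alpha> \<notin> A \<longrightarrow> x \<alpha> = 0) \<and> (\<forall>b\<in>B. l b x = 0)"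
        using insert.prems insert.hyps by (intro insert.IH) auto
      ultimately show ?thesis by blast
    qed
  qed
  then show ?thesis by blast
qed

definition mat_inj :: "'k::field mat \<Rightarrow> bool" where
  "mat_inj A \<longleftrightarrow> (\<forall>x\<in>carrier_vec (dim_col A). A *\<^sub>v x = 0\<^sub>v (dim_row A) \<longrightarrow> x = 0\<^sub>v (dim_col A))"

lemma mat_injD:
  assumes "mat_inj A" "A \<in> carrier_mat m n" "x \<in> carrier_vec n"
  shows "A *\<^sub>v x = 0\<^sub>v m \<Longrightarrow> x = 0\<^sub>v n"
  using assms unfolding mat_inj_def by auto

lemma mat_inj_cancel:
  assumes "mat_inj A" "A \<in> carrier_mat m n" "x \<in> carrier_vec n" "y \<in> carrier_vec n" "A *\<^sub>v x = A *\<^sub>v y"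
  shows "x = y"
proof -
  have "A *\<^sub>v (x - y) = 0\<^sub>v m"
    using mult_minus_distrib_mat_vec[OF assms(2-4)] assms(5) mult_mat_vec_carrier[OF assms(2,4)]
      vec_diff_identities(1) by metis
  then have d: "x - y = 0\<^sub>v n" using mat_injD[OF assms(1,2) minus_carrier_vec[OF assms(3,4)]] by simp
  show ?thesis
  proof (rule eq_vecI)
    fix i assume i: "i < dim_vec y"
    have "(x - y) $ i = 0" using d i assms(4) by simp
    then show "x $ i = y $ i" using i assms(3,4) by simp
  qed (use assms in auto)
qed

lemma mat_inj_dim:
  assumes "mat_inj A" and A: "A \<in> carrier_mat m n"
  shows "n \<le> m"
proof (rule ccontr)
  assume n: "\<not> n \<le> m"
  define l where "l i x = (\<Sum>j<n. A $$ (i, j) * x j)" for i x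
  have "\<exists>x. (\<exists>\<alpha>\<in>{..<n}. x \<alpha> \<noteq> 0) \<and> (\<forall>i\<in>{..<m}. l i x = 0)"
  proof (rule linear_system_nontrivial)
    show "card {..<m} < card {..<n}" using n by simp
    show "l i (\<lambda>j. x j + y j) = l i x + l i y" for i x y by (simp add: l_def distrib_left sum.distrib)
    show "l i (\<lambda>j. c * x j) = c * l i x" for i c x by (simp add: l_def sum_distrib_left mult.left_commute)
  qed auto
  then obtain x where x: "\<exists>j<n. x j \<noteq> 0" "\<And>i. i < m \<Longrightarrow> l i x = 0" by auto
  have "A *\<^sub>v vec n x = 0\<^sub>v m"
    using A x(2) by (intro eq_vecI) (auto simp: scalar_prod_def l_def atLeast0LessThan)
  then have "vec n x = 0\<^sub>v n" using mat_injD[OF assms vec_carrier] by blast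
  moreover have "vec n x $ j = x j" if "j < n" for j using that by simp
  ultimately show False using x(1) by auto
qed

lemma smult_mat_mult_vec:
  assumes A: "(A :: 'k::field mat) \<in> carrier_mat m n" and x: "x \<in> carrier_vec n"
  shows "(c \<cdot>\<^sub>m A) *\<^sub>v x = c \<cdot>\<^sub>v (A *\<^sub>v x)"
proof (rule eq_vecI)
  fix i assume "i < dim_vec (c \<cdot>\<^sub>v (A *\<^sub>v x))"
  then have i: "i < m" using A by simp
  have "row (c \<cdot>\<^sub>m A) i = c \<cdot>\<^sub>v row A i" using A i by (intro eq_vecI) auto
  moreover have "row A i \<in> carrier_vec n" using A i by auto
  ultimately show "((c \<cdot>\<^sub>m A) *\<^sub>v x) $ i = (c \<cdot>\<^sub>v (A *\<^sub>v x)) $ i"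
    using A x i smult_scalar_prod_distrib[of "row A i" n x c] by simp
qed simp

lemma mat_inj_square:
  assumes "mat_inj A" and A: "(A :: 'k::field mat) \<in> carrier_mat n n"
  shows "det A \<noteq> 0" "y \<in> carrier_vec n \<Longrightarrow> \<exists>x\<in>carrier_vec n. A *\<^sub>v x = y"
proof -
  show d: "det A \<noteq> 0"
  proof
    assume "det A = 0"
    then obtain v where "v \<in> carrier_vec n" "v \<noteq> 0\<^sub>v n" "A *\<^sub>v v = 0\<^sub>v n"
      using det_0_iff_vec_prod_zero_field[OF A] by blast
    then show False using mat_injD[OF assms, of v] by blast
  qed
  show "\<exists>x\<in>carrier_vec n. A *\<^sub>v x = y" if y: "y \<in> carrier_vec n"
  proof -
    note adj = adj_mat[OF A]
    let ?x = "(1 / det A) \<cdot>\<^sub>v (adj_mat A *\<^sub>v y)"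
    have c: "adj_mat A *\<^sub>v y \<in> carrier_vec n" using mult_mat_vec_carrier[OF adj(1) y] .
    have "A *\<^sub>v ?x = (1 / det A) \<cdot>\<^sub>v ((A * adj_mat A) *\<^sub>v y)"
      unfolding mult_mat_vec[OF A c] assoc_mult_mat_vec[OF A adj(1) y] ..
    also have "\<dots> = (1 / det A) \<cdot>\<^sub>v (det A \<cdot>\<^sub>v y)"
      unfolding adj(2) smult_mat_mult_vec[OF one_carrier_mat y] one_mult_mat_vec[OF y] ..
    also have "\<dots> = y" using d by (simp add: smult_smult_assoc)
    finally show ?thesis using c by (intro bexI[of _ ?x]) auto
  qed
qed

lemma eigenvector_exists:
  assumes A: "(A :: 'k::alg_closed_field mat) \<in> carrier_mat n n" and n: "n > 0"
  obtains c x where "x \<in> carrier_vec n" "x \<noteq> 0\<^sub>v n" "A *\<^sub>v x = c \<cdot>\<^sub>v x"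
proof -
  have "degree (char_poly A) > 0" using degree_monic_char_poly[OF A] n by simp
  then obtain c where "poly (char_poly A) c = 0" using alg_closed_imp_poly_has_root by blast
  then have "eigenvalue A c" using eigenvalue_root_char_poly[OF A] by simp
  then obtain v where "eigenvector A v c" unfolding eigenvalue_def by blast
  then have "v \<in> carrier_vec n" "v \<noteq> 0\<^sub>v n" "A *\<^sub>v v = c \<cdot>\<^sub>v v"
    unfolding eigenvector_def carrier_matD(1)[OF A] by blast+
  then show ?thesis by (rule that)
qed

text \<open>An injective matrix with image in \<open>S\<close> and the largest possible number of columns is onto \<open>S\<close>: a vector
of \<open>S\<close> outside its image could be appended as a further column.\<close>

lemma subspace_basis:
  assumes S: "lin_subspace n (S :: 'k::field vec set)"
  obtains d B where "B \<in> carrier_mat n d" "mat_inj B" "(\<lambda>x. B *\<^sub>v x) ` carrier_vec d = S"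
proof -
  define good where "good d \<longleftrightarrow> (\<exists>B\<in>carrier_mat n d. mat_inj B \<and> (\<lambda>x. B *\<^sub>v x) ` carrier_vec d \<subseteq> S)" for d
  have z: "x = y" if "x \<in> carrier_vec 0" "y \<in> carrier_vec 0" for x y :: "'k vec" using that by (intro eq_vecI) auto
  have "good 0"
    unfolding good_def
  proof (intro bexI[of _ "0\<^sub>m n 0"] conjI)
    show "mat_inj (0\<^sub>m n 0 :: 'k mat)" unfolding mat_inj_def using z by auto
    show "(\<lambda>x. 0\<^sub>m n 0 *\<^sub>v x) ` carrier_vec 0 \<subseteq> S" using lin_subspaceD(2)[OF S] by (auto simp: zero_mult_mat_vec[where nc=0])
  qed simp
  moreover have bound: "d \<le> n" if "good d" for d using that mat_inj_dim unfolding good_def by blast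
  ultimately obtain d where d: "good d" "\<And>d'. good d' \<Longrightarrow> d' \<le> d"
    using GreatestI_nat[of good 0 n] Greatest_le_nat[of good _ n] by blast
  then obtain B where B: "B \<in> carrier_mat n d" "mat_inj B" "(\<lambda>x. B *\<^sub>v x) ` carrier_vec d \<subseteq> S"
    unfolding good_def by blast
  have "S \<subseteq> (\<lambda>x. B *\<^sub>v x) ` carrier_vec d"
  proof (rule ccontr)
    assume "\<not> ?thesis"
    then obtain y where y: "y \<in> S" "y \<notin> (\<lambda>x. B *\<^sub>v x) ` carrier_vec d" by blast
    have yc: "y \<in> carrier_vec n" using lin_subspaceD(1)[OF S y(1)] .
    define C where "C = mat n (Suc d) (\<lambda>(i, j). if j < d then B $$ (i, j) else y $ i)"
    have C: "C \<in> carrier_mat n (Suc d)" by (simp add: C_def)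
    have Cv: "C *\<^sub>v v = B *\<^sub>v vec d (\<lambda>j. v $ j) + v $ d \<cdot>\<^sub>v y" if v: "v \<in> carrier_vec (Suc d)" for v
      using v B(1) yc by (intro eq_vecI) (auto simp: C_def scalar_prod_def)
    have "mat_inj C"
      unfolding mat_inj_def
    proof (intro ballI impI)
      fix v assume "v \<in> carrier_vec (dim_col C)" "C *\<^sub>v v = 0\<^sub>v (dim_row C)"
      then have v: "v \<in> carrier_vec (Suc d)" "C *\<^sub>v v = 0\<^sub>v n" using C by auto
      let ?w = "vec d (\<lambda>j. v $ j)"
      have w: "?w \<in> carrier_vec d" by simp
      have Bw: "B *\<^sub>v ?w \<in> carrier_vec n" using B(1) w by auto
      have e: "B *\<^sub>v ?w + v $ d \<cdot>\<^sub>v y = 0\<^sub>v n" using Cv[OF v(1)] v(2) by simp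
      have vd: "v $ d = 0"
      proof (rule ccontr)
        assume nz: "v $ d \<noteq> 0"
        have "B *\<^sub>v ((- 1 / v $ d) \<cdot>\<^sub>v ?w) = (- 1 / v $ d) \<cdot>\<^sub>v (B *\<^sub>v ?w)" using mult_mat_vec[OF B(1) w] .
        also have "\<dots> = y"
        proof (rule eq_vecI)
          fix i assume i: "i < dim_vec y"
          have "(B *\<^sub>v ?w + v $ d \<cdot>\<^sub>v y) $ i = 0" using e i yc by simp
          then have "(B *\<^sub>v ?w) $ i = - (v $ d * y $ i)" using i yc Bw by (simp add: eq_neg_iff_add_eq_0)
          then show "((- 1 / v $ d) \<cdot>\<^sub>v (B *\<^sub>v ?w)) $ i = y $ i" using i yc Bw B(1) nz by simp
        qed (use yc B(1) in auto)
        finally have "B *\<^sub>v ((- 1 / v $ d) \<cdot>\<^sub>v ?w) = y" .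
        moreover have "(- 1 / v $ d) \<cdot>\<^sub>v ?w \<in> carrier_vec d" by simp
        ultimately show False using y(2) by blast
      qed
      have "v $ d \<cdot>\<^sub>v y = 0\<^sub>v n" using vd yc by (intro eq_vecI) auto
      then have "B *\<^sub>v ?w = 0\<^sub>v n" using e right_zero_vec[OF Bw] by simp
      then have "?w = 0\<^sub>v d" using mat_injD[OF B(2,1) w] by simp
      moreover have "?w $ j = v $ j" if "j < d" for j using that by simp
      ultimately have "v $ j = 0" if "j < d" for j using that by auto
      then show "v = 0\<^sub>v (dim_col C)" using vd v(1) C by (intro eq_vecI) (auto simp: less_Suc_eq)
    qed
    moreover have "C *\<^sub>v v \<in> S" if "v \<in> carrier_vec (Suc d)" for v
    proof -
      have "B *\<^sub>v vec d (\<lambda>j. v $ j) \<in> S" using B(3) by auto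
      then show ?thesis unfolding Cv[OF that] using lin_subspaceD(3,4)[OF S] y(1) by blast
    qed
    ultimately have "good (Suc d)" unfolding good_def using C by blast
    then show False using d(2) by fastforce
  qed
  then show ?thesis using that B by blast
qed

lemma mat_factor:
  assumes C: "(C :: 'k::field mat) \<in> carrier_mat m d" "mat_inj C" and F: "F \<in> carrier_mat m n"
    and im: "\<And>x. x \<in> carrier_vec n \<Longrightarrow> F *\<^sub>v x \<in> (\<lambda>x. C *\<^sub>v x) ` carrier_vec d"
  obtains G where "G \<in> carrier_mat d n" "C * G = F"
proof -
  define g where "g x = (SOME y. y \<in> carrier_vec d \<and> C *\<^sub>v y = F *\<^sub>v x)" for x
  have g: "g x \<in> carrier_vec d \<and> C *\<^sub>v g x = F *\<^sub>v x" if "x \<in> carrier_vec n" for x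
    unfolding g_def by (rule someI_ex) (use im[OF that] in \<open>auto simp: image_iff\<close>)
  obtain G where G: "G \<in> carrier_mat d n" "\<And>x. x \<in> carrier_vec n \<Longrightarrow> g x = G *\<^sub>v x"
  proof (rule linear_fun_mat[of n g d])
    show "g x \<in> carrier_vec d" if "x \<in> carrier_vec n" for x using g[OF that] by blast
    show "g (x + y) = g x + g y" if xy: "x \<in> carrier_vec n" "y \<in> carrier_vec n" for x y
    proof (rule mat_inj_cancel[OF C(2,1)])
      have c: "g x \<in> carrier_vec d" "g y \<in> carrier_vec d" "g (x + y) \<in> carrier_vec d"
        using g[OF xy(1)] g[OF xy(2)] g[OF add_carrier_vec[OF xy]] by blast+
      show "g (x + y) \<in> carrier_vec d" "g x + g y \<in> carrier_vec d" using c add_carrier_vec by blast+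
      show "C *\<^sub>v g (x + y) = C *\<^sub>v (g x + g y)"
        unfolding mult_add_distrib_mat_vec[OF C(1) c(1,2)]
        using g[OF xy(1)] g[OF xy(2)] g[OF add_carrier_vec[OF xy]] mult_add_distrib_mat_vec[OF F xy] by metis
    qed
    show "g (b \<cdot>\<^sub>v x) = b \<cdot>\<^sub>v g x" if x: "x \<in> carrier_vec n" for x b
    proof (rule mat_inj_cancel[OF C(2,1)])
      have bx: "b \<cdot>\<^sub>v x \<in> carrier_vec n" using x by simp
      have c: "g x \<in> carrier_vec d" "g (b \<cdot>\<^sub>v x) \<in> carrier_vec d"
        using g[OF x] g[OF bx] by blast+
      show "g (b \<cdot>\<^sub>v x) \<in> carrier_vec d" "b \<cdot>\<^sub>v g x \<in> carrier_vec d" using c by auto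
      show "C *\<^sub>v g (b \<cdot>\<^sub>v x) = C *\<^sub>v (b \<cdot>\<^sub>v g x)"
        unfolding mult_mat_vec[OF C(1) c(1)]
        using g[OF x] g[OF bx] mult_mat_vec[OF F x] by metis
    qed
  qed blast
  have "C * G = F"
  proof (rule mat_eq_mult_vecI)
    show "C * G \<in> carrier_mat m n" "F \<in> carrier_mat m n" using C G F by auto
    show "(C * G) *\<^sub>v x = F *\<^sub>v x" if "x \<in> carrier_vec n" for x
      using assoc_mult_mat_vec[OF C(1) G(1) that] G(2)[OF that] g[OF that] by simp
  qed
  then show ?thesis using that G(1) by blast
qed

section \<open>Subrepresentations, kernels and images\<close>

lemma rep_inj_mat_inj:
  assumes "rep_inj U V g" shows "mat_inj (g i)" "g i \<in> carrier_mat (rdim V i) (rdim U i)" "g \<in> rep_hom U V"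
proof -
  show h: "g \<in> rep_hom U V" using assms by (simp add: rep_inj_def)
  show c: "g i \<in> carrier_mat (rdim V i) (rdim U i)" using rep_hom_carrier[OF h] .
  show "mat_inj (g i)" using assms unfolding rep_inj_def mat_inj_def carrier_matD[OF c] by blast
qed

lemma rep_injI:
  assumes "g \<in> rep_hom U V" "\<And>i. mat_inj (g i)" shows "rep_inj U V g"
  unfolding rep_inj_def using assms mat_injD[OF assms(2) rep_hom_carrier[OF assms(1)]] by blast

lemma rep_inj_comp:
  assumes g: "rep_inj U V g" and h: "rep_inj V W h" and U: "is_rep U" and V: "is_rep V" and W: "is_rep W"
  shows "rep_inj U W (\<lambda>i. h i * g i)"
  unfolding rep_inj_def
proof (intro conjI allI ballI impI)
  show "(\<lambda>i. h i * g i) \<in> rep_hom U W"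
    using rep_hom_comp[OF rep_inj_mat_inj(3)[OF g] rep_inj_mat_inj(3)[OF h] U V W] .
  fix i and x assume x: "x \<in> carrier_vec (rdim U i)" and z: "(h i * g i) *\<^sub>v x = 0\<^sub>v (rdim W i)"
  note gc = rep_inj_mat_inj(2)[OF g, of i] and hc = rep_inj_mat_inj(2)[OF h, of i]
  have gx: "g i *\<^sub>v x \<in> carrier_vec (rdim V i)" using mult_mat_vec_carrier[OF gc x] .
  have "h i *\<^sub>v (g i *\<^sub>v x) = 0\<^sub>v (rdim W i)" using z unfolding assoc_mult_mat_vec[OF hc gc x] .
  then have "g i *\<^sub>v x = 0\<^sub>v (rdim V i)" by (rule mat_injD[OF rep_inj_mat_inj(1)[OF h] hc gx])
  then show "x = 0\<^sub>v (rdim U i)" by (rule mat_injD[OF rep_inj_mat_inj(1)[OF g] gc x])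
qed

text \<open>A stable family of subspaces becomes a representation in coordinates after a choice of bases; the arrow
matrices are obtained by factoring through the inclusions.\<close>

lemma subrep_exists:
  fixes V :: "'k::field rep"
  assumes V: "is_rep V" and S: "\<And>i. lin_subspace (rdim V i) (S i)"
    and st: "\<And>a x. x \<in> S (src a) \<Longrightarrow> rmap V a *\<^sub>v x \<in> S (tgt a)"
  obtains U g where "is_rep U" "rep_inj U V g" "\<And>i. (\<lambda>x. g i *\<^sub>v x) ` carrier_vec (rdim U i) = S i"
proof -
  have "\<exists>d B. B \<in> carrier_mat (rdim V i) d \<and> mat_inj B \<and> (\<lambda>x. B *\<^sub>v x) ` carrier_vec d = S i" for i
    using subspace_basis[OF S[of i]] by metis
  then obtain d g where g: "\<And>i. g i \<in> carrier_mat (rdim V i) (d i)" "\<And>i. mat_inj (g i)"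
    "\<And>i. (\<lambda>x. g i *\<^sub>v x) ` carrier_vec (d i) = S i" by metis
  have rV: "rmap V a \<in> carrier_mat (rdim V (tgt a)) (rdim V (src a))" for a using V by (auto simp: is_rep_def)
  have "\<exists>G. G \<in> carrier_mat (d (tgt a)) (d (src a)) \<and> g (tgt a) * G = rmap V a * g (src a)" for a
  proof -
    obtain G where "G \<in> carrier_mat (d (tgt a)) (d (src a))" "g (tgt a) * G = rmap V a * g (src a)"
    proof (rule mat_factor[OF g(1,2) mult_carrier_mat[OF rV g(1)]])
      fix x :: "'k vec" assume x: "x \<in> carrier_vec (d (src a))"
      have "g (src a) *\<^sub>v x \<in> S (src a)" using g(3)[of "src a"] x by blast
      then have "rmap V a *\<^sub>v (g (src a) *\<^sub>v x) \<in> S (tgt a)" by (rule st)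
      then show "(rmap V a * g (src a)) *\<^sub>v x \<in> (\<lambda>x. g (tgt a) *\<^sub>v x) ` carrier_vec (d (tgt a))"
        unfolding g(3) assoc_mult_mat_vec[OF rV g(1) x] .
    qed blast
    then show ?thesis by blast
  qed
  then obtain r where r: "\<And>a. r a \<in> carrier_mat (d (tgt a)) (d (src a))" "\<And>a. g (tgt a) * r a = rmap V a * g (src a)"
    by metis
  let ?U = "\<lparr>rdim = d, rmap = r\<rparr>"
  have "is_rep ?U" using r(1) by (simp add: is_rep_def)
  moreover have "rep_inj ?U V g" by (rule rep_injI) (use g r in \<open>auto simp: rep_hom_def\<close>)
  moreover have "(\<lambda>x. g i *\<^sub>v x) ` carrier_vec (rdim ?U i) = S i" for i using g(3) by simp
  ultimately show ?thesis by (rule that)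
qed

lemma rep_hom_factor:
  fixes V :: "'k::field rep"
  assumes V: "is_rep V" and I: "is_rep I" and W: "is_rep W" and j: "rep_inj I W j" and f: "f \<in> rep_hom V W"
    and im: "\<And>i x. x \<in> carrier_vec (rdim V i) \<Longrightarrow> f i *\<^sub>v x \<in> (\<lambda>x. j i *\<^sub>v x) ` carrier_vec (rdim I i)"
  obtains q where "q \<in> rep_hom V I" "\<And>i. j i * q i = f i"
proof -
  note jc = rep_inj_mat_inj(2)[OF j] and ji = rep_inj_mat_inj(1)[OF j]
  have "\<exists>G. G \<in> carrier_mat (rdim I i) (rdim V i) \<and> j i * G = f i" for i
    using mat_factor[OF jc ji rep_hom_carrier[OF f] im] by metis
  then obtain q where q: "\<And>i. q i \<in> carrier_mat (rdim I i) (rdim V i)" "\<And>i. j i * q i = f i" by metis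
  have r: "rmap V a \<in> carrier_mat (rdim V (tgt a)) (rdim V (src a))"
    "rmap I a \<in> carrier_mat (rdim I (tgt a)) (rdim I (src a))"
    "rmap W a \<in> carrier_mat (rdim W (tgt a)) (rdim W (src a))" for a
    using V I W by (auto simp: is_rep_def)
  have "q (tgt a) * rmap V a = rmap I a * q (src a)" for a
  proof (rule mat_eq_mult_vecI)
    show "q (tgt a) * rmap V a \<in> carrier_mat (rdim I (tgt a)) (rdim V (src a))"
      "rmap I a * q (src a) \<in> carrier_mat (rdim I (tgt a)) (rdim V (src a))"
      using mult_carrier_mat[OF q(1) r(1)] mult_carrier_mat[OF r(2) q(1)] .
    fix x :: "'k vec" assume x: "x \<in> carrier_vec (rdim V (src a))"
    have c: "rmap V a *\<^sub>v x \<in> carrier_vec (rdim V (tgt a))" "q (src a) *\<^sub>v x \<in> carrier_vec (rdim I (src a))"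
      using mult_mat_vec_carrier[OF r(1) x] mult_mat_vec_carrier[OF q(1) x] .
    have jq: "j i *\<^sub>v (q i *\<^sub>v y) = f i *\<^sub>v y" if "y \<in> carrier_vec (rdim V i)" for i y
      using assoc_mult_mat_vec[OF jc q(1) that] unfolding q(2) by simp
    have "j (tgt a) *\<^sub>v (q (tgt a) *\<^sub>v (rmap V a *\<^sub>v x)) = rmap W a *\<^sub>v (f (src a) *\<^sub>v x)"
      unfolding jq[OF c(1)] by (rule rep_hom_arrow[OF f V W x])
    also have "\<dots> = rmap W a *\<^sub>v (j (src a) *\<^sub>v (q (src a) *\<^sub>v x))" unfolding jq[OF x] ..
    also have "\<dots> = j (tgt a) *\<^sub>v (rmap I a *\<^sub>v (q (src a) *\<^sub>v x))"
      by (rule rep_hom_arrow[OF rep_inj_mat_inj(3)[OF j] I W c(2), symmetric])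
    finally have "q (tgt a) *\<^sub>v (rmap V a *\<^sub>v x) = rmap I a *\<^sub>v (q (src a) *\<^sub>v x)"
      by (rule mat_inj_cancel[OF ji jc mult_mat_vec_carrier[OF q(1) c(1)] mult_mat_vec_carrier[OF r(2) c(2)]])
    then show "(q (tgt a) * rmap V a) *\<^sub>v x = (rmap I a * q (src a)) *\<^sub>v x"
      unfolding assoc_mult_mat_vec[OF q(1) r(1) x] assoc_mult_mat_vec[OF r(2) q(1) x] .
  qed
  then have "q \<in> rep_hom V I" using q(1) by (simp add: rep_hom_def)
  then show ?thesis using that q(2) by blast
qed

lemma rep_inj_on:
  assumes "rep_inj U V g"
  shows "inj_on (\<lambda>x. g i *\<^sub>v x) (carrier_vec (rdim U i))"
  using mat_inj_cancel[OF rep_inj_mat_inj(1,2)[OF assms]] by (auto intro!: inj_onI)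

lemma kernel_image_exact:
  fixes V W :: "'k::field rep"
  assumes V: "is_rep V" and W: "is_rep W" and f: "f \<in> rep_hom V W"
  obtains K k I j where "is_rep K" "rep_inj K V k" "is_rep I" "rep_inj I W j" "short_exact K V I"
    "\<forall>i. (\<lambda>x. k i *\<^sub>v x) ` carrier_vec (rdim K i) = {x \<in> carrier_vec (rdim V i). f i *\<^sub>v x = 0\<^sub>v (rdim W i)}"
    "\<forall>i. (\<lambda>x. j i *\<^sub>v x) ` carrier_vec (rdim I i) = (\<lambda>x. f i *\<^sub>v x) ` carrier_vec (rdim V i)"
proof -
  note fc = rep_hom_carrier[OF f]
  have rW: "rmap W a \<in> carrier_mat (rdim W (tgt a)) (rdim W (src a))" for a using W by (auto simp: is_rep_def)
  obtain K k where K: "is_rep K" "rep_inj K V k"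
    "\<And>i. (\<lambda>x. k i *\<^sub>v x) ` carrier_vec (rdim K i) = {x \<in> carrier_vec (rdim V i). f i *\<^sub>v x = 0\<^sub>v (rdim W i)}"
  proof (rule subrep_exists[OF V])
    show "lin_subspace (rdim V i) {x \<in> carrier_vec (rdim V i). f i *\<^sub>v x = 0\<^sub>v (rdim W i)}" for i
      by (rule lin_subspace_kernel[OF fc])
    show "rmap V a *\<^sub>v x \<in> {x \<in> carrier_vec (rdim V (tgt a)). f (tgt a) *\<^sub>v x = 0\<^sub>v (rdim W (tgt a))}"
      if "x \<in> {x \<in> carrier_vec (rdim V (src a)). f (src a) *\<^sub>v x = 0\<^sub>v (rdim W (src a))}" for a x
      using that rmap_carrier_vec[OF V] rep_hom_arrow[OF f V W] mult_mat_vec_0[OF rW] by auto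
  qed blast
  obtain I j where I: "is_rep I" "rep_inj I W j"
    "\<And>i. (\<lambda>x. j i *\<^sub>v x) ` carrier_vec (rdim I i) = (\<lambda>x. f i *\<^sub>v x) ` carrier_vec (rdim V i)"
  proof (rule subrep_exists[OF W])
    show "lin_subspace (rdim W i) ((\<lambda>x. f i *\<^sub>v x) ` carrier_vec (rdim V i))" for i
      by (rule lin_subspace_image[OF fc])
    show "rmap W a *\<^sub>v x \<in> (\<lambda>x. f (tgt a) *\<^sub>v x) ` carrier_vec (rdim V (tgt a))"
      if x: "x \<in> (\<lambda>x. f (src a) *\<^sub>v x) ` carrier_vec (rdim V (src a))" for a x
    proof -
      obtain y where y: "y \<in> carrier_vec (rdim V (src a))" "x = f (src a) *\<^sub>v y" using x by blast
      show ?thesis unfolding y(2) rep_hom_arrow[OF f V W y(1), symmetric] using rmap_carrier_vec[OF V y(1)] by blast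
    qed
  qed blast
  obtain q where q: "q \<in> rep_hom V I" "\<And>i. j i * q i = f i"
    by (rule rep_hom_factor[OF V I(1) W I(2) f]) (use I(3) in auto)
  note jc = rep_inj_mat_inj(2)[OF I(2)] and ji = rep_inj_mat_inj(1)[OF I(2)]
  have jq: "j i *\<^sub>v (q i *\<^sub>v y) = f i *\<^sub>v y" if "y \<in> carrier_vec (rdim V i)" for i y
    using assoc_mult_mat_vec[OF jc rep_hom_carrier[OF q(1)] that] unfolding q(2) by simp
  have qc: "q i *\<^sub>v y \<in> carrier_vec (rdim I i)" if "y \<in> carrier_vec (rdim V i)" for i y
    using mult_mat_vec_carrier[OF rep_hom_carrier[OF q(1)] that] .
  have z: "q i *\<^sub>v y = 0\<^sub>v (rdim I i) \<longleftrightarrow> f i *\<^sub>v y = 0\<^sub>v (rdim W i)" if y: "y \<in> carrier_vec (rdim V i)" for i y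
    using jq[OF y] mat_injD[OF ji jc qc[OF y]] mult_mat_vec_0[OF jc] by metis
  have "short_exact K V I"
    unfolding short_exact_def
  proof (rule bexI[of _ k], rule bexI[of _ q], intro allI conjI)
    fix i
    show "inj_on (\<lambda>x. k i *\<^sub>v x) (carrier_vec (rdim K i))" by (rule rep_inj_on[OF K(2)])
    show "(\<lambda>x. k i *\<^sub>v x) ` carrier_vec (rdim K i) = {y \<in> carrier_vec (rdim V i). q i *\<^sub>v y = 0\<^sub>v (rdim I i)}"
      unfolding K(3) using z by blast
    show "(\<lambda>y. q i *\<^sub>v y) ` carrier_vec (rdim V i) = carrier_vec (rdim I i)"
    proof
      show "(\<lambda>y. q i *\<^sub>v y) ` carrier_vec (rdim V i) \<subseteq> carrier_vec (rdim I i)" using qc by blast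
      show "carrier_vec (rdim I i) \<subseteq> (\<lambda>y. q i *\<^sub>v y) ` carrier_vec (rdim V i)"
      proof
        fix x :: "'k vec" assume x: "x \<in> carrier_vec (rdim I i)"
        then have "j i *\<^sub>v x \<in> (\<lambda>x. f i *\<^sub>v x) ` carrier_vec (rdim V i)" unfolding I(3)[symmetric] by (rule imageI)
        then obtain y where y: "y \<in> carrier_vec (rdim V i)" "j i *\<^sub>v x = f i *\<^sub>v y" by blast
        have "x = q i *\<^sub>v y" by (rule mat_inj_cancel[OF ji jc x qc[OF y(1)]]) (simp only: y(2) jq[OF y(1)])
        then show "x \<in> (\<lambda>y. q i *\<^sub>v y) ` carrier_vec (rdim V i)" using y(1) by blast
      qed
    qed
  qed (use K(2) q(1) in \<open>auto simp: rep_inj_def\<close>)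
  then show ?thesis using that[OF K(1,2) I(1,2)] K(3) I(3) by blast
qed

section \<open>The charge is linear in the dimension vector\<close>

lemma is_rep_simple: "is_rep (simple_rep v)"
  by (auto simp: is_rep_def simple_rep_def Let_def)

lemma arrow_acyclic: "src a \<noteq> tgt a"
  by (cases a) auto

lemma empty_mat_eq:
  assumes "A \<in> carrier_mat m n" "B \<in> carrier_mat m n" "m = 0 \<or> n = 0" shows "A = B"
proof (rule eq_matI)
  fix i j assume "i < dim_row B" "j < dim_col B"
  then show "A $$ (i, j) = B $$ (i, j)" using assms by auto
qed (use assms in auto)

text \<open>When nothing nonzero maps into the space at \<open>v\<close>, the first coordinate of that space is a morphism onto
the simple representation at \<open>v\<close>, whose kernel is given by the remaining coordinates.\<close>

lemma split_simple_top:
  fixes V :: "'k::field rep"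
  assumes V: "is_rep V" and d: "rdim V v = Suc d" and top: "\<And>a. tgt a = v \<Longrightarrow> rdim V (src a) = 0"
  obtains K where "is_rep K" "rdim K = (rdim V)(v := d)" "short_exact K V (simple_rep v)"
proof -
  have rV: "rmap V a \<in> carrier_mat (rdim V (tgt a)) (rdim V (src a))" for a using V by (auto simp: is_rep_def)
  let ?S = "simple_rep v :: 'k rep"
  define D where "D = (rdim V)(v := d)"
  define E where "E = (\<lambda>i::vertex. if i = v then 1 else (0::nat))"
  have Sd: "rdim ?S i = E i" for i by (simp add: simple_rep_def Let_def E_def)
  have Sr: "rmap ?S a = 0\<^sub>m (E (tgt a)) (E (src a))" for a by (simp add: simple_rep_def Let_def E_def)
  define k where "k = (\<lambda>i. if i = v then mat (Suc d) d (\<lambda>(r, c). if r = Suc c then 1 else 0) else (1\<^sub>m (rdim V i) :: 'k mat))"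
  define p where "p = (\<lambda>i. mat (E i) (rdim V i) (\<lambda>(r, c). if c = 0 then 1 else (0::'k)))"
  define r where "r = (\<lambda>a. if src a = v then rmap V a * k v else if tgt a = v then 0\<^sub>m d (rdim V (src a)) else rmap V a)"
  let ?K = "\<lparr>rdim = D, rmap = r\<rparr>"
  have kc: "k i \<in> carrier_mat (rdim V i) (D i)" for i by (auto simp: k_def D_def d)
  have kcv: "k v \<in> carrier_mat (rdim V v) d" using kc[of v] by (simp add: D_def)
  have pc: "p i \<in> carrier_mat (E i) (rdim V i)" for i by (simp add: p_def)
  have st: "src a = v \<Longrightarrow> tgt a \<noteq> v" for a using arrow_acyclic[of a] by auto
  have rc: "r a \<in> carrier_mat (D (tgt a)) (D (src a))" for a
    using rV[of a] mult_carrier_mat[OF rV[of a]] kcv st[of a] by (auto simp: r_def D_def)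
  have K: "is_rep ?K" using rc by (simp add: is_rep_def)
  have kh: "k (tgt a) * r a = rmap V a * k (src a)" for a
  proof (cases "src a = v")
    case True
    then have "k (tgt a) * r a = 1\<^sub>m (rdim V (tgt a)) * (rmap V a * k v)" using st[of a] by (simp add: k_def r_def)
    also have "\<dots> = rmap V a * k v" using mult_carrier_mat[OF rV[of a]] kcv True by (intro left_mult_one_mat) auto
    finally show ?thesis using True by simp
  next
    case False
    note F = False
    show ?thesis
    proof (cases "tgt a = v")
      case True
      have c: "k (tgt a) * r a \<in> carrier_mat (rdim V (tgt a)) (D (src a))" "rmap V a * k (src a) \<in> carrier_mat (rdim V (tgt a)) (D (src a))"
        using mult_carrier_mat[OF kc rc] mult_carrier_mat[OF rV kc] .
      have "D (src a) = 0" using top[OF True] F by (simp add: D_def)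
      then show ?thesis using empty_mat_eq[OF c] by blast
    next
      case False
      then show ?thesis using F rV[of a] by (simp add: k_def r_def)
    qed
  qed
  have ph: "p (tgt a) * rmap V a = rmap ?S a * p (src a)" for a
  proof (cases "tgt a = v")
    case True
    have c: "p (tgt a) * rmap V a \<in> carrier_mat (E (tgt a)) (rdim V (src a))" "rmap ?S a * p (src a) \<in> carrier_mat (E (tgt a)) (rdim V (src a))"
      unfolding Sr using mult_carrier_mat[OF pc rV] mult_carrier_mat[OF zero_carrier_mat pc] .
    show ?thesis using empty_mat_eq[OF c] top[OF True] by blast
  next
    case False
    have c: "p (tgt a) * rmap V a \<in> carrier_mat (E (tgt a)) (rdim V (src a))" "rmap ?S a * p (src a) \<in> carrier_mat (E (tgt a)) (rdim V (src a))"
      unfolding Sr using mult_carrier_mat[OF pc rV] mult_carrier_mat[OF zero_carrier_mat pc] .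
    have "E (tgt a) = 0" using False by (simp add: E_def)
    then show ?thesis using empty_mat_eq[OF c] by blast
  qed
  have kv: "k v *\<^sub>v x = vec (Suc d) (\<lambda>i. case i of 0 \<Rightarrow> 0 | Suc i \<Rightarrow> x $ i)" if x: "x \<in> carrier_vec d" for x
  proof (rule eq_vecI)
    fix i assume "i < dim_vec (vec (Suc d) (\<lambda>i. case i of 0 \<Rightarrow> 0 | Suc i \<Rightarrow> x $ i))"
    then have i: "i < Suc d" by simp
    have "(k v *\<^sub>v x) $ i = (\<Sum>c = 0..<d. (if i = Suc c then 1 else 0) * x $ c)"
      using i x by (simp add: k_def scalar_prod_def)
    also have "\<dots> = (case i of 0 \<Rightarrow> 0 | Suc i \<Rightarrow> x $ i)"
    proof (cases i)
      case (Suc i')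
      have "(\<Sum>c = 0..<d. (if i = Suc c then 1 else 0) * x $ c) = (\<Sum>c = 0..<d. if c = i' then x $ c else 0)"
        by (intro sum.cong) (auto simp: Suc)
      then show ?thesis using i Suc by simp
    qed simp
    finally show "(k v *\<^sub>v x) $ i = vec (Suc d) (\<lambda>i. case i of 0 \<Rightarrow> 0 | Suc i \<Rightarrow> x $ i) $ i" using i by simp
  qed (simp add: k_def)
  have pv: "p v *\<^sub>v y = vec 1 (\<lambda>_. y $ 0)" if y: "y \<in> carrier_vec (Suc d)" for y
  proof (rule eq_vecI)
    fix i assume i: "i < dim_vec (vec 1 (\<lambda>_. y $ 0))"
    have "(p v *\<^sub>v y) $ i = (\<Sum>c = 0..<Suc d. (if c = 0 then 1 else 0) * y $ c)"
      using i y by (simp add: p_def E_def d scalar_prod_def del: sum.op_ivl_Suc)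
    also have "\<dots> = (\<Sum>c = 0..<Suc d. if c = 0 then y $ c else 0)" by (intro sum.cong) auto
    also have "\<dots> = y $ 0" by (simp del: sum.op_ivl_Suc)
    finally show "(p v *\<^sub>v y) $ i = vec 1 (\<lambda>_. y $ 0) $ i" using i by simp
  qed (simp add: p_def E_def)
  have "short_exact ?K V ?S"
    unfolding short_exact_def
  proof (rule bexI[of _ k], rule bexI[of _ p], intro allI)
    show "k \<in> rep_hom ?K V" using kc kh by (simp add: rep_hom_def)
    show "p \<in> rep_hom V ?S" using pc ph by (simp add: rep_hom_def Sd)
    fix i
    show "inj_on (\<lambda>x. k i *\<^sub>v x) (carrier_vec (rdim ?K i)) \<and>
     (\<lambda>x. k i *\<^sub>v x) ` carrier_vec (rdim ?K i) = {y \<in> carrier_vec (rdim V i). p i *\<^sub>v y = 0\<^sub>v (rdim ?S i)} \<and>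
     (\<lambda>y. p i *\<^sub>v y) ` carrier_vec (rdim V i) = carrier_vec (rdim ?S i)"
    proof (cases "i = v")
      case False
      have e: "x = y" if "x \<in> carrier_vec 0" "y \<in> carrier_vec 0" for x y :: "'k vec" using that by (intro eq_vecI) auto
      have k1: "k i *\<^sub>v x = x" if "x \<in> carrier_vec (rdim V i)" for x using that False by (simp add: k_def)
      have E0: "E i = 0" using False by (simp add: E_def)
      have p0: "p i *\<^sub>v y \<in> carrier_vec 0" if "y \<in> carrier_vec (rdim V i)" for y
        using mult_mat_vec_carrier[OF pc that] unfolding E0 .
      have "(\<lambda>x. k i *\<^sub>v x) ` carrier_vec (rdim V i) = carrier_vec (rdim V i)" using k1 by (auto intro!: rev_image_eqI)
      moreover have "inj_on (\<lambda>x. k i *\<^sub>v x) (carrier_vec (rdim V i))" using k1 by (intro inj_onI) auto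
      moreover have "{y \<in> carrier_vec (rdim V i). p i *\<^sub>v y = 0\<^sub>v 0} = carrier_vec (rdim V i)" using e p0 by auto
      moreover have "(\<lambda>y. p i *\<^sub>v y) ` carrier_vec (rdim V i) = carrier_vec 0"
      proof
        show "(\<lambda>y. p i *\<^sub>v y) ` carrier_vec (rdim V i) \<subseteq> carrier_vec 0" using p0 by auto
        show "carrier_vec 0 \<subseteq> (\<lambda>y. p i *\<^sub>v y) ` carrier_vec (rdim V i)"
          using e p0[OF zero_carrier_vec] zero_carrier_vec[of "rdim V i"] by blast
      qed
      ultimately show ?thesis using False by (simp add: D_def Sd E0)
    next
      case True
      have inj: "inj_on (\<lambda>x. k v *\<^sub>v x) (carrier_vec d)"
      proof (rule inj_onI)
        fix x y :: "'k vec" assume xy: "x \<in> carrier_vec d" "y \<in> carrier_vec d" "k v *\<^sub>v x = k v *\<^sub>v y"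
        show "x = y"
        proof (rule eq_vecI)
          fix i assume i: "i < dim_vec y"
          have "(k v *\<^sub>v x) $ Suc i = (k v *\<^sub>v y) $ Suc i" using xy(3) by simp
          then show "x $ i = y $ i" unfolding kv[OF xy(1)] kv[OF xy(2)] using i xy(2) by simp
        qed (use xy in auto)
      qed
      have ker: "(\<lambda>x. k v *\<^sub>v x) ` carrier_vec d = {y \<in> carrier_vec (Suc d). p v *\<^sub>v y = 0\<^sub>v 1}"
      proof
        show "(\<lambda>x. k v *\<^sub>v x) ` carrier_vec d \<subseteq> {y \<in> carrier_vec (Suc d). p v *\<^sub>v y = 0\<^sub>v 1}"
        proof
          fix y assume "y \<in> (\<lambda>x. k v *\<^sub>v x) ` carrier_vec d"
          then obtain x where x: "x \<in> carrier_vec d" "y = k v *\<^sub>v x" by blast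
          have y: "y = vec (Suc d) (\<lambda>i. case i of 0 \<Rightarrow> 0 | Suc i \<Rightarrow> x $ i)" using x kv by simp
          then have yc: "y \<in> carrier_vec (Suc d)" by simp
          have "p v *\<^sub>v y = 0\<^sub>v 1" unfolding pv[OF yc] by (intro eq_vecI) (auto simp: y)
          then show "y \<in> {y \<in> carrier_vec (Suc d). p v *\<^sub>v y = 0\<^sub>v 1}" using yc by simp
        qed
        show "{y \<in> carrier_vec (Suc d). p v *\<^sub>v y = 0\<^sub>v 1} \<subseteq> (\<lambda>x. k v *\<^sub>v x) ` carrier_vec d"
        proof
          fix y assume "y \<in> {y \<in> carrier_vec (Suc d). p v *\<^sub>v y = 0\<^sub>v 1}"
          then have y: "y \<in> carrier_vec (Suc d)" "p v *\<^sub>v y = 0\<^sub>v 1" by auto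
          have "(p v *\<^sub>v y) $ 0 = 0" using y(2) by simp
          then have y0: "y $ 0 = 0" unfolding pv[OF y(1)] by simp
          have c: "vec d (\<lambda>i. y $ Suc i) \<in> carrier_vec d" by simp
          have "k v *\<^sub>v vec d (\<lambda>i. y $ Suc i) = y"
            unfolding kv[OF c] using y(1) y0 by (intro eq_vecI) (auto split: nat.split)
          then show "y \<in> (\<lambda>x. k v *\<^sub>v x) ` carrier_vec d" using c by (metis imageI)
        qed
      qed
      have sur: "(\<lambda>y. p v *\<^sub>v y) ` carrier_vec (Suc d) = carrier_vec 1"
      proof
        show "(\<lambda>y. p v *\<^sub>v y) ` carrier_vec (Suc d) \<subseteq> carrier_vec 1" using pv by auto
        show "carrier_vec 1 \<subseteq> (\<lambda>y. p v *\<^sub>v y) ` carrier_vec (Suc d)"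
        proof
          fix x :: "'k vec" assume x: "x \<in> carrier_vec 1"
          have c: "vec (Suc d) (\<lambda>_. x $ 0) \<in> carrier_vec (Suc d)" by simp
          have "p v *\<^sub>v vec (Suc d) (\<lambda>_. x $ 0) = x" unfolding pv[OF c] using x by (intro eq_vecI) auto
          then show "x \<in> (\<lambda>y. p v *\<^sub>v y) ` carrier_vec (Suc d)" using c by (metis imageI)
        qed
      qed
      show ?thesis using True inj ker sur by (simp add: D_def Sd E_def d)
    qed
  qed
  then show ?thesis using that[of ?K] K D_def by simp
qed

lemma Z_short_exact:
  assumes "Z \<in> hom K_rep complex_add_group" "is_rep U" "is_rep V" "is_rep W" "short_exact U V W"
  shows "Z (rep_class V) = Z (rep_class U) + Z (rep_class W)"
  using K_class_additive[OF assms(1), of U V W] assms by simp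

lemma vertex_UNIV: "UNIV = {Vb, Vmid, Ve}"
  using vertex.exhaust by auto

text \<open>Simple quotients are split off one at a time, at a vertex whose predecessors carry the zero space;
such a vertex exists in every nonzero representation since the quiver has no oriented cycle.\<close>

lemma Z_dims:
  fixes Z :: "('k::field rep \<Rightarrow>\<^sub>0 int) set \<Rightarrow> complex"
  assumes Z: "Z \<in> hom K_rep complex_add_group" and V: "is_rep V"
  shows "Z (rep_class V) = of_nat (rdim V Vb) * Z (rep_class (simple_rep Vb)) +
    of_nat (rdim V Vmid) * Z (rep_class (simple_rep Vmid)) + of_nat (rdim V Ve) * Z (rep_class (simple_rep Ve))"
  using V
proof (induction "rdim V Vb + rdim V Vmid + rdim V Ve" arbitrary: V)
  case 0
  then have d: "rdim V i = 0" for i by (cases i) auto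
  have r: "rmap V a \<in> carrier_mat 0 0" for a using 0(2) d by (auto simp: is_rep_def)
  have e: "x = y" if "x \<in> carrier_vec 0" "y \<in> carrier_vec 0" for x y :: "'k vec" using that by (intro eq_vecI) auto
  have "short_exact V V V"
    unfolding short_exact_def
  proof (intro bexI[of _ "\<lambda>i. 1\<^sub>m (rdim V i)"] allI)
    fix i
    show "inj_on (\<lambda>x :: 'k vec. 1\<^sub>m (rdim V i) *\<^sub>v x) (carrier_vec (rdim V i)) \<and>
      (\<lambda>x :: 'k vec. 1\<^sub>m (rdim V i) *\<^sub>v x) ` carrier_vec (rdim V i) =
       {y \<in> carrier_vec (rdim V i). 1\<^sub>m (rdim V i) *\<^sub>v y = 0\<^sub>v (rdim V i)} \<and>
      (\<lambda>y :: 'k vec. 1\<^sub>m (rdim V i) *\<^sub>v y) ` carrier_vec (rdim V i) = carrier_vec (rdim V i)"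
    proof -
      have o: "1\<^sub>m 0 *\<^sub>v x = x" if "x \<in> carrier_vec 0" for x :: "'k vec" using that by (rule one_mult_mat_vec)
      have A: "(\<lambda>x. 1\<^sub>m 0 *\<^sub>v x) ` carrier_vec 0 = (carrier_vec 0 :: 'k vec set)"
        using image_cong[OF refl o, of "carrier_vec 0" "\<lambda>x. x"] unfolding image_ident by blast
      have B: "{y \<in> carrier_vec 0. 1\<^sub>m 0 *\<^sub>v y = 0\<^sub>v 0} = (carrier_vec 0 :: 'k vec set)"
        using e o by (metis (mono_tags, lifting) Collect_cong Collect_mem_eq zero_carrier_vec)
      have C: "inj_on (\<lambda>x. 1\<^sub>m 0 *\<^sub>v x) (carrier_vec 0 :: 'k vec set)" using e by (rule inj_onI)
      show ?thesis unfolding d A B by (intro conjI C refl)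
    qed
  qed (rule rep_hom_id[OF 0(2)])+
  from Z_short_exact[OF Z 0(2) 0(2) 0(2) this] show ?case by (simp add: d)
next
  case (Suc n)
  have "\<exists>v. rdim V v \<noteq> 0 \<and> (\<forall>a. tgt a = v \<longrightarrow> rdim V (src a) = 0)"
  proof (cases "rdim V Vb = 0")
    case False
    have "tgt a \<noteq> Vb" for a by (cases a) auto
    then show ?thesis using False by blast
  next
    case True
    note b = True
    show ?thesis
    proof (cases "rdim V Vmid = 0")
      case False
      have "src a = Vb" if "tgt a = Vmid" for a using that by (cases a) auto
      then show ?thesis using False b by metis
    next
      case True
      have "src a = Vb \<or> src a = Vmid" if "tgt a = Ve" for a using that by (cases a) auto
      then show ?thesis using Suc(2) b True by (metis add_0 Zero_not_Suc)
    qed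
  qed
  then obtain v where v: "rdim V v \<noteq> 0" "\<And>a. tgt a = v \<Longrightarrow> rdim V (src a) = 0" by blast
  obtain d where d: "rdim V v = Suc d" using v(1) not0_implies_Suc by blast
  obtain K where K: "is_rep K" "rdim K = (rdim V)(v := d)" "short_exact K V (simple_rep v)"
    using split_simple_top[OF Suc(3) d v(2)] by blast
  have "n = rdim K Vb + rdim K Vmid + rdim K Ve" using Suc(2) d unfolding K(2) by (cases v) auto
  from Suc(1)[OF this K(1)] show ?case
    unfolding Z_short_exact[OF Z K(1) Suc(3) is_rep_simple K(3)]
    using d unfolding K(2) by (cases v) (simp_all add: algebra_simps)
qed

section \<open>Semistable representations with scalar endomorphisms\<close>

text \<open>The determinant of two vectors of the plane, which compares arguments bilinearly.\<close>

definition cross :: "complex \<Rightarrow> complex \<Rightarrow> real" where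
  "cross z w = Re z * Im w - Im z * Re w"

lemma cross_bilinear:
  "cross (z + z') w = cross z w + cross z' w" "cross z (w + w') = cross z w + cross z w'"
  "cross (of_nat n * z) w = of_nat n * cross z w"
  "cross z z = 0" "cross w z = - cross z w"
  by (simp_all add: cross_def algebra_simps)

lemma Arg_less_iff_cross:
  assumes "Im z > 0" "Im w > 0"
  shows "Arg z < Arg w \<longleftrightarrow> cross z w > 0"
proof -
  have z: "Re z = cmod z * cos (Arg z)" "Im z = cmod z * sin (Arg z)" for z
    using Re_rcis[of "cmod z" "Arg z"] Im_rcis[of "cmod z" "Arg z"] unfolding rcis_cmod_Arg .
  have c: "cross z w = (cmod z * cmod w) * sin (Arg w - Arg z)"
    by (simp only: cross_def z[of z] z[of w] sin_diff) (simp only: algebra_simps)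
  have b: "0 < Arg z" "Arg z < pi" "0 < Arg w" "Arg w < pi" using Arg_lt_pi assms by blast+
  have pos: "p > 0 \<Longrightarrow> 0 < p * s \<longleftrightarrow> 0 < s" for p s :: real by (simp add: zero_less_mult_iff)
  have "cmod z > 0" "cmod w > 0" using assms by auto
  then have "cmod z * cmod w > 0" by (rule mult_pos_pos)
  then have "cross z w > 0 \<longleftrightarrow> sin (Arg w - Arg z) > 0" unfolding c by (rule pos)
  also have "\<dots> \<longleftrightarrow> Arg z < Arg w"
  proof
    assume "Arg z < Arg w"
    then show "sin (Arg w - Arg z) > 0" using b by (intro sin_gt_zero) auto
  next
    assume s: "sin (Arg w - Arg z) > 0"
    show "Arg z < Arg w"
    proof (rule ccontr)
      assume "\<not> Arg z < Arg w"
      then have "sin (Arg z - Arg w) \<ge> 0" using b by (intro sin_ge_zero) auto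
      then show False using s by (metis minus_diff_eq neg_0_le_iff_le not_le sin_minus)
    qed
  qed
  finally show ?thesis by simp
qed

text \<open>The argument of a sum lies strictly between those of the summands unless all agree.\<close>

lemma Arg_add_eq:
  assumes "Im z > 0" "Im w > 0" "Arg z \<le> Arg (z + w)" "Arg w \<le> Arg (z + w)"
  shows "Arg z = Arg (z + w)"
proof -
  have v: "Im (z + w) > 0" using assms by simp
  have "\<not> cross (z + w) z > 0" "\<not> cross (z + w) w > 0"
    using Arg_less_iff_cross[OF v assms(1)] Arg_less_iff_cross[OF v assms(2)] assms(3,4) by auto
  then have "cross z w = 0" using cross_bilinear(5)[of w z] by (simp add: cross_bilinear(1,4))
  then have "\<not> cross z (z + w) > 0" by (simp add: cross_bilinear(2,4))
  then show ?thesis using Arg_less_iff_cross[OF assms(1) v] assms(3) by auto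
qed

locale alg_closed_charge = charge Z
  for Z :: "('k::alg_closed_field rep \<Rightarrow>\<^sub>0 int) set \<Rightarrow> complex"
begin

text \<open>Semistability in the sense of King, tested on subrepresentations.\<close>

definition slope_semistable :: "real \<Rightarrow> 'k rep \<Rightarrow> bool" where
  "slope_semistable \<theta> V \<longleftrightarrow> is_rep V \<and> nonzero_rep V \<and> Arg (Z (rep_class V)) = \<theta> \<and>
     (\<forall>U g. is_rep U \<longrightarrow> nonzero_rep U \<longrightarrow> rep_inj U V g \<longrightarrow> Arg (Z (rep_class U)) \<le> \<theta>)"

text \<open>Take \<open>V\<close> of least total dimension. Given an endomorphism \<open>f\<close>, let \<open>h = f - c\<close> for an eigenvalue \<open>c\<close> of
\<open>f\<close> at some vertex. If \<open>h\<close> were nonzero, then kernel and image would both be nonzero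
subrepresentations whose charges add up to that of \<open>V\<close>; both would have argument \<open>\<theta>\<close>, and the
kernel would be a smaller semistable representation.\<close>

lemma semistable_brick:
  assumes "slope_semistable \<theta> V0"
  obtains V where "slope_semistable \<theta> V" "\<And>f. f \<in> rep_hom V V \<Longrightarrow> \<exists>c. \<forall>i. f i = c \<cdot>\<^sub>m 1\<^sub>m (rdim V i)"
proof -
  define td where "td V = rdim V Vb + rdim V Vmid + rdim V Ve" for V :: "'k rep"
  obtain V where V: "slope_semistable \<theta> V" "\<And>U. slope_semistable \<theta> U \<Longrightarrow> td V \<le> td U"
    using ex_has_least_nat[of "slope_semistable \<theta>" V0 td] assms by blast
  have rep: "is_rep V" and nz: "nonzero_rep V" and Arg: "Arg (Z (rep_class V)) = \<theta>"
    and sub: "\<And>U g. is_rep U \<Longrightarrow> nonzero_rep U \<Longrightarrow> rep_inj U V g \<Longrightarrow> Arg (Z (rep_class U)) \<le> \<theta>"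
    using V(1) unfolding slope_semistable_def by blast+
  have rV: "rmap V a \<in> carrier_mat (rdim V (tgt a)) (rdim V (src a))" for a using rep by (auto simp: is_rep_def)
  have "\<exists>c. \<forall>i. f i = c \<cdot>\<^sub>m 1\<^sub>m (rdim V i)" if f: "f \<in> rep_hom V V" for f
  proof -
    obtain i0 where i0: "rdim V i0 > 0" using nz by (auto simp: nonzero_rep_def)
    note fc = rep_hom_carrier[OF f]
    obtain c x where x: "x \<in> carrier_vec (rdim V i0)" "x \<noteq> 0\<^sub>v (rdim V i0)" "f i0 *\<^sub>v x = c \<cdot>\<^sub>v x"
      using eigenvector_exists[OF fc i0] by blast
    define h where "h i = f i - c \<cdot>\<^sub>m 1\<^sub>m (rdim V i)" for i
    have hc: "h i \<in> carrier_mat (rdim V i) (rdim V i)" for i unfolding h_def by (rule minus_carrier_mat) simp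
    have hv: "h i *\<^sub>v y = f i *\<^sub>v y - c \<cdot>\<^sub>v y" if y: "y \<in> carrier_vec (rdim V i)" for i y
    proof -
      have c1: "c \<cdot>\<^sub>m 1\<^sub>m (rdim V i) \<in> carrier_mat (rdim V i) (rdim V i)" by simp
      show ?thesis unfolding h_def minus_mult_distrib_mat_vec[OF fc c1 y] smult_mat_mult_vec[OF one_carrier_mat y]
          one_mult_mat_vec[OF y] ..
    qed
    have h: "h \<in> rep_hom V V"
    proof -
      have "h (tgt a) * rmap V a = rmap V a * h (src a)" for a
      proof (rule mat_eq_mult_vecI)
        show "h (tgt a) * rmap V a \<in> carrier_mat (rdim V (tgt a)) (rdim V (src a))"
          "rmap V a * h (src a) \<in> carrier_mat (rdim V (tgt a)) (rdim V (src a))"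
          using mult_carrier_mat[OF hc rV] mult_carrier_mat[OF rV hc] .
        fix y :: "'k vec" assume y: "y \<in> carrier_vec (rdim V (src a))"
        have fy: "f (src a) *\<^sub>v y \<in> carrier_vec (rdim V (src a))" "c \<cdot>\<^sub>v y \<in> carrier_vec (rdim V (src a))"
          using mult_mat_vec_carrier[OF fc y] y by auto
        show "(h (tgt a) * rmap V a) *\<^sub>v y = (rmap V a * h (src a)) *\<^sub>v y"
          unfolding assoc_mult_mat_vec[OF hc rV y] assoc_mult_mat_vec[OF rV hc y] hv[OF y]
            hv[OF mult_mat_vec_carrier[OF rV y]] mult_minus_distrib_mat_vec[OF rV fy] rep_hom_arrow[OF f rep rep y]
            mult_mat_vec[OF rV y] ..
      qed
      then show ?thesis using hc by (simp add: rep_hom_def)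
    qed
    obtain K k I j where K: "is_rep K" "rep_inj K V k" and I: "is_rep I" "rep_inj I V j" and ex: "short_exact K V I"
      and ker': "\<forall>i. (\<lambda>x. k i *\<^sub>v x) ` carrier_vec (rdim K i) = {x \<in> carrier_vec (rdim V i). h i *\<^sub>v x = 0\<^sub>v (rdim V i)}"
      and im': "\<forall>i. (\<lambda>x. j i *\<^sub>v x) ` carrier_vec (rdim I i) = (\<lambda>x. h i *\<^sub>v x) ` carrier_vec (rdim V i)"
      using kernel_image_exact[OF rep rep h] .
    note ker = ker'[rule_format] and im = im'[rule_format]
    note kc = rep_inj_mat_inj(2)[OF K(2)] and ki = rep_inj_mat_inj(1)[OF K(2)] and jc = rep_inj_mat_inj(2)[OF I(2)]
    have nzI: "rdim U i \<noteq> 0" if gy: "y \<in> (\<lambda>x. g *\<^sub>v x) ` carrier_vec (rdim U i)" "y \<noteq> 0\<^sub>v m" "g \<in> carrier_mat m (rdim U i)"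
      for U :: "'k rep" and g :: "'k mat" and i y m
    proof
      assume z: "rdim U i = 0"
      obtain w where w: "w \<in> carrier_vec 0" "y = g *\<^sub>v w" using gy(1) unfolding z by blast
      have w0: "w = 0\<^sub>v 0" using w(1) by (intro eq_vecI) auto
      have "y = 0\<^sub>v m" unfolding w(2) w0 by (rule mult_mat_vec_0) (use gy(3) in \<open>simp only: z\<close>)
      then show False using gy(2) by contradiction
    qed
    have "h i0 *\<^sub>v x = 0\<^sub>v (rdim V i0)"
      unfolding hv[OF x(1)] x(3) by (rule vec_diff_identities(1)[OF _ x(1) x(1) x(1)]) (simp add: x(1))
    then have "x \<in> (\<lambda>x. k i0 *\<^sub>v x) ` carrier_vec (rdim K i0)" unfolding ker using x(1) by simp
    then have "rdim K i0 \<noteq> 0" by (rule nzI[OF _ x(2) kc])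
    then have Knz: "nonzero_rep K" unfolding nonzero_rep_def by (rule exI)
    have hz: "h i *\<^sub>v y = 0\<^sub>v (rdim V i)" if y: "y \<in> carrier_vec (rdim V i)" for i y
    proof (rule ccontr)
      assume ne: "h i *\<^sub>v y \<noteq> 0\<^sub>v (rdim V i)"
      have "h i *\<^sub>v y \<in> (\<lambda>x. j i *\<^sub>v x) ` carrier_vec (rdim I i)" unfolding im using y by blast
      then have "rdim I i \<noteq> 0" by (rule nzI[OF _ ne jc])
      then have Inz: "nonzero_rep I" unfolding nonzero_rep_def by (rule exI)
      have dne: "rdim K i \<noteq> rdim V i"
      proof
        assume e: "rdim K i = rdim V i"
        obtain w where "w \<in> carrier_vec (rdim K i)" "k i *\<^sub>v w = y"
          using mat_inj_square(2)[OF ki[of i] _ y] kc[of i] unfolding e by blast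
        then have "y \<in> (\<lambda>x. k i *\<^sub>v x) ` carrier_vec (rdim K i)" by blast
        then show False using ne unfolding ker by blast
      qed
      have le: "rdim K i \<le> rdim V i" for i by (rule mat_inj_dim[OF ki kc])
      have lt: "rdim K i < rdim V i" by (rule le_neq_implies_less[OF le dne])
      have "td K < td V" unfolding td_def using lt le[of Vb] le[of Vmid] le[of Ve] by (cases i) simp_all
      moreover have "slope_semistable \<theta> K"
      proof -
        have s: "Z (rep_class V) = Z (rep_class K) + Z (rep_class I)" by (rule Z_short_exact[OF Z_hom K(1) rep I(1) ex])
        have "Arg (Z (rep_class K)) = \<theta>"
          using Arg_add_eq[OF Im_pos[OF K(1) Knz] Im_pos[OF I(1) Inz]] sub[OF K(1) Knz K(2)] sub[OF I(1) Inz I(2)] Arg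
          unfolding s by simp
        moreover have "Arg (Z (rep_class U)) \<le> \<theta>" if "is_rep U" "nonzero_rep U" "rep_inj U K g" for U g
          using sub[OF that(1,2) rep_inj_comp[OF that(3) K(2) that(1) K(1) rep]] .
        ultimately show ?thesis unfolding slope_semistable_def using K(1) Knz by blast
      qed
      ultimately show False using V(2)[of K] by simp
    qed
    have "f i = c \<cdot>\<^sub>m 1\<^sub>m (rdim V i)" for i
    proof (rule mat_eq_mult_vecI[OF fc])
      fix y :: "'k vec" assume y: "y \<in> carrier_vec (rdim V i)"
      have fy: "f i *\<^sub>v y \<in> carrier_vec (rdim V i)" "c \<cdot>\<^sub>v y \<in> carrier_vec (rdim V i)"
        using mult_mat_vec_carrier[OF fc y] y by auto
      have "(f i *\<^sub>v y - c \<cdot>\<^sub>v y) + c \<cdot>\<^sub>v y = f i *\<^sub>v y" by (rule vec_diff_identities(6)[OF fy fy])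
      moreover have "f i *\<^sub>v y - c \<cdot>\<^sub>v y = 0\<^sub>v (rdim V i)" using hz[OF y] unfolding hv[OF y] .
      moreover have "0\<^sub>v (rdim V i) + c \<cdot>\<^sub>v y = c \<cdot>\<^sub>v y" using fy(2) by (rule left_zero_vec)
      ultimately have "f i *\<^sub>v y = c \<cdot>\<^sub>v y" by metis
      then show "f i *\<^sub>v y = (c \<cdot>\<^sub>m 1\<^sub>m (rdim V i)) *\<^sub>v y"
        unfolding smult_mat_mult_vec[OF one_carrier_mat y] one_mult_mat_vec[OF y] .
    qed simp
    then show ?thesis by blast
  qed
  then show ?thesis using that V(1) by blast
qed

end

lemma arrow_UNIV: "UNIV = {Abe, Abm, Ame}"
  using arrow.exhaust by auto

text \<open>The unknowns are the entries of an endomorphism and the equations say that it commutes with the arrows.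
One further equation, that the first entry at a nonzero vertex vanishes, excludes the nonzero
scalars; if unknowns still outnumbered equations, there would be a nonscalar endomorphism.\<close>

lemma brick_dims:
  fixes V :: "'k::field rep"
  assumes V: "is_rep V" and nz: "nonzero_rep V"
    and br: "\<And>f. f \<in> rep_hom V V \<Longrightarrow> \<exists>c. \<forall>i. f i = c \<cdot>\<^sub>m 1\<^sub>m (rdim V i)"
  shows "rdim V Vb * rdim V Vb + rdim V Vmid * rdim V Vmid + rdim V Ve * rdim V Ve
    \<le> rdim V Ve * rdim V Vb + rdim V Vmid * rdim V Vb + rdim V Ve * rdim V Vmid + 1"
proof (rule ccontr)
  assume no: "\<not> ?thesis"
  let ?d = "rdim V"
  obtain i0 where i0: "?d i0 > 0" using nz by (auto simp: nonzero_rep_def)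
  have rV: "rmap V a \<in> carrier_mat (rdim V (tgt a)) (rdim V (src a))" for a using V by (auto simp: is_rep_def)
  define A where "A = (SIGMA i:(UNIV :: vertex set). {..<?d i} \<times> {..<?d i})"
  define B where "B = insert (Inr ()) (Inl ` (SIGMA a:(UNIV :: arrow set). {..<?d (tgt a)} \<times> {..<?d (src a)}))"
  have finv: "finite (UNIV :: vertex set)" "finite (UNIV :: arrow set)"
    unfolding vertex_UNIV arrow_UNIV by simp_all
  have cA: "card A = ?d Vb * ?d Vb + ?d Vmid * ?d Vmid + ?d Ve * ?d Ve"
    unfolding A_def by (subst card_SigmaI) (use finv in \<open>simp_all add: vertex_UNIV\<close>)
  have finB: "finite (SIGMA a:(UNIV :: arrow set). {..<?d (tgt a)} \<times> {..<?d (src a)})" using finv by simp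
  have "card (SIGMA a:(UNIV :: arrow set). {..<?d (tgt a)} \<times> {..<?d (src a)}) =
      ?d Ve * ?d Vb + ?d Vmid * ?d Vb + ?d Ve * ?d Vmid"
    by (subst card_SigmaI) (use finv in \<open>simp_all add: arrow_UNIV\<close>)
  then have cB: "card B = ?d Ve * ?d Vb + ?d Vmid * ?d Vb + ?d Ve * ?d Vmid + 1"
    unfolding B_def using finB by (subst card_insert_disjoint) (auto simp: card_image)
  define l where "l \<beta> x = (case \<beta> of Inl (a, r, s) \<Rightarrow>
      (\<Sum>j<?d (tgt a). x (tgt a, r, j) * rmap V a $$ (j, s)) - (\<Sum>j<?d (src a). rmap V a $$ (r, j) * x (src a, j, s))
      | Inr _ \<Rightarrow> x (i0, 0, 0))" for \<beta> :: "arrow \<times> nat \<times> nat + unit" and x :: "vertex \<times> nat \<times> nat \<Rightarrow> 'k"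
  have "\<exists>x. (\<exists>\<alpha>\<in>A. x \<alpha> \<noteq> 0) \<and> (\<forall>\<beta>\<in>B. l \<beta> x = 0)"
  proof (rule linear_system_nontrivial)
    show "finite A" "finite B" using finv finB by (simp_all add: A_def B_def)
    show "card B < card A" using no unfolding cA cB by simp
    show "l \<beta> (\<lambda>\<alpha>. x \<alpha> + y \<alpha>) = l \<beta> x + l \<beta> y" for \<beta> x y
      by (simp add: l_def distrib_left distrib_right sum.distrib split: sum.split prod.split)
    show "l \<beta> (\<lambda>\<alpha>. c * x \<alpha>) = c * l \<beta> x" for \<beta> c x
      by (simp add: l_def right_diff_distrib sum_distrib_left mult.left_commute mult.assoc split: sum.split prod.split)
  qed
  then obtain x where x: "\<exists>\<alpha>\<in>A. x \<alpha> \<noteq> 0" "\<And>\<beta>. \<beta> \<in> B \<Longrightarrow> l \<beta> x = 0" by blast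
  define f where "f i = mat (?d i) (?d i) (\<lambda>(r, s). x (i, r, s))" for i
  have "f (tgt a) * rmap V a = rmap V a * f (src a)" for a
  proof (rule eq_matI)
    fix r s assume "r < dim_row (rmap V a * f (src a))" "s < dim_col (rmap V a * f (src a))"
    then have rs: "r < ?d (tgt a)" "s < ?d (src a)" using rV[of a] by (auto simp: f_def)
    then have "l (Inl (a, r, s)) x = 0" by (intro x(2)) (auto simp: B_def)
    then have "(\<Sum>j<?d (tgt a). x (tgt a, r, j) * rmap V a $$ (j, s)) = (\<Sum>j<?d (src a). rmap V a $$ (r, j) * x (src a, j, s))"
      by (simp add: l_def)
    then show "(f (tgt a) * rmap V a) $$ (r, s) = (rmap V a * f (src a)) $$ (r, s)"
      using rs rV[of a] by (simp add: f_def scalar_prod_def atLeast0LessThan)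
  qed (use rV[of a] in \<open>auto simp: f_def\<close>)
  then have "f \<in> rep_hom V V" by (simp add: rep_hom_def f_def)
  then obtain c where c: "\<And>i. f i = c \<cdot>\<^sub>m 1\<^sub>m (?d i)" using br by blast
  have "l (Inr ()) x = 0" by (rule x(2)) (simp add: B_def)
  then have "f i0 $$ (0, 0) = 0" using i0 by (simp add: l_def f_def)
  then have c0: "c = 0" unfolding c using i0 by simp
  obtain i r s where irs: "r < ?d i" "s < ?d i" "x (i, r, s) \<noteq> 0" using x(1) by (auto simp: A_def)
  have "f i $$ (r, s) = 0" unfolding c c0 using irs by simp
  then show False using irs by (simp add: f_def)
qed

section \<open>A family of preprojective representations\<close>

text \<open>The preprojective Kronecker representation of dimension $(n, n+1)$ whose two arrows are the inclusions
of $k^n$ into $k^{n+1}$ as the first and as the last coordinates, with the first arrow factored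
through an identity map at the middle vertex.\<close>

definition preproj :: "nat \<Rightarrow> 'k::field rep" where
  "preproj n = \<lparr>rdim = (\<lambda>i. case i of Vb \<Rightarrow> n | Vmid \<Rightarrow> n | Ve \<Rightarrow> Suc n),
     rmap = (\<lambda>a. case a of Abm \<Rightarrow> 1\<^sub>m n
        | Ame \<Rightarrow> mat (Suc n) n (\<lambda>(i, j). if i = j then 1 else 0)
        | Abe \<Rightarrow> mat (Suc n) n (\<lambda>(i, j). if i = Suc j then 1 else 0))\<rparr>"

lemma preproj_dims: "rdim (preproj n) Vb = n" "rdim (preproj n) Vmid = n" "rdim (preproj n) Ve = Suc n"
  by (simp_all add: preproj_def)

lemma is_rep_preproj: "is_rep (preproj n)"
  unfolding is_rep_def
proof
  fix a show "rmap (preproj n) a \<in> carrier_mat (rdim (preproj n) (tgt a)) (rdim (preproj n) (src a))"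
    by (cases a) (simp_all add: preproj_def)
qed

lemma preproj_maps:
  fixes y :: "'k::field vec"
  assumes y: "y \<in> carrier_vec n"
  shows "rmap (preproj n) Abm *\<^sub>v y = y"
    "i \<le> n \<Longrightarrow> (rmap (preproj n) Ame *\<^sub>v y) $ i = (if i < n then y $ i else 0)"
    "i \<le> n \<Longrightarrow> (rmap (preproj n) Abe *\<^sub>v y) $ i = (case i of 0 \<Rightarrow> 0 | Suc j \<Rightarrow> y $ j)"
proof -
  show "rmap (preproj n) Abm *\<^sub>v y = y" using y by (simp add: preproj_def)
  assume i: "i \<le> n"
  have "(rmap (preproj n) Ame *\<^sub>v y) $ i = (\<Sum>j = 0..<n. (if i = j then 1 else 0) * y $ j)"
    using i y by (simp add: preproj_def scalar_prod_def)
  also have "\<dots> = (\<Sum>j = 0..<n. if j = i then y $ j else 0)" by (intro sum.cong) auto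
  finally show "(rmap (preproj n) Ame *\<^sub>v y) $ i = (if i < n then y $ i else 0)" by simp
  have "(rmap (preproj n) Abe *\<^sub>v y) $ i = (\<Sum>j = 0..<n. (if i = Suc j then 1 else 0) * y $ j)"
    using i y by (simp add: preproj_def scalar_prod_def)
  also have "\<dots> = (case i of 0 \<Rightarrow> 0 | Suc j \<Rightarrow> y $ j)"
  proof (cases i)
    case (Suc i')
    have "(\<Sum>j = 0..<n. (if i = Suc j then 1 else 0) * y $ j) = (\<Sum>j = 0..<n. if j = i' then y $ j else 0)"
      by (intro sum.cong) (auto simp: Suc)
    then show ?thesis using i Suc by simp
  qed simp
  finally show "(rmap (preproj n) Abe *\<^sub>v y) $ i = (case i of 0 \<Rightarrow> 0 | Suc j \<Rightarrow> y $ j)" .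
qed

text \<open>Comparing entries of \<open>(0, y)\<close> and \<open>c (y, 0)\<close> from the last one downwards gives \<open>y = 0\<close>.\<close>

lemma preproj_pencil_injective:
  fixes y :: "'k::field vec"
  assumes y: "y \<in> carrier_vec n" and e: "rmap (preproj n) Abe *\<^sub>v y = c \<cdot>\<^sub>v (rmap (preproj n) Ame *\<^sub>v y)"
  shows "y = 0\<^sub>v n"
proof -
  have ent: "(case i of 0 \<Rightarrow> 0 | Suc j \<Rightarrow> y $ j) = c * (if i < n then y $ i else 0)" if i: "i \<le> n" for i
  proof -
    have d: "dim_vec (rmap (preproj n) Ame *\<^sub>v y) = Suc n" by (simp add: preproj_def)
    have "(rmap (preproj n) Abe *\<^sub>v y) $ i = c * (rmap (preproj n) Ame *\<^sub>v y) $ i" unfolding e using i d by simp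
    then show ?thesis unfolding preproj_maps(2,3)[OF y i] .
  qed
  have "y $ j = 0" if "j < n" for j
    using that
  proof (induction "n - j" arbitrary: j)
    case 0
    then show ?case by simp
  next
    case (Suc m)
    have 1: "y $ j = c * (if Suc j < n then y $ Suc j else 0)" using ent[of "Suc j"] Suc(3) by simp
    show ?case
    proof (cases "Suc j < n")
      case True
      then have "y $ Suc j = 0" using Suc by (intro Suc(1)) auto
      then show ?thesis using 1 by simp
    next
      case False
      then show ?thesis using 1 by simp
    qed
  qed
  then show ?thesis using y by (intro eq_vecI) auto
qed

text \<open>The maps along the path from \<open>Vb\<close> to \<open>Ve\<close> are injective on \<open>preproj n\<close>, hence on \<open>U\<close>. If the spaces of
\<open>U\<close> at \<open>Vb\<close> and \<open>Ve\<close> had the same nonzero dimension, this composite \<open>T\<close> would be invertible, and an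
eigenvector of $T^{-1}$ composed with the direct arrow would contradict
\<open>preproj_pencil_injective\<close>.\<close>

lemma preproj_sub_dims:
  fixes U :: "'k::alg_closed_field rep"
  assumes U: "is_rep U" and g: "rep_inj U (preproj n) g"
  shows "rdim U Vb \<le> rdim U Vmid" "rdim U Vmid \<le> rdim U Ve" "rdim U Vb > 0 \<Longrightarrow> rdim U Vb < rdim U Ve"
proof -
  note gc = rep_inj_mat_inj(2)[OF g] and gi = rep_inj_mat_inj(1)[OF g] and gh = rep_inj_mat_inj(3)[OF g]
  let ?b = "rdim U Vb" and ?m = "rdim U Vmid" and ?e = "rdim U Ve"
  have rU: "rmap U Abm \<in> carrier_mat ?m ?b" "rmap U Ame \<in> carrier_mat ?e ?m" "rmap U Abe \<in> carrier_mat ?e ?b"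
    using U[unfolded is_rep_def, THEN spec, of Abm] U[unfolded is_rep_def, THEN spec, of Ame]
      U[unfolded is_rep_def, THEN spec, of Abe] by simp_all
  have gb: "g Vb *\<^sub>v x \<in> carrier_vec n" if "x \<in> carrier_vec ?b" for x
    using mult_mat_vec_carrier[OF gc that] by (simp add: preproj_dims)
  have gm: "g Vmid *\<^sub>v x \<in> carrier_vec n" if "x \<in> carrier_vec ?m" for x
    using mult_mat_vec_carrier[OF gc that] by (simp add: preproj_dims)
  have bm: "g Vmid *\<^sub>v (rmap U Abm *\<^sub>v x) = g Vb *\<^sub>v x" if "x \<in> carrier_vec ?b" for x
    using rep_hom_arrow[OF gh U is_rep_preproj, of x Abm] that preproj_maps(1)[OF gb[OF that]] by simp
  have me: "g Ve *\<^sub>v (rmap U Ame *\<^sub>v x) = rmap (preproj n) Ame *\<^sub>v (g Vmid *\<^sub>v x)" if "x \<in> carrier_vec ?m" for x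
    using rep_hom_arrow[OF gh U is_rep_preproj, of x Ame] that by simp
  have be: "g Ve *\<^sub>v (rmap U Abe *\<^sub>v x) = rmap (preproj n) Abe *\<^sub>v (g Vb *\<^sub>v x)" if "x \<in> carrier_vec ?b" for x
    using rep_hom_arrow[OF gh U is_rep_preproj, of x Abe] that by simp
  have i1: "mat_inj (rmap U Abm)"
    unfolding mat_inj_def carrier_matD[OF rU(1)]
  proof (intro ballI impI)
    fix x assume x: "x \<in> carrier_vec ?b" "rmap U Abm *\<^sub>v x = 0\<^sub>v ?m"
    have "g Vb *\<^sub>v x = 0\<^sub>v (rdim (preproj n) Vb)"
      using bm[OF x(1)] mult_mat_vec_0[OF gc[of Vmid]] unfolding x(2) by (simp add: preproj_dims)
    then show "x = 0\<^sub>v ?b" by (rule mat_injD[OF gi gc x(1)])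
  qed

  have i2: "mat_inj (rmap U Ame)"
    unfolding mat_inj_def carrier_matD[OF rU(2)]
  proof (intro ballI impI)
    fix x assume x: "x \<in> carrier_vec ?m" "rmap U Ame *\<^sub>v x = 0\<^sub>v ?e"
    have z: "rmap (preproj n) Ame *\<^sub>v (g Vmid *\<^sub>v x) = 0\<^sub>v (Suc n)"
      using me[OF x(1)] mult_mat_vec_0[OF gc[of Ve]] unfolding x(2) by (simp add: preproj_dims)
    have "(g Vmid *\<^sub>v x) $ j = 0" if "j < n" for j
      using preproj_maps(2)[OF gm[OF x(1)], of j] that unfolding z by simp
    then have "g Vmid *\<^sub>v x = 0\<^sub>v n" using carrier_vecD[OF gm[OF x(1)]] by (intro eq_vecI) auto
    then have "g Vmid *\<^sub>v x = 0\<^sub>v (rdim (preproj n) Vmid)" by (simp add: preproj_dims)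
    then show "x = 0\<^sub>v ?m" by (rule mat_injD[OF gi gc x(1)])
  qed
  show 1: "?b \<le> ?m" by (rule mat_inj_dim[OF i1 rU(1)])
  show 2: "?m \<le> ?e" by (rule mat_inj_dim[OF i2 rU(2)])
  show "?b < ?e" if b: "?b > 0"
  proof (rule ccontr)
    assume "\<not> ?b < ?e"
    then have eq: "?m = ?b" "?e = ?b" using 1 2 by simp_all
    define T where "T = rmap U Ame * rmap U Abm"
    have T: "T \<in> carrier_mat ?b ?b" unfolding T_def using mult_carrier_mat[OF rU(2,1)] eq by simp
    have N: "rmap U Abe \<in> carrier_mat ?b ?b" using rU(3) eq by simp
    have Tv: "T *\<^sub>v x = rmap U Ame *\<^sub>v (rmap U Abm *\<^sub>v x)" if "x \<in> carrier_vec ?b" for x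
      unfolding T_def by (rule assoc_mult_mat_vec[OF rU(2,1) that])
    have Ti: "mat_inj T"
      unfolding mat_inj_def carrier_matD[OF T]
    proof (intro ballI impI)
      fix x assume x: "x \<in> carrier_vec ?b" "T *\<^sub>v x = 0\<^sub>v ?b"
      have "rmap U Ame *\<^sub>v (rmap U Abm *\<^sub>v x) = 0\<^sub>v ?e" using x(2) unfolding Tv[OF x(1)] eq .
      then have "rmap U Abm *\<^sub>v x = 0\<^sub>v ?m" by (rule mat_injD[OF i2 rU(2) mult_mat_vec_carrier[OF rU(1) x(1)]])
      then show "x = 0\<^sub>v ?b" by (rule mat_injD[OF i1 rU(1) x(1)])
    qed
    have "(rmap U Abe *\<^sub>v x) \<in> (\<lambda>x. T *\<^sub>v x) ` carrier_vec ?b" if "x \<in> carrier_vec ?b" for x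
      using mat_inj_square(2)[OF Ti T mult_mat_vec_carrier[OF N that]] by (metis imageI)
    \<comment> \<open>\<open>G\<close> is $T^{-1}$ composed with the direct arrow.\<close>
    then obtain G where G: "G \<in> carrier_mat ?b ?b" "T * G = rmap U Abe" using mat_factor[OF T Ti N] by metis
    obtain c x where x: "x \<in> carrier_vec ?b" "x \<noteq> 0\<^sub>v ?b" "G *\<^sub>v x = c \<cdot>\<^sub>v x"
      using eigenvector_exists[OF G(1) b] by blast
    have Nx: "rmap U Abe *\<^sub>v x = c \<cdot>\<^sub>v (T *\<^sub>v x)"
      unfolding G(2)[symmetric] assoc_mult_mat_vec[OF T G(1) x(1)] x(3) by (rule mult_mat_vec[OF T x(1)])
    have gT: "g Ve *\<^sub>v (T *\<^sub>v x) = rmap (preproj n) Ame *\<^sub>v (g Vb *\<^sub>v x)"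
      unfolding Tv[OF x(1)] me[OF mult_mat_vec_carrier[OF rU(1) x(1)]] bm[OF x(1)] ..
    have Tc: "T *\<^sub>v x \<in> carrier_vec ?e" using mult_mat_vec_carrier[OF T x(1)] eq by simp
    have "rmap (preproj n) Abe *\<^sub>v (g Vb *\<^sub>v x) = c \<cdot>\<^sub>v (rmap (preproj n) Ame *\<^sub>v (g Vb *\<^sub>v x))"
      unfolding be[OF x(1), symmetric] Nx gT[symmetric] by (rule mult_mat_vec[OF gc Tc])
    then have "g Vb *\<^sub>v x = 0\<^sub>v n" by (rule preproj_pencil_injective[OF gb[OF x(1)]])
    then have "g Vb *\<^sub>v x = 0\<^sub>v (rdim (preproj n) Vb)" by (simp add: preproj_dims)
    then show False using mat_injD[OF gi gc x(1)] x(2) by blast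
  qed
qed

section \<open>Limit points of the phases\<close>

text \<open>After subtraction of the minimum one of the three differences vanishes, which leaves
\<open>p\<^sup>2 + q\<^sup>2 \<le> pq + 1\<close> for the other two.\<close>

lemma root_dims:
  fixes b m e :: nat
  assumes "b * b + m * m + e * e \<le> e * b + m * b + e * m + 1"
  obtains n x y z where "b = n + x" "m = n + y" "e = n + z" "x \<le> 1" "y \<le> 1" "z \<le> 1"
proof -
  define n where "n = min b (min m e)"
  have le: "n \<le> b" "n \<le> m" "n \<le> e" by (auto simp: n_def)
  obtain x y z where xyz: "b = n + x" "m = n + y" "e = n + z"
    using le_Suc_ex[OF le(1)] le_Suc_ex[OF le(2)] le_Suc_ex[OF le(3)] by blast
  have "n = b \<or> n = m \<or> n = e" by (auto simp: n_def min_def)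
  then have "x = 0 \<or> y = 0 \<or> z = 0" using xyz by auto
  moreover have q: "x * x + y * y + z * z \<le> z * x + y * x + z * y + 1"
    using assms unfolding xyz by (simp add: algebra_simps)
  have two: "p \<le> 1 \<and> q \<le> 1" if pq: "p * p + q * q \<le> p * q + 1" for p q :: nat
  proof -
    have le: "p \<le> 1 \<and> q \<le> 1" if h: "p * p + q * q \<le> p * q + 1" "p \<le> q" for p q :: nat
    proof -
      have "p * q \<le> q * q" using h(2) by simp
      then have sq: "p * p \<le> 1" using h(1) by linarith
      have p: "p \<le> 1"
      proof (rule ccontr)
        assume "\<not> p \<le> 1"
        then have "2 * 2 \<le> p * p" by (intro mult_le_mono) auto
        then show False using sq by simp
      qed
      have "q \<le> 1"
      proof (rule ccontr)
        assume q: "\<not> q \<le> 1"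
        then have "2 * q \<le> q * q" by (intro mult_le_mono) auto
        moreover have "p * q \<le> 1 * q" using p by (intro mult_le_mono) auto
        ultimately show False using q h(1) by linarith
      qed
      then show ?thesis using p by simp
    qed
    show ?thesis
    proof (cases "p \<le> q")
      case True
      then show ?thesis using le[OF pq] by simp
    next
      case False
      have "q * q + p * p \<le> q * p + 1" using pq by (simp only: add.commute mult.commute)
      then show ?thesis using le[of q p] False by simp
    qed
  qed
  ultimately have "x \<le> 1 \<and> y \<le> 1 \<and> z \<le> 1"
    using two[of x y] two[of y z] two[of x z] q by (elim disjE) (simp_all add: mult.commute)
  then show ?thesis using that xyz by blast
qed

lemma sgn_shift_tendsto:
  fixes \<delta> w :: complex
  assumes "\<delta> \<noteq> 0"
  shows "(\<lambda>n. sgn (of_nat n * \<delta> + w)) \<longlonglongrightarrow> sgn \<delta>"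
proof -
  have "(\<lambda>n. (1 / real n) *\<^sub>R w) \<longlonglongrightarrow> 0 *\<^sub>R w"
    by (intro tendsto_scaleR lim_1_over_n tendsto_const)
  then have "(\<lambda>n. \<delta> + (1 / real n) *\<^sub>R w) \<longlonglongrightarrow> \<delta> + 0 *\<^sub>R w" by (intro tendsto_add tendsto_const)
  then have "(\<lambda>n. sgn (\<delta> + (1 / real n) *\<^sub>R w)) \<longlonglongrightarrow> sgn \<delta>" using assms by (intro tendsto_sgn) simp_all
  moreover have "eventually (\<lambda>n. sgn (\<delta> + (1 / real n) *\<^sub>R w) = sgn (of_nat n * \<delta> + w)) sequentially"
  proof (rule eventually_sequentiallyI)
    fix n :: nat assume n: "1 \<le> n"
    have "of_nat n * \<delta> + w = real n *\<^sub>R (\<delta> + (1 / real n) *\<^sub>R w)"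
    proof -
      have "real n *\<^sub>R (\<delta> + (1 / real n) *\<^sub>R w) = real n *\<^sub>R \<delta> + w"
        unfolding scaleR_add_right scaleR_scaleR using n by simp
      then show ?thesis by (simp add: scaleR_conv_of_real)
    qed
    then show "sgn (\<delta> + (1 / real n) *\<^sub>R w) = sgn (of_nat n * \<delta> + w)" using n by (simp add: sgn_scaleR)
  qed
  ultimately show ?thesis by (rule Lim_transform_eventually)
qed

lemma islimpt_finite_UN:
  assumes "finite I" "x islimpt (\<Union>i\<in>I. A i)"
  shows "\<exists>i\<in>I. x islimpt A i"
  using assms
  by (induction I rule: finite_induct) (auto simp: islimpt_Un islimpt_EMPTY)

lemma islimpt_uminus:
  fixes S :: "complex set"
  assumes "x islimpt S" "uminus ` S \<subseteq> S" shows "- x islimpt S"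
proof -
  obtain f where f: "\<And>n. f n \<in> S - {x}" "f \<longlonglongrightarrow> x" using assms(1) unfolding islimpt_sequential by blast
  have "(\<lambda>n. - f n) \<longlonglongrightarrow> - x" by (rule tendsto_minus[OF f(2)])
  moreover have "- f n \<in> S - {- x}" for n using f(1)[of n] assms(2) by auto
  ultimately show ?thesis unfolding islimpt_sequential by (intro exI[of _ "\<lambda>n. - f n"]) simp
qed

lemma cis_pi_shift: "cis (pi * (\<phi> + 1)) = - cis (pi * \<phi>)"
proof -
  have "cis (pi * (\<phi> + 1)) = cis (pi * \<phi>) * cis pi"
    by (simp only: distrib_left mult_1_right cis_mult)
  then show ?thesis by simp
qed

text \<open>Since the arguments of \<open>m\<close> and \<open>e\<close> are below that of \<open>\<delta>\<close>, adding copies of \<open>m\<close> and \<open>e\<close> to a multiple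
of \<open>\<delta>\<close> lowers the argument; this bounds the subrepresentations of \<open>preproj n\<close>.\<close>

locale affine_stability = stability_on_heart P W Z + alg_closed_charge Z
  for P :: "real \<Rightarrow> 'k::alg_closed_field cpx set" and W :: "('k cpx \<Rightarrow>\<^sub>0 int) set \<Rightarrow> complex"
    and Z :: "('k rep \<Rightarrow>\<^sub>0 int) set \<Rightarrow> complex" +
  fixes a m e \<delta> :: complex
  assumes a: "a = Z (rep_class (simple_rep Vb))" and m: "m = Z (rep_class (simple_rep Vmid))"
    and e: "e = Z (rep_class (simple_rep Ve))" and \<delta>: "\<delta> = m + a + e"
    and simple_pos: "Im a > 0" "Im m > 0" "Im e > 0"
    and Arg_m: "Arg m < Arg \<delta>" and Arg_e: "Arg e < Arg \<delta>"
begin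

lemma Z_rep: "is_rep V \<Longrightarrow>
    Z (rep_class V) = of_nat (rdim V Vb) * a + of_nat (rdim V Vmid) * m + of_nat (rdim V Ve) * e"
  unfolding a m e by (rule Z_dims[OF Z_hom])

abbreviation S :: "complex set" where "S \<equiv> stable_phases (P, W)"

lemma S_iff: "z \<in> S \<longleftrightarrow> (\<exists>\<phi> X. X \<in> P \<phi> \<and> \<not> acyclic_cpx X \<and> z = cis (pi * \<phi>))"
proof -
  have "exp (\<i> * of_real pi * of_real \<phi>) = cis (pi * \<phi>)" for \<phi> by (simp add: cis_conv_exp mult.assoc)
  moreover have "X \<in> P \<phi> \<and> Db_nonzero X \<longleftrightarrow> X \<in> P \<phi> \<and> \<not> acyclic_cpx X" for X \<phi>
    using Db_nonzero_iff[OF P_cpx[of X \<phi>]] by blast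
  ultimately show ?thesis unfolding stable_phases_def by auto
qed

lemma Im_\<delta>: "Im \<delta> > 0" using simple_pos by (simp add: \<delta>)

lemma \<delta>_nonzero: "\<delta> \<noteq> 0"
proof
  assume "\<delta> = 0"
  then have "Im \<delta> = 0" by simp
  then show False using Im_\<delta> by simp
qed

lemma Im_sgn_\<delta>: "Im (sgn \<delta>) > 0"
  unfolding Im_sgn using Im_\<delta> \<delta>_nonzero by (intro divide_pos_pos) simp_all

lemma S_uminus: "z \<in> S \<Longrightarrow> - z \<in> S"
proof -
  assume "z \<in> S"
  then obtain \<phi> X where X: "X \<in> P \<phi>" "\<not> acyclic_cpx X" "z = cis (pi * \<phi>)" unfolding S_iff by blast
  have "shift X \<in> P (\<phi> + 1)" unfolding P_shift using X(1) by (rule imageI)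
  moreover have "\<not> acyclic_cpx (shift X)" using X(2) shift_acyclic[OF P_cpx[OF X(1)]] by simp
  moreover have "- z = cis (pi * (\<phi> + 1))" unfolding X(3) cis_pi_shift ..
  ultimately show "- z \<in> S" unfolding S_iff by blast
qed

lemma shift_to_heart:
  assumes "X \<in> P \<phi>" "\<not> acyclic_cpx X"
  shows "\<exists>\<psi> Y. Y \<in> P \<psi> \<and> \<not> acyclic_cpx Y \<and> 0 < \<psi> \<and> \<psi> \<le> 1 \<and> (cis (pi * \<phi>) = cis (pi * \<psi>) \<or> cis (pi * \<phi>) = - cis (pi * \<psi>))"
proof -
  note c1 = cis_pi_shift
  have up: "\<exists>Y. Y \<in> P (\<phi> + real k) \<and> \<not> acyclic_cpx Y \<and> (cis (pi * \<phi>) = cis (pi * (\<phi> + real k)) \<or> cis (pi * \<phi>) = - cis (pi * (\<phi> + real k)))"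
    if "X \<in> P \<phi>" "\<not> acyclic_cpx X" for X \<phi> k
  proof (induction k)
    case 0
    then show ?case using that by auto
  next
    case (Suc k)
    then obtain Y where Y: "Y \<in> P (\<phi> + real k)" "\<not> acyclic_cpx Y"
      "cis (pi * \<phi>) = cis (pi * (\<phi> + real k)) \<or> cis (pi * \<phi>) = - cis (pi * (\<phi> + real k))" by blast
    have s: "\<phi> + real (Suc k) = (\<phi> + real k) + 1" by simp
    have "shift Y \<in> P (\<phi> + real (Suc k))" unfolding s P_shift using Y(1) by (rule imageI)
    moreover have "\<not> acyclic_cpx (shift Y)" using Y(2) shift_acyclic[OF P_cpx[OF Y(1)]] by simp
    ultimately show ?case using Y(3) unfolding s c1 minus_minus by blast
  qed
  have down: "\<exists>Y. Y \<in> P (\<phi> - real k) \<and> \<not> acyclic_cpx Y \<and> (cis (pi * \<phi>) = cis (pi * (\<phi> - real k)) \<or> cis (pi * \<phi>) = - cis (pi * (\<phi> - real k)))"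
    if "X \<in> P \<phi>" "\<not> acyclic_cpx X" for X \<phi> k
  proof (induction k)
    case 0
    then show ?case using that by auto
  next
    case (Suc k)
    then obtain Y where Y: "Y \<in> P (\<phi> - real k)" "\<not> acyclic_cpx Y"
      "cis (pi * \<phi>) = cis (pi * (\<phi> - real k)) \<or> cis (pi * \<phi>) = - cis (pi * (\<phi> - real k))" by blast
    have s: "\<phi> - real k = (\<phi> - real (Suc k)) + 1" by simp
    obtain Y' where Y': "Y' \<in> P (\<phi> - real (Suc k))" "Y = shift Y'" using Y(1) unfolding s P_shift by blast
    have "\<not> acyclic_cpx Y'" using Y(2) shift_acyclic[OF P_cpx[OF Y'(1)]] Y'(2) by simp
    then show ?case using Y(3) Y'(1) unfolding s c1 minus_minus by blast
  qed
  define c where "c = \<lceil>\<phi>\<rceil> - 1"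
  have c: "0 < \<phi> - of_int c" "\<phi> - of_int c \<le> 1" unfolding c_def by linarith+
  show ?thesis
  proof (cases "c \<ge> 0")
    case True
    then have "0 < \<phi> - real (nat c)" "\<phi> - real (nat c) \<le> 1" using c by simp_all
    then show ?thesis using down[OF assms, of "nat c"] by blast
  next
    case False
    then have "0 < \<phi> + real (nat (- c))" "\<phi> + real (nat (- c)) \<le> 1" using c by simp_all
    then show ?thesis using up[OF assms, of "nat (- c)"] by blast
  qed
qed

text \<open>A phase of the heart is attained by a slope-semistable representation with scalar endomorphisms, whose
dimension vector is \<open>n(1,1,1) + (x,y,z)\<close>.\<close>

lemma heart_phase:
  assumes Y: "Y \<in> P \<psi>" "\<not> acyclic_cpx Y" "0 < \<psi>" "\<psi> \<le> 1"
  shows "\<exists>n x y z. x \<in> {0, 1} \<and> y \<in> {0, 1} \<and> z \<in> {0, 1} \<and> cis (pi * \<psi>) = sgn (of_nat n * \<delta> + (x * a + y * m + z * e))"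
proof -
  obtain V where V: "is_rep V" "Db_isomorphic Y (stalk V)" "stalk V \<in> P \<psi>" using heart_rep[OF Y(1,3,4)] .
  have "\<not> acyclic_cpx (stalk V)"
    using Y(2) Db_isomorphic_coh_zero[OF P_cpx[OF Y(1)] is_cpx_stalk[OF V(1)] V(2)] by (simp add: acyclic_cpx_def)
  then have nz: "nonzero_rep V" using acyclic_stalk[OF V(1)] by simp
  have "slope_semistable (pi * \<psi>) V"
    unfolding slope_semistable_def
    by (intro conjI allI impI V(1) nz stalk_phase[OF V(1) nz V(3) Y(3,4)] semistable_sub[OF V(1,3) Y(3,4)])
  then obtain V' where V': "slope_semistable (pi * \<psi>) V'" "\<And>f. f \<in> rep_hom V' V' \<Longrightarrow> \<exists>c. \<forall>i. f i = c \<cdot>\<^sub>m 1\<^sub>m (rdim V' i)"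
    using semistable_brick by blast
  have r: "is_rep V'" "nonzero_rep V'" "Arg (Z (rep_class V')) = pi * \<psi>" using V'(1) by (auto simp: slope_semistable_def)
  obtain n x y z where d: "rdim V' Vb = n + x" "rdim V' Vmid = n + y" "rdim V' Ve = n + z" "x \<le> 1" "y \<le> 1" "z \<le> 1"
    using root_dims[OF brick_dims[OF r(1,2) V'(2)]] .
  have "Z (rep_class V') \<noteq> 0" using Im_pos[OF r(1,2)] by auto
  then have "cis (pi * \<psi>) = sgn (Z (rep_class V'))" by (rule cis_Arg[of "Z (rep_class V')", unfolded r(3)])
  also have "Z (rep_class V') = of_nat n * \<delta> + (of_nat x * a + of_nat y * m + of_nat z * e)"
    unfolding Z_rep[OF r(1)] d(1-3) \<delta> by (simp add: algebra_simps)
  finally have "cis (pi * \<psi>) = sgn (of_nat n * \<delta> + (of_nat x * a + of_nat y * m + of_nat z * e))" .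
  moreover have "of_nat k \<in> {0, 1 :: complex}" if "k \<le> 1" for k
    using that by (auto simp: le_Suc_eq)
  ultimately show ?thesis using d(4-6)
    by (intro exI[of _ n] exI[of _ "of_nat x"] exI[of _ "of_nat y"] exI[of _ "of_nat z"] conjI)
qed

lemma limit_points_subset:
  assumes "z islimpt S" shows "z \<in> {sgn \<delta>, - sgn \<delta>}"
proof -
  define I where "I = {1, -1 :: complex} \<times> {0, 1 :: complex} \<times> {0, 1 :: complex} \<times> {0, 1 :: complex}"
  define A where "A = (\<lambda>(s, x, y, z). range (\<lambda>n. s * sgn (of_nat n * \<delta> + (x * a + y * m + z * e))))"
  have "S \<subseteq> (\<Union>i\<in>I. A i)"
  proof
    fix p assume "p \<in> S"
    then obtain \<phi> X where X: "X \<in> P \<phi>" "\<not> acyclic_cpx X" "p = cis (pi * \<phi>)" unfolding S_iff by blast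
    obtain \<psi> Y where Y: "Y \<in> P \<psi>" "\<not> acyclic_cpx Y" "0 < \<psi>" "\<psi> \<le> 1"
      "cis (pi * \<phi>) = cis (pi * \<psi>) \<or> cis (pi * \<phi>) = - cis (pi * \<psi>)"
      using shift_to_heart[OF X(1,2)] by blast
    obtain n x y z where n: "x \<in> {0, 1}" "y \<in> {0, 1}" "z \<in> {0, 1}"
      "cis (pi * \<psi>) = sgn (of_nat n * \<delta> + (x * a + y * m + z * e))"
      using heart_phase[OF Y(1-4)] by blast
    obtain s where s: "s \<in> {1, -1}" "p = s * cis (pi * \<psi>)"
    proof -
      from Y(5) show thesis
      proof
        assume "cis (pi * \<phi>) = cis (pi * \<psi>)"
        then show thesis using X(3) by (intro that[of 1]) simp_all
      next
        assume "cis (pi * \<phi>) = - cis (pi * \<psi>)"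
        then show thesis using X(3) by (intro that[of "-1"]) simp_all
      qed
    qed
    have "p \<in> A (s, x, y, z)" unfolding A_def s(2) n(4) prod.case by (rule range_eqI[of _ _ n]) (rule refl)
    moreover have "(s, x, y, z) \<in> I" unfolding I_def using s(1) n(1-3) by (intro SigmaI)
    ultimately show "p \<in> (\<Union>i\<in>I. A i)" by blast
  qed
  then have "z islimpt (\<Union>i\<in>I. A i)" using assms islimpt_subset by blast
  moreover have "finite I" by (simp add: I_def)
  ultimately obtain i where i: "i \<in> I" "z islimpt A i" using islimpt_finite_UN by blast
  obtain s x y w where sx: "i = (s, x, y, w)" by (cases i)
  have "s \<in> {1, -1}" using i(1) unfolding sx I_def by (rule SigmaD1)
  then have s: "s = 1 \<or> s = -1" by simp
  have "(\<lambda>n. s * sgn (of_nat n * \<delta> + (x * a + y * m + w * e))) \<longlonglongrightarrow> s * sgn \<delta>"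
    by (intro tendsto_mult tendsto_const sgn_shift_tendsto \<delta>_nonzero)
  then have "z = s * sgn \<delta>"
    by (rule sequence_unique_limpt) (use i(2) in \<open>simp only: sx A_def prod.case\<close>)
  then show ?thesis using s by (elim disjE) simp_all
qed

text \<open>For a subrepresentation of dimension $(b, b+p, b+q)$ of \<open>preproj n\<close> the charge is
\<open>b\<delta> + pm + qe\<close> with \<open>q > 0\<close>, so its argument is strictly below that of \<open>\<delta>\<close>. This applies to the
first Harder-Narasimhan piece.\<close>

lemma preproj_phase: "\<exists>\<theta>. cis \<theta> \<in> S \<and> Arg (of_nat n * \<delta> + e) \<le> \<theta> \<and> \<theta> < Arg \<delta>"
proof -
  have nz: "nonzero_rep (preproj n :: 'k rep)" unfolding nonzero_rep_def by (intro exI[of _ Ve]) (simp add: preproj_dims)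
  obtain U g \<phi> where U: "is_rep U" "nonzero_rep U" "rep_inj U (preproj n) g" "0 < \<phi>" "\<phi> \<le> 1" "stalk U \<in> P \<phi>"
    "Arg (Z (rep_class (preproj n))) \<le> pi * \<phi>" using HN_sub[OF is_rep_preproj nz] .
  have "Z (rep_class (preproj n :: 'k rep)) = of_nat n * \<delta> + e"
    unfolding Z_rep[OF is_rep_preproj] preproj_dims \<delta> by (simp add: algebra_simps)
  then have 1: "Arg (of_nat n * \<delta> + e) \<le> pi * \<phi>" using U(7) by simp
  have AU: "Arg (Z (rep_class U)) = pi * \<phi>" by (rule stalk_phase[OF U(1,2,6,4,5)])
  note d = preproj_sub_dims[OF U(1,3)]
  let ?b = "rdim U Vb" and ?m = "rdim U Vmid" and ?e = "rdim U Ve"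
  have lt: "?b < ?e"
  proof (cases "?b = 0")
    case True
    have "?e \<noteq> 0"
    proof
      assume "?e = 0"
      then have "rdim U i = 0" for i using d(2) True by (cases i) simp_all
      then show False using U(2) by (simp add: nonzero_rep_def)
    qed
    then show ?thesis using True by simp
  next
    case False
    then show ?thesis using d(3) by simp
  qed
  obtain p where p: "?m = ?b + p" using le_Suc_ex[OF d(1)] by blast
  define q where "q = ?e - ?b"
  have q: "?e = ?b + q" "q > 0" using lt by (simp_all add: q_def)
  have ZU: "Z (rep_class U) = of_nat ?b * \<delta> + of_nat p * m + of_nat q * e"
    unfolding Z_rep[OF U(1)] p q(1) \<delta> by (simp add: algebra_simps)
  have cr: "cross m \<delta> > 0" "cross e \<delta> > 0"
    using Arg_less_iff_cross[OF simple_pos(2) Im_\<delta>] Arg_less_iff_cross[OF simple_pos(3) Im_\<delta>] Arg_m Arg_e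
    by simp_all
  have "0 \<le> of_nat p * cross m \<delta>" "0 < of_nat q * cross e \<delta>" using cr q(2) by simp_all
  then have "cross (Z (rep_class U)) \<delta> > 0"
    unfolding ZU cross_bilinear(1,3) cross_bilinear(4) by simp
  then have "pi * \<phi> < Arg \<delta>" using Arg_less_iff_cross[OF Im_pos[OF U(1,2)] Im_\<delta>] AU by simp
  moreover have "cis (pi * \<phi>) \<in> S" unfolding S_iff
    using U(6) acyclic_stalk[OF U(1)] U(2) by (intro exI[of _ \<phi>] exI[of _ "stalk U"]) simp
  ultimately show ?thesis using 1 by blast
qed

lemma limit_\<delta>: "sgn \<delta> islimpt S"
proof -
  obtain \<theta> where \<theta>: "\<And>n. cis (\<theta> n) \<in> S" "\<And>n. Arg (of_nat n * \<delta> + e) \<le> \<theta> n" "\<And>n. \<theta> n < Arg \<delta>"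
    using choice[of "\<lambda>n \<theta>. cis \<theta> \<in> S \<and> Arg (of_nat n * \<delta> + e) \<le> \<theta> \<and> \<theta> < Arg \<delta>"] preproj_phase by blast
  have im: "Im (of_nat n * \<delta> + e) > 0" for n
  proof -
    have "0 \<le> real n * Im \<delta>" using Im_\<delta> by simp
    then have "0 < real n * Im \<delta> + Im e" using simple_pos(3) by linarith
    then show ?thesis by simp
  qed
  have "(\<lambda>n. Arg (sgn (of_nat n * \<delta> + e))) \<longlonglongrightarrow> Arg (sgn \<delta>)"
  proof (rule isCont_tendsto_compose[OF continuous_at_Arg sgn_shift_tendsto])
    show "\<delta> \<noteq> 0" by (rule \<delta>_nonzero)
    have "Im (sgn \<delta>) \<noteq> 0" using Im_sgn_\<delta> by (rule less_imp_neq[symmetric])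
    then show "sgn \<delta> \<notin> \<real>\<^sub>\<le>\<^sub>0" unfolding complex_nonpos_Reals_iff by blast
  qed
  moreover have Arg_sgn: "Arg (sgn z) = Arg z" if z: "Im z > 0" for z
  proof -
    have "z \<noteq> 0" using z by (metis less_irrefl zero_complex.sel(2))
    then have "cmod z > 0" by simp
    moreover have "sgn z = z / of_real (cmod z)" by (rule sgn_eq)
    ultimately show ?thesis by (simp only: Arg_divide_of_real)
  qed
  ultimately have lim: "(\<lambda>n. Arg (of_nat n * \<delta> + e)) \<longlonglongrightarrow> Arg \<delta>"
    by (simp only: Arg_sgn[OF im] Arg_sgn[OF Im_\<delta>])
  have "\<theta> \<longlonglongrightarrow> Arg \<delta>"
  proof (rule tendsto_sandwich[OF _ _ lim tendsto_const])
    show "\<forall>\<^sub>F n in sequentially. Arg (of_nat n * \<delta> + e) \<le> \<theta> n" by (intro always_eventually allI \<theta>(2))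
    show "\<forall>\<^sub>F n in sequentially. \<theta> n \<le> Arg \<delta>" by (intro always_eventually allI less_imp_le \<theta>(3))
  qed
  then have lim: "(\<lambda>n. cis (\<theta> n)) \<longlonglongrightarrow> cis (Arg \<delta>)"
    unfolding cis_conv_exp by (intro tendsto_intros)
  note \<delta>0 = \<delta>_nonzero
  have ne: "cis (\<theta> n) \<noteq> cis (Arg \<delta>)" for n
  proof
    assume eq: "cis (\<theta> n) = cis (Arg \<delta>)"
    have "0 < Arg (of_nat n * \<delta> + e)" using Arg_lt_pi[of "of_nat n * \<delta> + e"] im[of n] by simp
    then have "0 < \<theta> n" using \<theta>(2)[of n] by linarith
    moreover have "\<theta> n < Arg \<delta>" "Arg \<delta> \<le> pi" using \<theta>(3)[of n] Arg_le_pi[of \<delta>] by simp_all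
    ultimately have "- pi < \<theta> n" "\<theta> n \<le> pi" using pi_gt_zero by linarith+
    then have 1: "Arg (cis (\<theta> n)) = \<theta> n" by (intro Arg_cis) simp
    have 2: "Arg (cis (Arg \<delta>)) = Arg \<delta>" using Arg_bounded[of \<delta>] by (intro Arg_cis) simp
    have "\<theta> n = Arg \<delta>" using arg_cong[OF eq, of Arg] unfolding 1 2 .
    then show False using \<theta>(3)[of n] by simp
  qed
  have "cis (Arg \<delta>) islimpt S"
    unfolding islimpt_sequential using lim \<theta>(1) ne by (intro exI[of _ "\<lambda>n. cis (\<theta> n)"]) simp
  then show ?thesis using cis_Arg[OF \<delta>0] by simp
qed

lemma card_limits: "card {z \<in> sphere 0 1. z islimpt S} = 2"
proof -
  note \<delta>0 = \<delta>_nonzero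
  have n: "sgn \<delta> \<in> sphere 0 1" "- sgn \<delta> \<in> sphere 0 1" using \<delta>0 by (simp_all add: norm_sgn)
  have "- sgn \<delta> islimpt S" by (rule islimpt_uminus[OF limit_\<delta> image_subsetI[OF S_uminus]])
  then have "{z \<in> sphere 0 1. z islimpt S} = {sgn \<delta>, - sgn \<delta>}"
    using limit_points_subset limit_\<delta> n by blast
  moreover have "sgn \<delta> \<noteq> - sgn \<delta>"
  proof
    assume "sgn \<delta> = - sgn \<delta>"
    then have "Im (sgn \<delta>) = - Im (sgn \<delta>)" by (metis uminus_complex.sel(2))
    then show False using Im_sgn_\<delta> by linarith
  qed
  ultimately show ?thesis by simp
qed

end

theorem lemma3p15:
  fixes Z :: "('k::alg_closed_field rep \<Rightarrow>\<^sub>0 int) set \<Rightarrow> complex"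
    and \<sigma> :: "(real \<Rightarrow> 'k cpx set) \<times> (('k cpx \<Rightarrow>\<^sub>0 int) set \<Rightarrow> complex)"
    and zE1 zM zE3 \<delta> :: complex
  defines "zE1 \<equiv> Z (rep_class (simple_rep Vb))"
    and "zM \<equiv> Z (rep_class (simple_rep Vmid))"
    and "zE3 \<equiv> Z (rep_class (simple_rep Ve))"
    and "\<delta> \<equiv> zM + zE1 + zE3"
  assumes "stability_function Z"
    and "Im zE1 > 0" and "Im zM > 0" and "Im zE3 > 0"
    and "0 < Arg zE3" and "Arg zE3 < Arg (zE3 + zM)" and "Arg (zE3 + zM) < Arg zM"
    and "Arg zM < Arg \<delta>" and "Arg \<delta> < Arg (zE1 + zM)" and "Arg (zE1 + zM) < Arg zE1"
    and "Arg zE1 < pi"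
    and "\<sigma> \<in> Stab" and "has_heart_and_charge \<sigma> Z"
  shows "card {z \<in> sphere 0 1. z islimpt stable_phases \<sigma>} = 2"
proof -
  obtain P W where \<sigma>: "\<sigma> = (P, W)" by (cases \<sigma>)
  have Z: "Z \<in> hom K_rep complex_add_group" using assms(5) by (simp add: stability_function_def)
  have Z_pos: "Im (Z (rep_class V)) > 0" if V: "is_rep V" "nonzero_rep V" for V
  proof -
    obtain i where i: "rdim V i \<noteq> 0" using V(2) by (auto simp: nonzero_rep_def)
    have "Im (Z (rep_class V)) = real (rdim V Vb) * Im zE1 + real (rdim V Vmid) * Im zM + real (rdim V Ve) * Im zE3"
      unfolding Z_dims[OF Z V(1)] zE1_def zM_def zE3_def by simp
    moreover have "0 \<le> real (rdim V Vb) * Im zE1" "0 \<le> real (rdim V Vmid) * Im zM" "0 \<le> real (rdim V Ve) * Im zE3"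
      using assms(6-8) by simp_all
    moreover have "0 < real (rdim V Vb) * Im zE1 \<or> 0 < real (rdim V Vmid) * Im zM \<or> 0 < real (rdim V Ve) * Im zE3"
      using i assms(6-8) by (cases i) simp_all
    ultimately show ?thesis by linarith
  qed
  interpret affine_stability P W Z zE1 zM zE3 \<delta>
  proof unfold_locales
    show "(P, W) \<in> Stab" "has_heart_and_charge (P, W) Z" using assms(16,17) unfolding \<sigma> .
    show "Im (Z (rep_class V)) > 0" if "is_rep V" "nonzero_rep V" for V by (rule Z_pos[OF that])
    show "Z \<in> hom K_rep complex_add_group" by (rule Z)
    show "Arg zE3 < Arg \<delta>" using assms(10-12) by linarith
  qed (fact assms zE1_def[THEN meta_eq_to_obj_eq] zM_def[THEN meta_eq_to_obj_eq]
      zE3_def[THEN meta_eq_to_obj_eq] \<delta>_def[THEN meta_eq_to_obj_eq])+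
  show ?thesis unfolding \<sigma> by (rule card_limits)
qed

end
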